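(* Let $\alpha\in(0,1)$. In the transductive networked-interference model described in the context, let $I\sim\mathrm{Unif}(\{1,\dots,N\})$ be drawn independently of all other variables, and suppose the following score-stability condition holds (conditionally on $T_I=0$): for every $j\in\mathcal H_I$ there is a finite, nonnegative, observable margin $\Delta_j^I$ that is a measurable function of $(X_{1:N},T_{1:N},I,E_j,Y_j(1))$, and does not depend on the random exposures or outcomes of other units, such that for every $t\in\mathbb R$ $$\Pr\left[V_j^{\mathrm{int}}>t\mid X_{1:N},T_{1:N},I\right]\le\Pr\left[V_j^{\mathrm{obs}}+\Delta_j^I>t\mid X_{1:N},T_{1:N},I\right].$$ Define $$\rho_{I,y}^{+}=\frac{\sum_{j\in\mathcal H_I}W_j\mathbf 1\{V_I(y)-\Delta_j^I\le V_j^{\mathrm{obs}}<V_I(y)\}}{W_I+\sum_{j\in\mathcal I_1}W_j},\qquad \Gamma_I^{\mathrm{IA-WCP}+}=\left\{y\in\mathcal Y:\ p_{I,y}^{\mathrm{obs}}>(\alpha-\rho_{I,y}^{+})_+\right\}.$$ Then $$\Pr\left[Y_I(1)\notin\Gamma_I^{\mathrm{IA-WCP}+}\ \middle|\ T_I=0\right]\le\alpha .$$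
   Context: Model. There are $N$ units $i\in\{1,\dots,N\}$. Unit $i$ has a covariate $X_i\in\mathcal X$, a binary treatment $T_i\in\{0,1\}$, an exposure $E_i\in\mathcal E$, and potential outcomes $Y_i(0),Y_i(1)\in\mathcal Y$. Write $X_{1:N}=(X_1,\dots,X_N)$, $T_{1:N}=(T_1,\dots,T_N)$, $E_{1:N}=(E_1,\dots,E_N)$. The covariates $X_1,\dots,X_N$ are i.i.d. from a distribution $P_X$ on $\mathcal X$. (Treatment assignment and overlap.) There is a function $\pi:\mathcal X\to(0,1)$ such that, conditionally on $X_{1:N}$, the treatments are independent with $T_i\sim\mathrm{Bernoulli}(\pi(X_i))$; moreover there is $\underline\pi\in(0,1/2]$ with $\underline\pi\le\pi(x)\le1-\underline\pi$ for all $x\in\mathcal X$. (Neighborhoods.) Each unit $i$ has a neighborhood $\mathcal N_i(X_{1:N})\subseteq\{1,\dots,N\}\setminus\{i\}$ which is a function of $X_{1:N}$; the relation may be directed. The rule is permutation-equivariant: for every permutation $\sigma$ of $\{1,\dots,N\}$ and every $i$, $\mathcal N_i(X_{\sigma(1)},\dots,X_{\sigma(N)})=\{j:\sigma(j)\in\mathcal N_{\sigma(i)}(X_{1:N})\}$. The local configuration of unit $i$ is the multiset $\mathcal L_i(X_{1:N},T_{1:N})=\{\{(X_j,T_j):j\in\mathcal N_i(X_{1:N})\}\}$. (Exposures.) Conditionally on $(X_{1:N},T_{1:N})$ the exposures $E_1,\dots,E_N$ are independent, and there is a common kernel $P_{E\mid X,\mathcal L}$ with $E_i\mid(X_{1:N},T_{1:N})\sim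 P_{E\mid X,\mathcal L}(\cdot\mid X_i,\mathcal L_i(X_{1:N},T_{1:N}))$ for each $i$. The exposures are observed, or exactly recoverable from $X_i$ and $\mathcal L_i(X_{1:N},T_{1:N})$. (Outcomes.) Conditionally on $(X_{1:N},E_{1:N},T_{1:N})$ the pairs $(Y_i(0),Y_i(1))_{i=1}^N$ are independent across units, and for $t\in\{0,1\}$ there is a common kernel $P_{Y(t)\mid X,E}$ with $Y_i(t)\mid(X_{1:N},E_{1:N},T_{1:N})\sim P_{Y(t)\mid X,E}(\cdot\mid X_i,E_i)$. (Consistency.) The observed outcome is $Y_i^{\mathrm{obs}}=Y_i(T_i)$. Definitions. $\mathcal I_1=\{j:T_j=1\}$. $S:\mathcal X\times\mathcal E\times\mathcal Y\to\mathbb R$ is a fixed (measurable) nonconformity score. $V_j^{\mathrm{obs}}=S(X_j,E_j,Y_j(1))$ for $j\in\mathcal I_1$, and $V_I(y)=S(X_I,E_I,y)$ for $y\in\mathcal Y$. Weights: $W_j=(1-\pi(X_j))/\pi(X_j)$ for $j\in\mathcal I_1\cup\{I\}$. For $T_I=0$, the observational conformal $p$-value is $$p_{I,y}^{\mathrm{obs}}=\frac{W_I+\sum_{j\in\mathcal I_1}W_j\mathbf 1\{V_j^{\mathrm{obs}}\ge V_I(y)\}}{W_I+\sum_{j\in\mathcal I_1}W_j}.$$ The affected calibration units are $\mathcal H_I=\{j\in\mathcal I_1:I\in\mathcal N_j(X_{1:N})\}$. Also $(x)_+=\max\{x,0\}$. Interventional variables. For $T_I=0$, let $\tilde T^I_{1:N}$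 be $T_{1:N}$ with its $I$-th entry changed to $1$ and all other entries unchanged. Conditionally on $(X_{1:N},T_{1:N},I)$, the interventional exposures $\tilde E_j^I$ are independent with $\tilde E_j^I\sim P_{E\mid X,\mathcal L}(\cdot\mid X_j,\mathcal L_j(X_{1:N},\tilde T^I_{1:N}))$, and, given these, the interventional treated outcomes $\tilde Y_j^I(1)$ are independent with $\tilde Y_j^I(1)\sim P_{Y(1)\mid X,E}(\cdot\mid X_j,\tilde E_j^I)$. The interventional scores are $V_j^{\mathrm{int}}=S(X_j,\tilde E_j^I,\tilde Y_j^I(1))$ for $j\in\mathcal I_1$. *)

theory Defs
  imports "HOL-Probability.Probability" "HOL-Combinatorics.Permutations"
begin

section \<open>Conditional probabilities given a sub-sigma-algebra\<close>

definition prob_given :: "'w measure \<Rightarrow> 'w measure \<Rightarrow> ('w \<Rightarrow> bool) \<Rightarrow> 'w \<Rightarrow> real" where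
  "prob_given M F P = real_cond_exp M F (indicator {\<omega> \<in> space M. P \<omega>})"

text \<open>The two notions below are relative to an event \<open>G\<close>, because some of the variables are
  specified only on an event of the conditioning sigma-algebra.  Taking \<open>G = space M\<close> gives
  conditional law and conditional independence without restriction.\<close>

definition cond_law_on ::
  "'w measure \<Rightarrow> 'w set \<Rightarrow> 'w measure \<Rightarrow> 'a measure \<Rightarrow> ('w \<Rightarrow> 'a) \<Rightarrow> ('w \<Rightarrow> 'a measure) \<Rightarrow> bool" where
  "cond_law_on M G F MZ Z K \<longleftrightarrow>
     (\<forall>B \<in> sets MZ. AE \<omega> in M. \<omega> \<in> G \<longrightarrow>
        prob_given M F (\<lambda>\<omega>'. Z \<omega>' \<in> B) \<omega> = measure (K \<omega>) B)"

definition cond_indep_on ::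
  "'w measure \<Rightarrow> 'w set \<Rightarrow> 'w measure \<Rightarrow> 'i set \<Rightarrow> 'a measure \<Rightarrow> ('i \<Rightarrow> 'w \<Rightarrow> 'a) \<Rightarrow> bool" where
  "cond_indep_on M G F J MZ Z \<longleftrightarrow>
     (\<forall>B \<in> J \<rightarrow> sets MZ. AE \<omega> in M. \<omega> \<in> G \<longrightarrow>
        prob_given M F (\<lambda>\<omega>'. \<forall>j\<in>J. Z j \<omega>' \<in> B j) \<omega>
          = (\<Prod>j\<in>J. prob_given M F (\<lambda>\<omega>'. Z j \<omega>' \<in> B j) \<omega>))"

section \<open>Vectors indexed by units, and local configurations\<close>

abbreviation vec_space :: "nat \<Rightarrow> 'a measure \<Rightarrow> (nat \<Rightarrow> 'a) measure" where
  "vec_space N MZ \<equiv> PiM {1..N} (\<lambda>_. MZ)"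

definition vec_of :: "nat \<Rightarrow> (nat \<Rightarrow> 'w \<Rightarrow> 'a) \<Rightarrow> 'w \<Rightarrow> (nat \<Rightarrow> 'a)" where
  "vec_of N Z \<omega> = (\<lambda>i\<in>{1..N}. Z i \<omega>)"

abbreviation bool_space :: "bool measure" where
  "bool_space \<equiv> count_space UNIV"

text \<open>Finite multisets carry the sigma-algebra generated by the counts of measurable sets,
  as is usual for point processes.\<close>

definition multiset_algebra :: "'a measure \<Rightarrow> 'a multiset measure" where
  "multiset_algebra MZ = sigma {m. set_mset m \<subseteq> space MZ}
     {{m. set_mset m \<subseteq> space MZ \<and> size (filter_mset (\<lambda>z. z \<in> B) m) = k} | B k. B \<in> sets MZ}"

definition local_config ::
  "(nat \<Rightarrow> (nat \<Rightarrow> 'x) \<Rightarrow> nat set) \<Rightarrow> nat \<Rightarrow> (nat \<Rightarrow> 'x) \<Rightarrow> (nat \<Rightarrow> bool) \<Rightarrow> ('x \<times> bool) multiset" where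
  "local_config nbhd i x t = image_mset (\<lambda>j. (x j, t j)) (mset_set (nbhd i x))"

section \<open>The networked-interference model\<close>

text \<open>\<open>Y True i\<close> and \<open>Y False i\<close> are the treated and the untreated potential outcome of unit \<open>i\<close>.
  The neighborhood \<open>nbhd i\<close> takes the covariate vector as an element of \<open>vec_space N MX\<close>;
  its measurability contains the requirement that units are not their own neighbors.\<close>

locale networked_interference = prob_space M
  for M :: "'w measure" +
  fixes N :: nat
    and MX :: "'x measure" and ME :: "'e measure" and MY :: "'y measure"
    and PX :: "'x measure"
    and \<pi> :: "'x \<Rightarrow> real" and \<pi>_min :: real
    and nbhd :: "nat \<Rightarrow> (nat \<Rightarrow> 'x) \<Rightarrow> nat set"
    and PE :: "'x \<times> ('x \<times> bool) multiset \<Rightarrow> 'e measure"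
    and PY :: "bool \<Rightarrow> 'x \<times> 'e \<Rightarrow> 'y measure"
    and X :: "nat \<Rightarrow> 'w \<Rightarrow> 'x" and T :: "nat \<Rightarrow> 'w \<Rightarrow> bool" and E :: "nat \<Rightarrow> 'w \<Rightarrow> 'e"
    and Y :: "bool \<Rightarrow> nat \<Rightarrow> 'w \<Rightarrow> 'y" and Y_obs :: "nat \<Rightarrow> 'w \<Rightarrow> 'y"
  assumes units_nonempty: "1 \<le> N"
    and X_measurable: "\<And>i. i \<in> {1..N} \<Longrightarrow> X i \<in> M \<rightarrow>\<^sub>M MX"
    and T_measurable: "\<And>i. i \<in> {1..N} \<Longrightarrow> T i \<in> M \<rightarrow>\<^sub>M bool_space"
    and E_measurable: "\<And>i. i \<in> {1..N} \<Longrightarrow> E i \<in> M \<rightarrow>\<^sub>M ME"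
    and Y_measurable: "\<And>t i. i \<in> {1..N} \<Longrightarrow> Y t i \<in> M \<rightarrow>\<^sub>M MY"
    and X_indep: "indep_vars (\<lambda>_. MX) X {1..N}"
    and X_law: "\<And>i. i \<in> {1..N} \<Longrightarrow> distr M MX (X i) = PX"
    and \<pi>_measurable: "\<pi> \<in> borel_measurable MX"
    and \<pi>_min_range: "0 < \<pi>_min" "\<pi>_min \<le> 1 / 2"
    and overlap: "\<And>x. x \<in> space MX \<Longrightarrow> \<pi>_min \<le> \<pi> x \<and> \<pi> x \<le> 1 - \<pi>_min"
    and T_cond_indep: "cond_indep_on M (space M)
          (vimage_algebra (space M) (vec_of N X) (vec_space N MX))
          {1..N} bool_space T"
    and T_cond_law: "\<And>i. i \<in> {1..N} \<Longrightarrow> cond_law_on M (space M)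
          (vimage_algebra (space M) (vec_of N X) (vec_space N MX))
          bool_space (T i) (\<lambda>\<omega>. measure_pmf (bernoulli_pmf (\<pi> (X i \<omega>))))"
    and nbhd_measurable: "\<And>i. i \<in> {1..N} \<Longrightarrow>
          nbhd i \<in> vec_space N MX \<rightarrow>\<^sub>M count_space (Pow ({1..N} - {i}))"
    and nbhd_equivariant: "\<And>\<sigma> i x. \<sigma> permutes {1..N} \<Longrightarrow> i \<in> {1..N} \<Longrightarrow> x \<in> space (vec_space N MX) \<Longrightarrow>
          nbhd i (\<lambda>k\<in>{1..N}. x (\<sigma> k)) = {j \<in> {1..N}. \<sigma> j \<in> nbhd (\<sigma> i) x}"
    and PE_kernel: "PE \<in> MX \<Otimes>\<^sub>M multiset_algebra (MX \<Otimes>\<^sub>M bool_space) \<rightarrow>\<^sub>M prob_algebra ME"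
    and E_cond_indep: "cond_indep_on M (space M)
          (vimage_algebra (space M) (\<lambda>\<omega>. (vec_of N X \<omega>, vec_of N T \<omega>))
             (vec_space N MX \<Otimes>\<^sub>M vec_space N bool_space))
          {1..N} ME E"
    and E_cond_law: "\<And>i. i \<in> {1..N} \<Longrightarrow> cond_law_on M (space M)
          (vimage_algebra (space M) (\<lambda>\<omega>. (vec_of N X \<omega>, vec_of N T \<omega>))
             (vec_space N MX \<Otimes>\<^sub>M vec_space N bool_space))
          ME (E i) (\<lambda>\<omega>. PE (X i \<omega>, local_config nbhd i (vec_of N X \<omega>) (vec_of N T \<omega>)))"
    and PY_kernel: "\<And>t. PY t \<in> MX \<Otimes>\<^sub>M ME \<rightarrow>\<^sub>M prob_algebra MY"
    and Y_cond_indep: "cond_indep_on M (space M)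
          (vimage_algebra (space M) (\<lambda>\<omega>. (vec_of N X \<omega>, vec_of N E \<omega>, vec_of N T \<omega>))
             (vec_space N MX \<Otimes>\<^sub>M vec_space N ME \<Otimes>\<^sub>M vec_space N bool_space))
          {1..N} (MY \<Otimes>\<^sub>M MY) (\<lambda>i \<omega>. (Y False i \<omega>, Y True i \<omega>))"
    and Y_cond_law: "\<And>t i. i \<in> {1..N} \<Longrightarrow> cond_law_on M (space M)
          (vimage_algebra (space M) (\<lambda>\<omega>. (vec_of N X \<omega>, vec_of N E \<omega>, vec_of N T \<omega>))
             (vec_space N MX \<Otimes>\<^sub>M vec_space N ME \<Otimes>\<^sub>M vec_space N bool_space))
          MY (Y t i) (\<lambda>\<omega>. PY t (X i \<omega>, E i \<omega>))"
    and consistency: "\<And>i \<omega>. i \<in> {1..N} \<Longrightarrow> \<omega> \<in> space M \<Longrightarrow> Y_obs i \<omega> = Y (T i \<omega>) i \<omega>"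

text \<open>The sigma-algebra generated by all covariates, all treatments and the target index.\<close>

definition design_algebra ::
  "'w measure \<Rightarrow> nat \<Rightarrow> 'x measure \<Rightarrow> (nat \<Rightarrow> 'w \<Rightarrow> 'x) \<Rightarrow> (nat \<Rightarrow> 'w \<Rightarrow> bool) \<Rightarrow> ('w \<Rightarrow> nat) \<Rightarrow> 'w measure" where
  "design_algebra M N MX X T I =
     vimage_algebra (space M) (\<lambda>\<omega>. (vec_of N X \<omega>, vec_of N T \<omega>, I \<omega>))
       (vec_space N MX \<Otimes>\<^sub>M vec_space N bool_space \<Otimes>\<^sub>M count_space {1..N})"

text \<open>\<open>E_int j\<close> and \<open>Y1_int j\<close> are the exposure and the treated outcome of unit \<open>j\<close> after the target
  unit \<open>I\<close> has been switched to treatment.  Their laws are prescribed only on the event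
  that \<open>I\<close> is untreated, and nothing is assumed about their coupling with \<open>E\<close> and \<open>Y\<close>.\<close>

locale interventional_interference =
  networked_interference M N MX ME MY PX \<pi> \<pi>_min nbhd PE PY X T E Y Y_obs
  for M :: "'w measure" and N :: nat
    and MX :: "'x measure" and ME :: "'e measure" and MY :: "'y measure"
    and PX :: "'x measure"
    and \<pi> :: "'x \<Rightarrow> real" and \<pi>_min :: real
    and nbhd :: "nat \<Rightarrow> (nat \<Rightarrow> 'x) \<Rightarrow> nat set"
    and PE :: "'x \<times> ('x \<times> bool) multiset \<Rightarrow> 'e measure"
    and PY :: "bool \<Rightarrow> 'x \<times> 'e \<Rightarrow> 'y measure"
    and X :: "nat \<Rightarrow> 'w \<Rightarrow> 'x" and T :: "nat \<Rightarrow> 'w \<Rightarrow> bool" and E :: "nat \<Rightarrow> 'w \<Rightarrow> 'e"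
    and Y :: "bool \<Rightarrow> nat \<Rightarrow> 'w \<Rightarrow> 'y" and Y_obs :: "nat \<Rightarrow> 'w \<Rightarrow> 'y" +
  fixes I :: "'w \<Rightarrow> nat" and E_int :: "nat \<Rightarrow> 'w \<Rightarrow> 'e" and Y1_int :: "nat \<Rightarrow> 'w \<Rightarrow> 'y"
  assumes I_measurable: "I \<in> M \<rightarrow>\<^sub>M count_space {1..N}"
    and I_uniform: "distr M (count_space {1..N}) I = uniform_count_measure {1..N}"
    and I_indep: "indep_set
          (sets (vimage_algebra (space M) I (count_space {1..N})))
          (sets (vimage_algebra (space M)
             (\<lambda>\<omega>. (vec_of N X \<omega>, vec_of N T \<omega>, vec_of N E \<omega>, vec_of N (Y False) \<omega>, vec_of N (Y True) \<omega>))
             (vec_space N MX \<Otimes>\<^sub>M vec_space N bool_space \<Otimes>\<^sub>M vec_space N ME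
                \<Otimes>\<^sub>M vec_space N MY \<Otimes>\<^sub>M vec_space N MY)))"
    and E_int_measurable: "\<And>j. j \<in> {1..N} \<Longrightarrow> E_int j \<in> M \<rightarrow>\<^sub>M ME"
    and Y1_int_measurable: "\<And>j. j \<in> {1..N} \<Longrightarrow> Y1_int j \<in> M \<rightarrow>\<^sub>M MY"
    and E_int_cond_indep: "cond_indep_on M {\<omega> \<in> space M. \<not> T (I \<omega>) \<omega>}
          (design_algebra M N MX X T I) {1..N} ME E_int"
    and E_int_cond_law: "\<And>j. j \<in> {1..N} \<Longrightarrow> cond_law_on M {\<omega> \<in> space M. \<not> T (I \<omega>) \<omega>}
          (design_algebra M N MX X T I) ME (E_int j)
          (\<lambda>\<omega>. PE (X j \<omega>, local_config nbhd j (vec_of N X \<omega>) ((vec_of N T \<omega>)(I \<omega> := True))))"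
    and Y1_int_cond_indep: "cond_indep_on M {\<omega> \<in> space M. \<not> T (I \<omega>) \<omega>}
          (vimage_algebra (space M) (\<lambda>\<omega>. (vec_of N X \<omega>, vec_of N T \<omega>, I \<omega>, vec_of N E_int \<omega>))
             (vec_space N MX \<Otimes>\<^sub>M vec_space N bool_space \<Otimes>\<^sub>M count_space {1..N} \<Otimes>\<^sub>M vec_space N ME))
          {1..N} MY Y1_int"
    and Y1_int_cond_law: "\<And>j. j \<in> {1..N} \<Longrightarrow> cond_law_on M {\<omega> \<in> space M. \<not> T (I \<omega>) \<omega>}
          (vimage_algebra (space M) (\<lambda>\<omega>. (vec_of N X \<omega>, vec_of N T \<omega>, I \<omega>, vec_of N E_int \<omega>))
             (vec_space N MX \<Otimes>\<^sub>M vec_space N bool_space \<Otimes>\<^sub>M count_space {1..N} \<Otimes>\<^sub>M vec_space N ME))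
          MY (Y1_int j) (\<lambda>\<omega>. PY True (X j \<omega>, E_int j \<omega>))"

section \<open>The conformal procedure\<close>

text \<open>These are functions of realized data: \<open>x\<close>, \<open>t\<close>, \<open>e\<close> and \<open>y1\<close> are the vectors of covariates,
  treatments, exposures and treated outcomes, \<open>i\<close> is the target unit and \<open>y\<close> a candidate outcome.
  Only the entries of \<open>y1\<close> at treated units are used.\<close>

definition treated :: "nat \<Rightarrow> (nat \<Rightarrow> bool) \<Rightarrow> nat set" where
  "treated N t = {j \<in> {1..N}. t j}"

definition weight :: "('x \<Rightarrow> real) \<Rightarrow> 'x \<Rightarrow> real" where
  "weight \<pi> x = (1 - \<pi> x) / \<pi> x"

definition affected ::
  "nat \<Rightarrow> (nat \<Rightarrow> (nat \<Rightarrow> 'x) \<Rightarrow> nat set) \<Rightarrow> (nat \<Rightarrow> 'x) \<Rightarrow> (nat \<Rightarrow> bool) \<Rightarrow> nat \<Rightarrow> nat set" where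
  "affected N nbhd x t i = {j \<in> treated N t. i \<in> nbhd j x}"

definition p_obs ::
  "nat \<Rightarrow> ('x \<Rightarrow> real) \<Rightarrow> ('x \<times> 'e \<times> 'y \<Rightarrow> real) \<Rightarrow> (nat \<Rightarrow> 'x) \<Rightarrow> (nat \<Rightarrow> bool) \<Rightarrow> (nat \<Rightarrow> 'e) \<Rightarrow> (nat \<Rightarrow> 'y)
     \<Rightarrow> nat \<Rightarrow> 'y \<Rightarrow> real" where
  "p_obs N \<pi> S x t e y1 i y =
     (weight \<pi> (x i) + (\<Sum>j\<in>treated N t.
         weight \<pi> (x j) * of_bool (S (x j, e j, y1 j) \<ge> S (x i, e i, y))))
     / (weight \<pi> (x i) + (\<Sum>j\<in>treated N t. weight \<pi> (x j)))"

text \<open>\<open>\<Delta> j\<close> is the stability margin of unit \<open>j\<close>; its arguments are all covariates, all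
  treatments, the target unit, and the exposure and treated outcome of \<open>j\<close> alone.\<close>

definition rho_plus ::
  "nat \<Rightarrow> ('x \<Rightarrow> real) \<Rightarrow> (nat \<Rightarrow> (nat \<Rightarrow> 'x) \<Rightarrow> nat set) \<Rightarrow> ('x \<times> 'e \<times> 'y \<Rightarrow> real)
     \<Rightarrow> (nat \<Rightarrow> (nat \<Rightarrow> 'x) \<times> (nat \<Rightarrow> bool) \<times> nat \<times> 'e \<times> 'y \<Rightarrow> real)
     \<Rightarrow> (nat \<Rightarrow> 'x) \<Rightarrow> (nat \<Rightarrow> bool) \<Rightarrow> (nat \<Rightarrow> 'e) \<Rightarrow> (nat \<Rightarrow> 'y) \<Rightarrow> nat \<Rightarrow> 'y \<Rightarrow> real" where
  "rho_plus N \<pi> nbhd S \<Delta> x t e y1 i y =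
     (\<Sum>j\<in>affected N nbhd x t i. weight \<pi> (x j) *
         of_bool (S (x i, e i, y) - \<Delta> j (x, t, i, e j, y1 j) \<le> S (x j, e j, y1 j)
                  \<and> S (x j, e j, y1 j) < S (x i, e i, y)))
     / (weight \<pi> (x i) + (\<Sum>j\<in>treated N t. weight \<pi> (x j)))"

definition IA_WCP_plus ::
  "real \<Rightarrow> 'y measure \<Rightarrow> nat \<Rightarrow> ('x \<Rightarrow> real) \<Rightarrow> (nat \<Rightarrow> (nat \<Rightarrow> 'x) \<Rightarrow> nat set) \<Rightarrow> ('x \<times> 'e \<times> 'y \<Rightarrow> real)
     \<Rightarrow> (nat \<Rightarrow> (nat \<Rightarrow> 'x) \<times> (nat \<Rightarrow> bool) \<times> nat \<times> 'e \<times> 'y \<Rightarrow> real)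
     \<Rightarrow> (nat \<Rightarrow> 'x) \<Rightarrow> (nat \<Rightarrow> bool) \<Rightarrow> (nat \<Rightarrow> 'e) \<Rightarrow> (nat \<Rightarrow> 'y) \<Rightarrow> nat \<Rightarrow> 'y set" where
  "IA_WCP_plus \<alpha> MY N \<pi> nbhd S \<Delta> x t e y1 i =
     {y \<in> space MY. p_obs N \<pi> S x t e y1 i y
        > max (\<alpha> - rho_plus N \<pi> nbhd S \<Delta> x t e y1 i y) 0}"

section \<open>Score stability\<close>

text \<open>On the event that the target is untreated, for each affected unit \<open>j\<close> the
  interventional score is, conditionally on the design, stochastically dominated by the
  observed score plus its margin.  Both conditional probabilities are versions, so each
  threshold comes with its own null set.\<close>

definition score_stability ::
  "'w measure \<Rightarrow> nat \<Rightarrow> 'x measure \<Rightarrow> 'e measure \<Rightarrow> 'y measure \<Rightarrow> (nat \<Rightarrow> (nat \<Rightarrow> 'x) \<Rightarrow> nat set)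
     \<Rightarrow> ('x \<times> 'e \<times> 'y \<Rightarrow> real)
     \<Rightarrow> (nat \<Rightarrow> 'w \<Rightarrow> 'x) \<Rightarrow> (nat \<Rightarrow> 'w \<Rightarrow> bool) \<Rightarrow> (nat \<Rightarrow> 'w \<Rightarrow> 'e) \<Rightarrow> (bool \<Rightarrow> nat \<Rightarrow> 'w \<Rightarrow> 'y)
     \<Rightarrow> ('w \<Rightarrow> nat) \<Rightarrow> (nat \<Rightarrow> 'w \<Rightarrow> 'e) \<Rightarrow> (nat \<Rightarrow> 'w \<Rightarrow> 'y)
     \<Rightarrow> (nat \<Rightarrow> (nat \<Rightarrow> 'x) \<times> (nat \<Rightarrow> bool) \<times> nat \<times> 'e \<times> 'y \<Rightarrow> real) \<Rightarrow> bool" where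
  "score_stability M N MX ME MY nbhd S X T E Y I E_int Y1_int \<Delta> \<longleftrightarrow>
     (\<forall>j\<in>{1..N}.
        \<Delta> j \<in> borel_measurable
          (vec_space N MX \<Otimes>\<^sub>M vec_space N bool_space \<Otimes>\<^sub>M count_space {1..N} \<Otimes>\<^sub>M ME \<Otimes>\<^sub>M MY)
      \<and> (\<forall>\<omega>\<in>space M. \<not> T (I \<omega>) \<omega> \<and> j \<in> affected N nbhd (vec_of N X \<omega>) (vec_of N T \<omega>) (I \<omega>) \<longrightarrow>
            0 \<le> \<Delta> j (vec_of N X \<omega>, vec_of N T \<omega>, I \<omega>, E j \<omega>, Y True j \<omega>))
      \<and> (\<forall>s::real. AE \<omega> in M.
            \<not> T (I \<omega>) \<omega> \<and> j \<in> affected N nbhd (vec_of N X \<omega>) (vec_of N T \<omega>) (I \<omega>) \<longrightarrow>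
              prob_given M (design_algebra M N MX X T I)
                (\<lambda>\<omega>'. S (X j \<omega>', E_int j \<omega>', Y1_int j \<omega>') > s) \<omega>
              \<le> prob_given M (design_algebra M N MX X T I)
                (\<lambda>\<omega>'. S (X j \<omega>', E j \<omega>', Y True j \<omega>')
                  + \<Delta> j (vec_of N X \<omega>', vec_of N T \<omega>', I \<omega>', E j \<omega>', Y True j \<omega>') > s) \<omega>))"

end

theory Submission
  imports Defs
begin

text \<open>
  Switching the target unit \<open>i\<close> from untreated to treated multiplies the density of the treatment
  law by the odds weight of \<open>i\<close>, so the law of covariates, treatments, exposures and outcomes
  after the switch, restricted to \<open>i\<close> untreated, is the weighted original law restricted to
  \<open>i\<close> treated.  Averaged over the random target, the interventional weighted p-value is
  therefore superuniform by the deterministic fact that, for any scores, the units whose weighted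
  upper rank is at most \<open>c\<close> have total weight at most \<open>c\<close>.  Given the design, scores are independent across units, so replacing the
  interventional law of an affected score by that of the observed score plus its margin, one
  unit at a time, can only increase the weighted rank stochastically.  The observed p-value plus
  \<open>\<rho>\<^sup>+\<close> dominates the p-value of the inflated scores.
\<close>

section \<open>Disintegration along conditional laws\<close>

text \<open>The hypotheses give conditional laws only as versions, with a separate null set for each
  event. They are therefore used under integrals: kernels reproduce the probabilities of rectangles,
  hence the integrals of all nonnegative measurable functions. The world after the switch is
  represented by the same unit kernels evaluated at the switched design, so no coupling with the
  observed world has to be built.

  The argument does not control the error for one fixed target. It bounds the sum over treated units
  of weight times the indicator of a small rank, and a uniform independent \<open>I\<close> makes an
  average over units into a probability. The change of treatment is used twice: with the rank event
  as integrand, and with the constant 1, where it says that the expected total weight of the treated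
  units is the expected number of untreated ones. The second use turns the bound into \<alpha> times
  the probability that the target is untreated.

  The comparison for one target is exact in two respects: the denominator of its p-value is the
  total weight of the switched design, and its own kernel is unchanged because it is not its own
  neighbor.\<close>

text \<open>Two measures on the product space are compared: the law of \<open>(D, Z)\<close> on the
  event \<open>D \<in> G\<close>, and the law of \<open>D\<close> on that event followed by
  \<open>K\<close>. They agree on rectangles over the intersection-stable generator, hence
  everywhere. Requiring \<open>rect\<close> only for \<open>C \<subseteq> G\<close> admits kernels
  that describe \<open>Z\<close> on part of the space only.\<close>

lemma nn_integral_disintegration:
  assumes D [measurable]: "D \<in> M \<rightarrow>\<^sub>M MD" and Z [measurable]: "Z \<in> M \<rightarrow>\<^sub>M MZ"
    and K [measurable]: "K \<in> MD \<rightarrow>\<^sub>M prob_algebra MZ"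
    and G [measurable]: "G \<in> sets MD"
    and M: "finite_measure M" "space M \<noteq> {}"
    and gen: "sets MZ = sigma_sets (space MZ) \<G>" "Int_stable \<G>" "\<G> \<subseteq> Pow (space MZ)" "space MZ \<in> \<G>"
    and rect: "\<And>C B. C \<in> sets MD \<Longrightarrow> C \<subseteq> G \<Longrightarrow> B \<in> \<G> \<Longrightarrow>
      emeasure M {\<omega> \<in> space M. D \<omega> \<in> C \<and> Z \<omega> \<in> B}
        = (\<integral>\<^sup>+\<omega>. indicator C (D \<omega>) * emeasure (K (D \<omega>)) B \<partial>M)"
    and f [measurable]: "f \<in> borel_measurable (MD \<Otimes>\<^sub>M MZ)"
  shows "(\<integral>\<^sup>+\<omega>. indicator G (D \<omega>) * f (D \<omega>, Z \<omega>) \<partial>M)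
    = (\<integral>\<^sup>+\<omega>. indicator G (D \<omega>) * (\<integral>\<^sup>+z. f (D \<omega>, z) \<partial>K (D \<omega>)) \<partial>M)"
proof -
  interpret finite_measure M by fact
  \<comment> \<open>The restriction to \<open>G\<close> is put into the base measure, so that both
    sides become integrals against ordinary measures on the product.\<close>
  define M' where "M' = density M (\<lambda>\<omega>. indicator G (D \<omega>) :: ennreal)"
  define K' where "K' = (\<lambda>d. distr (K d) (MD \<Otimes>\<^sub>M MZ) (Pair d))"
  define \<mu>1 where "\<mu>1 = distr M' (MD \<Otimes>\<^sub>M MZ) (\<lambda>\<omega>. (D \<omega>, Z \<omega>))"
  define \<mu>2 where "\<mu>2 = distr M' MD D \<bind> K'"
  have M'_sets [measurable_cong, simp]: "sets M' = sets M" by (simp add: M'_def)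
  have K' [measurable]: "K' \<in> MD \<rightarrow>\<^sub>M subprob_algebra (MD \<Otimes>\<^sub>M MZ)"
    unfolding K'_def by (intro measurable_prob_algebraD) measurable
  have sK: "sets (K d) = sets MZ" "prob_space (K d)" if "d \<in> space MD" for d
    using measurable_space[OF K that] by (auto simp: space_prob_algebra)
  have [measurable]: "(\<lambda>d. emeasure (K d) B) \<in> borel_measurable MD" if "B \<in> sets MZ" for B
    using measurable_prob_algebraD[OF K] that by measurable
  have ne: "space (distr M' MD D) \<noteq> {}"
    using M(2) measurable_space[OF D] by auto
  have \<G>_sets: "B \<in> sets MZ" if "B \<in> \<G>" for B
    using gen(1) that by auto
  have int1: "(\<integral>\<^sup>+p. g p \<partial>\<mu>1) = (\<integral>\<^sup>+\<omega>. indicator G (D \<omega>) * g (D \<omega>, Z \<omega>) \<partial>M)"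
    if [measurable]: "g \<in> borel_measurable (MD \<Otimes>\<^sub>M MZ)" for g
    unfolding \<mu>1_def M'_def by (simp add: nn_integral_distr nn_integral_density)
  have int2: "(\<integral>\<^sup>+p. g p \<partial>\<mu>2) = (\<integral>\<^sup>+\<omega>. indicator G (D \<omega>) * (\<integral>\<^sup>+z. g (D \<omega>, z) \<partial>K (D \<omega>)) \<partial>M)"
    if g [measurable]: "g \<in> borel_measurable (MD \<Otimes>\<^sub>M MZ)" for g
  proof -
    have [measurable]: "(\<lambda>d. \<integral>\<^sup>+z. g (d, z) \<partial>K d) \<in> borel_measurable MD"
      by (rule nn_integral_measurable_subprob_algebra2[where N = MZ]) (use measurable_prob_algebraD[OF K] in auto)
    have "(\<integral>\<^sup>+p. g p \<partial>\<mu>2) = (\<integral>\<^sup>+d. \<integral>\<^sup>+p. g p \<partial>K' d \<partial>distr M' MD D)"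
      unfolding \<mu>2_def by (rule nn_integral_bind[where B = "MD \<Otimes>\<^sub>M MZ"]) auto
    also have "\<dots> = (\<integral>\<^sup>+d. (\<integral>\<^sup>+z. g (d, z) \<partial>K d) \<partial>distr M' MD D)"
    proof (rule nn_integral_cong)
      fix d assume "d \<in> space (distr M' MD D)"
      then have d: "d \<in> space MD" by simp
      have [measurable]: "Pair d \<in> K d \<rightarrow>\<^sub>M MD \<Otimes>\<^sub>M MZ"
        using sK(1)[OF d] d by (simp cong: measurable_cong_sets)
      show "(\<integral>\<^sup>+p. g p \<partial>K' d) = (\<integral>\<^sup>+z. g (d, z) \<partial>K d)"
        unfolding K'_def by (subst nn_integral_distr) auto
    qed
    also have "\<dots> = (\<integral>\<^sup>+\<omega>. (\<integral>\<^sup>+z. g (D \<omega>, z) \<partial>K (D \<omega>)) \<partial>M')"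
      by (subst nn_integral_distr) auto
    also have "\<dots> = (\<integral>\<^sup>+\<omega>. indicator G (D \<omega>) * (\<integral>\<^sup>+z. g (D \<omega>, z) \<partial>K (D \<omega>)) \<partial>M)"
      unfolding M'_def by (subst nn_integral_density) auto
    finally show ?thesis .
  qed
  have sets1: "sets \<mu>1 = sets (MD \<Otimes>\<^sub>M MZ)" by (simp add: \<mu>1_def)
  have sets2: "sets \<mu>2 = sets (MD \<Otimes>\<^sub>M MZ)"
    unfolding \<mu>2_def using ne by (intro sets_bind) (auto simp: K'_def)
  let ?E = "{C \<times> B | C B. C \<in> sets MD \<and> B \<in> \<G>}"
  have sp: "sets (MD \<Otimes>\<^sub>M MZ) = sigma_sets (space MD \<times> space MZ) ?E"
  proof -
    have "sets (MD \<Otimes>\<^sub>M MZ) = sets (sigma (space MD \<times> space MZ) ?E)"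
      by (rule sets_pair_eq[where Ca = "{space MD}" and Cb = "{space MZ}"])
         (use gen in \<open>auto simp: sets.space_closed sets.sigma_sets_eq\<close>)
    also have "\<dots> = sigma_sets (space MD \<times> space MZ) ?E"
      using gen(3) sets.space_closed[of MD] by (intro sets_measure_of) blast
    finally show ?thesis .
  qed
  have em: "emeasure \<mu> A = (\<integral>\<^sup>+p. indicator A p \<partial>\<mu>)" if "sets \<mu> = sets (MD \<Otimes>\<^sub>M MZ)" "A \<in> sets (MD \<Otimes>\<^sub>M MZ)"
    for \<mu> :: "('b \<times> 'c) measure" and A using that by simp
  have "\<mu>1 = \<mu>2"
  proof (rule measure_eqI_generator_eq_countable)
    show "Int_stable ?E"
    proof (rule Int_stableI, clarify)
      fix C B C' B' assume *: "C \<in> sets MD" "B \<in> \<G>" "C' \<in> sets MD" "B' \<in> \<G>"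
      have "B \<inter> B' \<in> \<G>" using gen(2) * by (auto simp: Int_stable_def)
      then show "\<exists>C'' B''. C \<times> B \<inter> C' \<times> B' = C'' \<times> B'' \<and> C'' \<in> sets MD \<and> B'' \<in> \<G>"
        using * by (intro exI[of _ "C \<inter> C'"] exI[of _ "B \<inter> B'"]) auto
    qed
    show "?E \<subseteq> Pow (space MD \<times> space MZ)"
      using gen(3) sets.space_closed[of MD] by blast
    show "sets \<mu>1 = sigma_sets (space MD \<times> space MZ) ?E" "sets \<mu>2 = sigma_sets (space MD \<times> space MZ) ?E"
      using sets1 sets2 sp by auto
    show "{space MD \<times> space MZ} \<subseteq> ?E" using gen(4) by auto
    show "emeasure \<mu>1 a \<noteq> \<infinity>" if "a \<in> {space MD \<times> space MZ}" for a
    proof -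
      have "emeasure \<mu>1 a = (\<integral>\<^sup>+\<omega>. indicator G (D \<omega>) * indicator a (D \<omega>, Z \<omega>) \<partial>M)"
        using that by (subst em[OF sets1]) (auto intro!: int1)
      also have "\<dots> \<le> (\<integral>\<^sup>+\<omega>. 1 \<partial>M)" by (intro nn_integral_mono) (auto split: split_indicator)
      also have "\<dots> < \<infinity>" by (simp add: less_top[symmetric])
      finally show ?thesis by simp
    qed
    fix A assume "A \<in> ?E"
    then obtain C B where A: "A = C \<times> B" and C [measurable]: "C \<in> sets MD" and B: "B \<in> \<G>" by auto
    have [measurable]: "B \<in> sets MZ" using \<G>_sets[OF B] .
    have "emeasure \<mu>1 A = (\<integral>\<^sup>+\<omega>. indicator G (D \<omega>) * indicator A (D \<omega>, Z \<omega>) \<partial>M)"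
      by (subst em[OF sets1]) (auto simp: A intro!: int1)
    also have "\<dots> = (\<integral>\<^sup>+\<omega>. indicator {\<omega> \<in> space M. D \<omega> \<in> C \<inter> G \<and> Z \<omega> \<in> B} \<omega> \<partial>M)"
      by (intro nn_integral_cong) (auto simp: A split: split_indicator)
    also have "\<dots> = emeasure M {\<omega> \<in> space M. D \<omega> \<in> C \<inter> G \<and> Z \<omega> \<in> B}" by simp
    \<comment> \<open>The rectangle identity is available only below \<open>G\<close>, which is why
      \<open>C\<close> was cut down to \<open>C \<inter> G\<close>.\<close>
    also have "\<dots> = (\<integral>\<^sup>+\<omega>. indicator (C \<inter> G) (D \<omega>) * emeasure (K (D \<omega>)) B \<partial>M)"
      using B by (intro rect) auto
    also have "\<dots> = (\<integral>\<^sup>+\<omega>. indicator G (D \<omega>) * (\<integral>\<^sup>+z. indicator A (D \<omega>, z) \<partial>K (D \<omega>)) \<partial>M)"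
    proof (rule nn_integral_cong)
      fix \<omega> assume "\<omega> \<in> space M"
      then have "D \<omega> \<in> space MD" using measurable_space[OF D] by auto
      then have [measurable]: "B \<in> sets (K (D \<omega>))" using sK \<open>B \<in> sets MZ\<close> by auto
      have "(\<integral>\<^sup>+z. indicator A (D \<omega>, z) \<partial>K (D \<omega>)) = (\<integral>\<^sup>+z. indicator C (D \<omega>) * indicator B z \<partial>K (D \<omega>))"
        by (intro nn_integral_cong) (auto simp: A split: split_indicator)
      also have "\<dots> = indicator C (D \<omega>) * emeasure (K (D \<omega>)) B"
        by (simp add: nn_integral_cmult)
      finally show "indicator (C \<inter> G) (D \<omega>) * emeasure (K (D \<omega>)) B =
          indicator G (D \<omega>) * (\<integral>\<^sup>+z. indicator A (D \<omega>, z) \<partial>K (D \<omega>))"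
        by (auto split: split_indicator)
    qed
    also have "\<dots> = emeasure \<mu>2 A"
      by (subst em[OF sets2]) (auto simp: A intro!: int2[symmetric])
    finally show "emeasure \<mu>1 A = emeasure \<mu>2 A" .
  qed auto
  then show ?thesis using int1[OF f] int2[OF f] by simp
qed

section \<open>Finite products of probability measures and of kernels\<close>

text \<open>\<open>product_sigma_finite\<close> constrains every index of the type, whereas the
  factors are known to be probability measures on \<open>I\<close> only. Putting a one-point
  probability space at all other indices leaves \<open>PiM I\<close> unchanged.\<close>

lemma PiM_prob_eq_total:
  assumes "\<And>i. i \<in> I \<Longrightarrow> prob_space (P i)"
  obtains P' where "PiM I P = PiM I P'" "product_sigma_finite P'" "\<And>i. i \<in> I \<Longrightarrow> P' i = P i" "\<And>i. prob_space (P' i)"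
proof
  let ?P' = "\<lambda>i. if i \<in> I then P i else count_space {undefined}"
  show "PiM I P = PiM I ?P'" by (rule PiM_cong) auto
  show *: "prob_space (?P' i)" for i using assms by (auto intro!: prob_spaceI)
  show "product_sigma_finite ?P'"
    unfolding product_sigma_finite_def by (intro allI prob_space_imp_sigma_finite *)
qed auto

lemma emeasure_PiM_prob:
  assumes "finite I" "\<And>i. i \<in> I \<Longrightarrow> prob_space (P i)" "\<And>i. i \<in> I \<Longrightarrow> A i \<in> sets (P i)"
  shows "emeasure (PiM I P) (PiE I A) = (\<Prod>i\<in>I. emeasure (P i) (A i))"
proof -
  obtain P' where P': "PiM I P = PiM I P'" "product_sigma_finite P'" "\<And>i. i \<in> I \<Longrightarrow> P' i = P i" "\<And>i. prob_space (P' i)"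
    using PiM_prob_eq_total assms(2) by blast
  show ?thesis
    using product_sigma_finite.emeasure_PiM[OF P'(2), of I A] assms P' by simp
qed

lemma nn_integral_PiM_prod_prob:
  assumes "finite I" "\<And>i. i \<in> I \<Longrightarrow> prob_space (P i)" "\<And>i. i \<in> I \<Longrightarrow> f i \<in> borel_measurable (P i)"
  shows "(\<integral>\<^sup>+x. (\<Prod>i\<in>I. f i (x i)) \<partial>PiM I P) = (\<Prod>i\<in>I. integral\<^sup>N (P i) (f i))"
proof -
  obtain P' where P': "PiM I P = PiM I P'" "product_sigma_finite P'" "\<And>i. i \<in> I \<Longrightarrow> P' i = P i" "\<And>i. prob_space (P' i)"
    using PiM_prob_eq_total assms(2) by blast
  show ?thesis
    using product_sigma_finite.product_nn_integral_prod[OF P'(2), of I f] assms P' by simp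
qed

lemma nn_integral_PiM_insert_prob:
  assumes "finite I" "i \<notin> I" "\<And>j. j \<in> insert i I \<Longrightarrow> prob_space (P j)"
    and "f \<in> borel_measurable (PiM (insert i I) P)"
  shows "integral\<^sup>N (PiM (insert i I) P) f = (\<integral>\<^sup>+y. (\<integral>\<^sup>+x. f (x(i := y)) \<partial>PiM I P) \<partial>P i)"
    and "integral\<^sup>N (PiM (insert i I) P) f = (\<integral>\<^sup>+x. (\<integral>\<^sup>+y. f (x(i := y)) \<partial>P i) \<partial>PiM I P)"
proof -
  obtain P' where P': "PiM (insert i I) P = PiM (insert i I) P'" "product_sigma_finite P'"
      "\<And>j. j \<in> insert i I \<Longrightarrow> P' j = P j" "\<And>i. prob_space (P' i)"
    using PiM_prob_eq_total assms(3) by blast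
  have *: "PiM I P = PiM I P'" by (rule PiM_cong) (use P' in auto)
  show "integral\<^sup>N (PiM (insert i I) P) f = (\<integral>\<^sup>+y. (\<integral>\<^sup>+x. f (x(i := y)) \<partial>PiM I P) \<partial>P i)"
    using product_sigma_finite.product_nn_integral_insert_rev[OF P'(2), of I i f] assms P' * by simp
  show "integral\<^sup>N (PiM (insert i I) P) f = (\<integral>\<^sup>+x. (\<integral>\<^sup>+y. f (x(i := y)) \<partial>P i) \<partial>PiM I P)"
    using product_sigma_finite.product_nn_integral_insert[OF P'(2), of I i f] assms P' * by simp
qed

text \<open>Measurability of a probability kernel can be checked on an intersection-stable
  generator. On rectangles the product kernel is a finite product of measurable functions.\<close>

lemma measurable_PiM_prob_algebra [measurable (raw)]:
  assumes J: "finite J" and K: "\<And>j. j \<in> J \<Longrightarrow> K j \<in> MD \<rightarrow>\<^sub>M prob_algebra (MZ j)"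
  shows "(\<lambda>d. PiM J (\<lambda>j. K j d)) \<in> MD \<rightarrow>\<^sub>M prob_algebra (PiM J MZ)"
proof (rule measurable_prob_algebra_generated)
  have sK: "sets (K j d) = sets (MZ j)" "prob_space (K j d)" if "d \<in> space MD" "j \<in> J" for d j
    using measurable_space[OF K that(1)] that(2) by (auto simp: space_prob_algebra)
  show "sets (PiM J MZ) = sigma_sets (\<Pi>\<^sub>E i\<in>J. space (MZ i)) (prod_algebra J MZ)" by (rule sets_PiM)
  show "Int_stable (prod_algebra J MZ)" by (rule Int_stable_prod_algebra)
  show "prod_algebra J MZ \<subseteq> Pow (\<Pi>\<^sub>E i\<in>J. space (MZ i))" by (rule prod_algebra_sets_into_space)
  show "prob_space (PiM J (\<lambda>j. K j d))" if "d \<in> space MD" for d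
    using sK that by (intro prob_space_PiM) auto
  show "sets (PiM J (\<lambda>j. K j d)) = sets (PiM J MZ)" if "d \<in> space MD" for d
    using sK that by (intro sets_PiM_cong) auto
  fix A assume "A \<in> prod_algebra J MZ"
  then obtain B where A: "A = PiE J B" and B: "\<And>j. j \<in> J \<Longrightarrow> B j \<in> sets (MZ j)"
    unfolding prod_algebra_eq_finite[OF J] by auto
  have "(\<lambda>d. \<Prod>j\<in>J. emeasure (K j d) (B j)) \<in> borel_measurable MD"
    using K B measurable_prob_algebraD[OF K]
    by (intro borel_measurable_prod_ennreal measurable_compose[OF measurable_prob_algebraD[OF K] measurable_emeasure_subprob_algebra]) auto
  also have "?this \<longleftrightarrow> (\<lambda>d. emeasure (PiM J (\<lambda>j. K j d)) A) \<in> borel_measurable MD"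
    unfolding A using sK B J by (intro measurable_cong) (auto simp: emeasure_PiM_prob)
  finally show "(\<lambda>d. emeasure (PiM J (\<lambda>j. K j d)) A) \<in> borel_measurable MD" .
qed

lemma nn_integral_disintegration_PiM:
  assumes J: "finite J"
    and D [measurable]: "D \<in> M \<rightarrow>\<^sub>M MD" and Z [measurable]: "\<And>j. j \<in> J \<Longrightarrow> Z j \<in> M \<rightarrow>\<^sub>M MZ"
    and K [measurable]: "\<And>j. j \<in> J \<Longrightarrow> K j \<in> MD \<rightarrow>\<^sub>M prob_algebra MZ"
    and G: "G \<in> sets MD"
    and M: "finite_measure M" "space M \<noteq> {}"
    and rect: "\<And>C B. C \<in> sets MD \<Longrightarrow> C \<subseteq> G \<Longrightarrow> B \<in> J \<rightarrow> sets MZ \<Longrightarrow>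
      emeasure M {\<omega> \<in> space M. D \<omega> \<in> C \<and> (\<forall>j\<in>J. Z j \<omega> \<in> B j)}
        = (\<integral>\<^sup>+\<omega>. indicator C (D \<omega>) * (\<Prod>j\<in>J. emeasure (K j (D \<omega>)) (B j)) \<partial>M)"
    and f: "f \<in> borel_measurable (MD \<Otimes>\<^sub>M PiM J (\<lambda>_. MZ))"
  shows "(\<integral>\<^sup>+\<omega>. indicator G (D \<omega>) * f (D \<omega>, \<lambda>j\<in>J. Z j \<omega>) \<partial>M)
    = (\<integral>\<^sup>+\<omega>. indicator G (D \<omega>) * (\<integral>\<^sup>+z. f (D \<omega>, z) \<partial>PiM J (\<lambda>j. K j (D \<omega>))) \<partial>M)"
proof -
  have sK: "sets (K j d) = sets MZ" "prob_space (K j d)" if "d \<in> space MD" "j \<in> J" for d j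
    using measurable_space[OF K that(1)] that(2) by (auto simp: space_prob_algebra)
  show ?thesis
  proof (rule nn_integral_disintegration[OF D _ _ G M _ Int_stable_prod_algebra _ _ _ f])
    show "(\<lambda>\<omega>. \<lambda>j\<in>J. Z j \<omega>) \<in> M \<rightarrow>\<^sub>M PiM J (\<lambda>_. MZ)" by measurable
    show "(\<lambda>d. PiM J (\<lambda>j. K j d)) \<in> MD \<rightarrow>\<^sub>M prob_algebra (PiM J (\<lambda>_. MZ))"
      using J by measurable
    show "sets (PiM J (\<lambda>_. MZ)) = sigma_sets (space (PiM J (\<lambda>_. MZ))) (prod_algebra J (\<lambda>_. MZ))"
      by (simp add: sets_PiM space_PiM)
    show "prod_algebra J (\<lambda>_. MZ) \<subseteq> Pow (space (PiM J (\<lambda>_. MZ)))"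
      using prod_algebra_sets_into_space by (simp add: space_PiM)
    show "space (PiM J (\<lambda>_. MZ)) \<in> prod_algebra J (\<lambda>_. MZ)"
      unfolding prod_algebra_eq_finite[OF J] by (auto simp: space_PiM)
    fix C A assume C: "C \<in> sets MD" "C \<subseteq> G" and "A \<in> prod_algebra J (\<lambda>_. MZ)"
    then obtain B where A: "A = PiE J B" and B: "B \<in> J \<rightarrow> sets MZ"
      unfolding prod_algebra_eq_finite[OF J] by auto
    have "{\<omega> \<in> space M. D \<omega> \<in> C \<and> (\<lambda>j\<in>J. Z j \<omega>) \<in> A} = {\<omega> \<in> space M. D \<omega> \<in> C \<and> (\<forall>j\<in>J. Z j \<omega> \<in> B j)}"
      by (auto simp: A PiE_iff)
    then show "emeasure M {\<omega> \<in> space M. D \<omega> \<in> C \<and> (\<lambda>j\<in>J. Z j \<omega>) \<in> A}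
        = (\<integral>\<^sup>+\<omega>. indicator C (D \<omega>) * emeasure (PiM J (\<lambda>j. K j (D \<omega>))) A \<partial>M)"
      using rect[OF C B] measurable_space[OF D] sK B J
      by (auto simp: A emeasure_PiM_prob Pi_iff intro!: nn_integral_cong)
  qed
qed

section \<open>From versions of conditional probabilities to kernel integrals\<close>

text \<open>This is the defining property of conditional expectation on the event
  \<open>D \<in> C\<close>. A version is nonnegative only almost everywhere, which suffices to pass
  from the Bochner integral to the nonnegative one.\<close>

lemma emeasure_prob_given:
  assumes M: "prob_space M" and D [measurable]: "D \<in> M \<rightarrow>\<^sub>M MD"
    and P [measurable]: "{\<omega> \<in> space M. P \<omega>} \<in> sets M" and C [measurable]: "C \<in> sets MD"
  defines "F \<equiv> vimage_algebra (space M) D MD"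
  shows "emeasure M {\<omega> \<in> space M. D \<omega> \<in> C \<and> P \<omega>}
    = (\<integral>\<^sup>+\<omega>. indicator C (D \<omega>) * ennreal (prob_given M F P \<omega>) \<partial>M)"
proof -
  interpret prob_space M by fact
  have "subalgebra M F"
    unfolding subalgebra_def F_def using measurable_space[OF D] measurable_sets[OF D]
    by (auto simp: sets_vimage_algebra2 Pi_iff)
  then interpret finite_measure_subalgebra M F by unfold_locales
  define A where "A = D -` C \<inter> space M"
  have A: "A \<in> sets F" "A \<in> sets M"
    unfolding A_def F_def by (auto intro!: in_vimage_algebra)
  let ?f = "indicator {\<omega> \<in> space M. P \<omega>} :: _ \<Rightarrow> real"
  have f: "integrable M ?f"
    using P by (intro integrable_real_indicator) (auto simp: less_top[symmetric])
  have g: "integrable M (real_cond_exp M F ?f)" "AE \<omega> in M. 0 \<le> real_cond_exp M F ?f \<omega>"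
    using real_cond_exp_int(1)[OF f] real_cond_exp_pos[of ?f] by auto
  have "measure M {\<omega> \<in> space M. D \<omega> \<in> C \<and> P \<omega>} = (\<integral>\<omega>. indicator {\<omega> \<in> space M. D \<omega> \<in> C \<and> P \<omega>} \<omega> \<partial>M)"
    by simp
  also have "\<dots> = (\<integral>\<omega>\<in>A. ?f \<omega> \<partial>M)"
    unfolding set_lebesgue_integral_def
    by (intro Bochner_Integration.integral_cong) (auto simp: A_def split: split_indicator)
  also have "\<dots> = (\<integral>\<omega>\<in>A. real_cond_exp M F ?f \<omega> \<partial>M)"
    by (rule real_cond_exp_intA[OF f A(1)])
  finally have "emeasure M {\<omega> \<in> space M. D \<omega> \<in> C \<and> P \<omega>} = ennreal (\<integral>\<omega>. indicator A \<omega> * real_cond_exp M F ?f \<omega> \<partial>M)"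
    by (simp add: emeasure_eq_measure set_lebesgue_integral_def)
  also have "\<dots> = (\<integral>\<^sup>+\<omega>. ennreal (indicator A \<omega> * real_cond_exp M F ?f \<omega>) \<partial>M)"
    using g A(2) integrable_mult_indicator[OF A(2) g(1)]
    by (intro nn_integral_eq_integral[symmetric]) (auto elim!: eventually_mono)
  also have "\<dots> = (\<integral>\<^sup>+\<omega>. indicator C (D \<omega>) * ennreal (prob_given M F P \<omega>) \<partial>M)"
    by (intro nn_integral_cong) (auto simp: prob_given_def A_def split: split_indicator)
  finally show ?thesis .
qed

text \<open>Lets the disintegration for families be applied to one variable at a time.\<close>

lemma cond_indep_on_singleton: "cond_indep_on M G F {j} MZ Z"
  by (simp add: cond_indep_on_def)

text \<open>The null sets of \<open>cond_law_on\<close> and \<open>cond_indep_on\<close> depend on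
  the sets \<open>B j\<close>. For a fixed rectangle only finitely many occur, and after integration
  they disappear, so the rectangle identity holds without exception and the uncountably many choices
  of \<open>B\<close> do no harm.\<close>

lemma nn_integral_disintegration_cond_indep:
  assumes M: "prob_space M" and J: "finite J"
    and D [measurable]: "D \<in> M \<rightarrow>\<^sub>M MD" and Z [measurable]: "\<And>j. j \<in> J \<Longrightarrow> Z j \<in> M \<rightarrow>\<^sub>M MZ"
    and K [measurable]: "\<And>j. j \<in> J \<Longrightarrow> K j \<in> MD \<rightarrow>\<^sub>M prob_algebra MZ"
    and indep: "cond_indep_on M \<Omega> (vimage_algebra (space M) D MD) J MZ Z"
    and law: "\<And>j. j \<in> J \<Longrightarrow>
      cond_law_on M \<Omega> (vimage_algebra (space M) D MD) MZ (Z j) (\<lambda>\<omega>. K j (D \<omega>))"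
    and G: "G \<in> sets MD" "\<And>\<omega>. \<omega> \<in> space M \<Longrightarrow> D \<omega> \<in> G \<Longrightarrow> \<omega> \<in> \<Omega>"
    and f: "f \<in> borel_measurable (MD \<Otimes>\<^sub>M PiM J (\<lambda>_. MZ))"
  shows "(\<integral>\<^sup>+\<omega>. indicator G (D \<omega>) * f (D \<omega>, \<lambda>j\<in>J. Z j \<omega>) \<partial>M)
    = (\<integral>\<^sup>+\<omega>. indicator G (D \<omega>) * (\<integral>\<^sup>+z. f (D \<omega>, z) \<partial>PiM J (\<lambda>j. K j (D \<omega>))) \<partial>M)"
proof (rule nn_integral_disintegration_PiM[OF J D Z K G(1) _ _ _ f])
  interpret prob_space M by fact
  show "finite_measure M" "space M \<noteq> {}" by unfold_locales (rule not_empty)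
  let ?F = "vimage_algebra (space M) D MD"
  fix C B assume C [measurable]: "C \<in> sets MD" and CG: "C \<subseteq> G" and B: "B \<in> J \<rightarrow> sets MZ"
  have [measurable]: "{\<omega> \<in> space M. \<forall>j\<in>J. Z j \<omega> \<in> B j} \<in> sets M"
  proof (rule sets.sets_Collect_finite_All[OF _ J])
    fix j assume "j \<in> J"
    then have [measurable]: "Z j \<in> M \<rightarrow>\<^sub>M MZ" "B j \<in> sets MZ" using Z B by auto
    show "{\<omega> \<in> space M. Z j \<omega> \<in> B j} \<in> sets M" by measurable
  qed
  have "AE \<omega> in M. \<forall>j\<in>J. \<omega> \<in> \<Omega> \<longrightarrow> prob_given M ?F (\<lambda>\<omega>'. Z j \<omega>' \<in> B j) \<omega> = measure (K j (D \<omega>)) (B j)"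
    by (rule AE_finite_allI[OF J]) (use law B in \<open>auto simp: cond_law_on_def\<close>)
  moreover have "AE \<omega> in M. \<omega> \<in> \<Omega> \<longrightarrow>
        prob_given M ?F (\<lambda>\<omega>'. \<forall>j\<in>J. Z j \<omega>' \<in> B j) \<omega> = (\<Prod>j\<in>J. prob_given M ?F (\<lambda>\<omega>'. Z j \<omega>' \<in> B j) \<omega>)"
    using indep B by (auto simp: cond_indep_on_def)
  ultimately have "AE \<omega> in M. \<omega> \<in> \<Omega> \<longrightarrow>
        prob_given M ?F (\<lambda>\<omega>'. \<forall>j\<in>J. Z j \<omega>' \<in> B j) \<omega> = (\<Prod>j\<in>J. measure (K j (D \<omega>)) (B j))"
    by eventually_elim simp
  then have "AE \<omega> in M. indicator C (D \<omega>) * ennreal (prob_given M ?F (\<lambda>\<omega>'. \<forall>j\<in>J. Z j \<omega>' \<in> B j) \<omega>)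
        = indicator C (D \<omega>) * (\<Prod>j\<in>J. emeasure (K j (D \<omega>)) (B j))"
    using AE_space
  proof eventually_elim
    case (elim \<omega>)
    have "prob_space (K j (D \<omega>))" if "j \<in> J" for j
      using measurable_space[OF K[OF that], of "D \<omega>"] measurable_space[OF D] elim by (auto simp: space_prob_algebra)
    then have "(\<Prod>j\<in>J. emeasure (K j (D \<omega>)) (B j)) = (\<Prod>j\<in>J. ennreal (measure (K j (D \<omega>)) (B j)))"
      by (intro prod.cong refl) (simp add: prob_space_def finite_measure.emeasure_eq_measure)
    then show ?case using elim CG G(2) by (auto simp: prod_ennreal split: split_indicator)
  qed
  then show "emeasure M {\<omega> \<in> space M. D \<omega> \<in> C \<and> (\<forall>j\<in>J. Z j \<omega> \<in> B j)}
      = (\<integral>\<^sup>+\<omega>. indicator C (D \<omega>) * (\<Prod>j\<in>J. emeasure (K j (D \<omega>)) (B j)) \<partial>M)"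
    by (subst emeasure_prob_given[OF M D]) (auto intro: nn_integral_cong_AE)
qed

lemma nn_integral_disintegration_cond_indep_space:
  assumes M: "prob_space M" and J: "finite J"
    and D [measurable]: "D \<in> M \<rightarrow>\<^sub>M MD" and Z: "\<And>j. j \<in> J \<Longrightarrow> Z j \<in> M \<rightarrow>\<^sub>M MZ"
    and K: "\<And>j. j \<in> J \<Longrightarrow> K j \<in> MD \<rightarrow>\<^sub>M prob_algebra MZ"
    and indep: "cond_indep_on M (space M) (vimage_algebra (space M) D MD) J MZ Z"
    and law: "\<And>j. j \<in> J \<Longrightarrow>
      cond_law_on M (space M) (vimage_algebra (space M) D MD) MZ (Z j) (\<lambda>\<omega>. K j (D \<omega>))"
    and f: "f \<in> borel_measurable (MD \<Otimes>\<^sub>M PiM J (\<lambda>_. MZ))"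
  shows "(\<integral>\<^sup>+\<omega>. f (D \<omega>, \<lambda>j\<in>J. Z j \<omega>) \<partial>M)
    = (\<integral>\<^sup>+\<omega>. (\<integral>\<^sup>+z. f (D \<omega>, z) \<partial>PiM J (\<lambda>j. K j (D \<omega>))) \<partial>M)"
proof -
  have ind: "indicator (space MD) (D \<omega>) * a = a" if "\<omega> \<in> space M" for \<omega> and a :: ennreal
    using measurable_space[OF D that] by simp
  have "(\<integral>\<^sup>+\<omega>. indicator (space MD) (D \<omega>) * f (D \<omega>, \<lambda>j\<in>J. Z j \<omega>) \<partial>M)
    = (\<integral>\<^sup>+\<omega>. indicator (space MD) (D \<omega>) * (\<integral>\<^sup>+z. f (D \<omega>, z) \<partial>PiM J (\<lambda>j. K j (D \<omega>))) \<partial>M)"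
    by (rule nn_integral_disintegration_cond_indep[OF M J D Z K indep law sets.top _ f])
  then show ?thesis by (simp only: ind cong: nn_integral_cong)
qed

lemma measurable_bernoulli_pmf [measurable (raw)]:
  assumes p [measurable]: "p \<in> borel_measurable MD" and p01: "\<And>x. x \<in> space MD \<Longrightarrow> 0 \<le> p x \<and> p x \<le> 1"
  shows "(\<lambda>x. measure_pmf (bernoulli_pmf (p x))) \<in> MD \<rightarrow>\<^sub>M prob_algebra bool_space"
proof (rule measurable_prob_algebraI)
  show "prob_space (measure_pmf (bernoulli_pmf (p x)))" for x by (rule prob_space_measure_pmf)
  show "(\<lambda>x. measure_pmf (bernoulli_pmf (p x))) \<in> MD \<rightarrow>\<^sub>M subprob_algebra bool_space"
  proof (rule measurable_subprob_algebra)
    fix A :: "bool set"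
    have "(\<lambda>x. indicator A True * ennreal (p x) + indicator A False * ennreal (1 - p x)) \<in> borel_measurable MD"
      by measurable
    also have "?this \<longleftrightarrow> (\<lambda>x. emeasure (measure_pmf (bernoulli_pmf (p x))) A) \<in> borel_measurable MD"
    proof (rule measurable_cong)
      fix x assume "x \<in> space MD"
      then show "indicator A True * ennreal (p x) + indicator A False * ennreal (1 - p x)
          = emeasure (measure_pmf (bernoulli_pmf (p x))) A"
        using p01[of x] nn_integral_bernoulli_pmf[of "p x" "indicator A"] by simp
    qed
    finally show "(\<lambda>x. emeasure (measure_pmf (bernoulli_pmf (p x))) A) \<in> borel_measurable MD" .
  qed (auto intro: prob_space_imp_subprob_space prob_space_measure_pmf)
qed

lemma emeasure_PiM_component:
  assumes J: "finite J" "j \<in> J" and P: "\<And>i. i \<in> J \<Longrightarrow> prob_space (P i)" and A: "A \<in> sets (P j)"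
  shows "emeasure (PiM J P) {z \<in> space (PiM J P). z j \<in> A} = emeasure (P j) A"
proof -
  have "{z \<in> space (PiM J P). z j \<in> A} = PiE J (\<lambda>i. if i = j then A else space (P i))"
  proof (intro set_eqI iffI)
    fix z assume "z \<in> {z \<in> space (PiM J P). z j \<in> A}"
    then show "z \<in> PiE J (\<lambda>i. if i = j then A else space (P i))"
      by (intro PiE_I) (auto simp: space_PiM dest: PiE_mem PiE_arb)
  next
    fix z assume z: "z \<in> PiE J (\<lambda>i. if i = j then A else space (P i))"
    then have zj: "z j \<in> A" using PiE_mem[OF z J(2)] by simp
    have "z i \<in> space (P i)" if "i \<in> J" for i
      using PiE_mem[OF z that] zj sets.sets_into_space[OF A] by (cases "i = j") auto
    then show "z \<in> {z \<in> space (PiM J P). z j \<in> A}"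
      using zj PiE_arb[OF z] by (auto simp: space_PiM intro!: PiE_I)
  qed
  then have "emeasure (PiM J P) {z \<in> space (PiM J P). z j \<in> A}
      = (\<Prod>i\<in>J. emeasure (P i) (if i = j then A else space (P i)))"
    using A P J by (auto simp: emeasure_PiM_prob)
  also have "\<dots> = (\<Prod>i\<in>J. if i = j then emeasure (P j) A else 1)"
    using prob_space.emeasure_space_1[OF P] by (intro prod.cong) auto
  finally show ?thesis using J by simp
qed

text \<open>Only rational thresholds are compared, so that the premise can be obtained off a single null set.\<close>

lemma emeasure_tail_mono:
  fixes f :: "'a \<Rightarrow> real" and g :: "'b \<Rightarrow> real"
  assumes "prob_space P" "prob_space Q"
    and [measurable]: "f \<in> borel_measurable Q" "g \<in> borel_measurable P"
    and le: "\<And>s. s \<in> \<rat> \<Longrightarrow> emeasure Q {z \<in> space Q. s < f z} \<le> emeasure P {z \<in> space P. s < g z}"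
  shows "emeasure Q {z \<in> space Q. v \<le> f z} \<le> emeasure P {z \<in> space P. v \<le> g z}"
proof -
  interpret P: prob_space P by fact
  interpret Q: prob_space Q by fact
  \<comment> \<open>A rational \<open>s\<close> in the gap below \<open>v\<close> compares the
    closed tail of \<open>f\<close> with a slightly larger open tail of \<open>g\<close>. Continuity
    from above then removes the slack \<open>1 / Suc n\<close>.\<close>
  have "measure Q {z \<in> space Q. v \<le> f z} \<le> measure P {z \<in> space P. v - 1 / Suc n < g z}" for n
  proof -
    obtain s where s: "s \<in> \<rat>" "v - 1 / Suc n < s" "s < v"
      using Rats_dense_in_real[of "v - 1 / Suc n" v] by auto
    have "measure Q {z \<in> space Q. v \<le> f z} \<le> measure Q {z \<in> space Q. s < f z}"
      using s by (intro Q.finite_measure_mono) auto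
    also have "\<dots> \<le> measure P {z \<in> space P. s < g z}"
      using le[OF s(1)] by (simp add: P.emeasure_eq_measure Q.emeasure_eq_measure)
    also have "\<dots> \<le> measure P {z \<in> space P. v - 1 / Suc n < g z}"
      using s by (intro P.finite_measure_mono) auto
    finally show ?thesis .
  qed
  moreover have "(\<lambda>n. measure P {z \<in> space P. v - 1 / Suc n < g z}) \<longlonglongrightarrow> measure P (\<Inter>n. {z \<in> space P. v - 1 / Suc n < g z})"
  proof (rule P.finite_Lim_measure_decseq)
    show "decseq (\<lambda>n. {z \<in> space P. v - 1 / Suc n < g z})"
    proof (rule antimonoI, safe)
      fix m n :: nat and z assume mn: "m \<le> n" and z: "v - 1 / Suc n < g z"
      have "1 / real (Suc n) \<le> 1 / real (Suc m)" using mn by (intro divide_left_mono) auto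
      then show "v - 1 / Suc m < g z" using z by linarith
    qed
  qed auto
  moreover have "(\<Inter>n. {z \<in> space P. v - 1 / Suc n < g z}) = {z \<in> space P. v \<le> g z}"
  proof safe
    fix z assume "z \<in> (\<Inter>n. {z \<in> space P. v - 1 / Suc n < g z})"
    then have *: "v - 1 / Suc n < g z" for n by auto
    show "v \<le> g z"
    proof (rule ccontr)
      assume "\<not> v \<le> g z"
      then obtain n where "1 / Suc n < v - g z" using nat_approx_posE[of "v - g z"] by auto
      then show False using *[of n] by linarith
    qed
  next
    fix z n assume "v \<le> g z"
    moreover have "0 < 1 / real (Suc n)" by simp
    ultimately show "v - 1 / Suc n < g z" by linarith
  qed auto
  ultimately have "measure Q {z \<in> space Q. v \<le> f z} \<le> measure P {z \<in> space P. v \<le> g z}"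
    by (metis (no_types, lifting) LIMSEQ_le_const)
  then show ?thesis by (simp add: P.emeasure_eq_measure Q.emeasure_eq_measure)
qed

text \<open>Serves to pass to the smaller event \<open>I \<omega> = i\<close>, on which a kernel
  mentioning the random target coincides with one for the fixed target \<open>i\<close>.\<close>

lemma cond_law_on_cong:
  assumes "cond_law_on M \<Omega> F MZ Z K" "\<Omega>' \<subseteq> \<Omega>" "\<And>\<omega>. \<omega> \<in> \<Omega>' \<Longrightarrow> K \<omega> = K' \<omega>"
  shows "cond_law_on M \<Omega>' F MZ Z K'"
  unfolding cond_law_on_def
proof
  fix B assume "B \<in> sets MZ"
  with assms(1) have "AE \<omega> in M. \<omega> \<in> \<Omega> \<longrightarrow> prob_given M F (\<lambda>\<omega>'. Z \<omega>' \<in> B) \<omega> = measure (K \<omega>) B"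
    by (simp add: cond_law_on_def)
  then show "AE \<omega> in M. \<omega> \<in> \<Omega>' \<longrightarrow> prob_given M F (\<lambda>\<omega>'. Z \<omega>' \<in> B) \<omega> = measure (K' \<omega>) B"
    by (rule eventually_mono) (use assms(2,3) in auto)
qed

lemma nn_integral_PiM_singleton_prob:
  assumes "prob_space (P j)" and f: "f \<in> borel_measurable (P j)"
  shows "(\<integral>\<^sup>+z. f (z j) \<partial>PiM {j} P) = (\<integral>\<^sup>+z. f z \<partial>P j)"
  using nn_integral_PiM_prod_prob[of "{j}" P "\<lambda>_. f"] assms by simp

lemma space_vec_upd:
  assumes i: "i \<in> J" and z: "z \<in> space (PiM (J - {i}) (\<lambda>_. MZ))" and y: "y \<in> space MZ"
  shows "z(i := y) \<in> space (PiM J (\<lambda>_. MZ))"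
  using assms by (auto simp: space_PiM PiE_iff extensional_def)

section \<open>Monotonicity of weighted counts and ranks\<close>

text \<open>Under a product measure the weighted count depends on the factors only through the hit
  probabilities. By induction on \<open>J\<close> the units are exchanged one at a time: raising one
  hit probability moves mass from a count without that nonnegative weight to a count with it, so
  staying below \<open>c\<close> becomes less likely.\<close>

lemma emeasure_PiM_weighted_sum_mono:
  fixes w :: "'i \<Rightarrow> real" and P Q :: "'i \<Rightarrow> 'a measure"
  assumes "finite J"
    and "\<And>j. j \<in> J \<Longrightarrow> prob_space (P j)" "\<And>j. j \<in> J \<Longrightarrow> prob_space (Q j)"
    and "\<And>j. j \<in> J \<Longrightarrow> A j \<in> sets (P j)" "\<And>j. j \<in> J \<Longrightarrow> B j \<in> sets (Q j)"
    and "\<And>j. j \<in> J \<Longrightarrow> emeasure (Q j) (B j) \<le> emeasure (P j) (A j)"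
    and "\<And>j. j \<in> J \<Longrightarrow> 0 \<le> w j"
  shows "emeasure (PiM J P) {z \<in> space (PiM J P). (\<Sum>j\<in>J. w j * indicator (A j) (z j)) \<le> c}
    \<le> emeasure (PiM J Q) {z \<in> space (PiM J Q). (\<Sum>j\<in>J. w j * indicator (B j) (z j)) \<le> c}"
proof -
  define F where "F J P A c = measure (PiM J P) {z \<in> space (PiM J P). (\<Sum>j\<in>J. w j * indicator (A j) (z j)) \<le> c}"
    for J and P :: "'i \<Rightarrow> 'a measure" and A c
  \<comment> \<open>Conditioning on coordinate \<open>k\<close>: a hit uses up \<open>w k\<close> of
    the allowance \<open>c\<close>, a miss leaves it intact. The shifted allowance is the reason why
    \<open>c\<close> is generalized in the induction.\<close>
  have F_insert: "F (insert k J) P A c = F J P A (c - w k) * measure (P k) (A k) + F J P A c * (1 - measure (P k) (A k))"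
    if J: "finite J" "k \<notin> J" and P: "\<And>j. j \<in> insert k J \<Longrightarrow> prob_space (P j)"
      and A: "\<And>j. j \<in> insert k J \<Longrightarrow> A j \<in> sets (P j)"
    for J k and P :: "'i \<Rightarrow> 'a measure" and A c
  proof -
    interpret Pk: prob_space "P k" using P by simp
    interpret PJ: prob_space "PiM J P" using P by (intro prob_space_PiM) simp
    interpret PkJ: prob_space "PiM (insert k J) P" using P by (intro prob_space_PiM) simp
    have [measurable]: "A k \<in> sets (P k)" "\<And>j. j \<in> J \<Longrightarrow> A j \<in> sets (P j)" using A by auto
    have *: "(\<Sum>j\<in>insert k J. w j * indicator (A j) (z j)) = w k * indicator (A k) (z k) + (\<Sum>j\<in>J. w j * indicator (A j) (z j))"
      for z :: "'i \<Rightarrow> 'a" by (rule sum.insert[OF J])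
    have upd: "(\<Sum>j\<in>J. w j * indicator (A j) ((z(k := y)) j)) = (\<Sum>j\<in>J. w j * indicator (A j) (z j))"
      for z :: "'i \<Rightarrow> 'a" and y using J by (intro sum.cong) auto
    have meas [measurable]: "{z \<in> space (PiM (insert k J) P). (\<Sum>j\<in>insert k J. w j * indicator (A j) (z j)) \<le> c} \<in> sets (PiM (insert k J) P)" 
      unfolding * by measurable
    have "emeasure (PiM (insert k J) P) {z \<in> space (PiM (insert k J) P). (\<Sum>j\<in>insert k J. w j * indicator (A j) (z j)) \<le> c}
      = (\<integral>\<^sup>+z. indicator {z \<in> space (PiM (insert k J) P). (\<Sum>j\<in>insert k J. w j * indicator (A j) (z j)) \<le> c} z \<partial>PiM (insert k J) P)"
      by simp
    also have "\<dots> = (\<integral>\<^sup>+y. \<integral>\<^sup>+z. indicator {z \<in> space (PiM (insert k J) P). (\<Sum>j\<in>insert k J. w j * indicator (A j) (z j)) \<le> c} (z(k := y)) \<partial>PiM J P \<partial>P k)"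
      by (rule nn_integral_PiM_insert_prob(1)[OF J P borel_measurable_indicator[OF meas]])
    also have "\<dots> = (\<integral>\<^sup>+y. \<integral>\<^sup>+z. indicator {z \<in> space (PiM J P). (\<Sum>j\<in>J. w j * indicator (A j) (z j)) \<le> c - w k * indicator (A k) y} z \<partial>PiM J P \<partial>P k)"
    proof (intro nn_integral_cong)
      fix y z assume "y \<in> space (P k)" "z \<in> space (PiM J P)"
      then have "z(k := y) \<in> space (PiM (insert k J) P)" by (auto simp: space_PiM PiE_iff extensional_def)
      then show "indicator {z \<in> space (PiM (insert k J) P). (\<Sum>j\<in>insert k J. w j * indicator (A j) (z j)) \<le> c} (z(k := y))
          = (indicator {z \<in> space (PiM J P). (\<Sum>j\<in>J. w j * indicator (A j) (z j)) \<le> c - w k * indicator (A k) y} z :: ennreal)"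
        using \<open>z \<in> _\<close> upd[of z y] unfolding * by (auto simp: algebra_simps split: split_indicator)
    qed
    also have "\<dots> = (\<integral>\<^sup>+y. ennreal (F J P A (c - w k * indicator (A k) y)) \<partial>P k)"
      unfolding F_def by (intro nn_integral_cong, subst nn_integral_indicator) (auto simp: PJ.emeasure_eq_measure)
    also have "\<dots> = (\<integral>\<^sup>+y. ennreal (F J P A (c - w k)) * indicator (A k) y + ennreal (F J P A c) * indicator (space (P k) - A k) y \<partial>P k)"
      by (intro nn_integral_cong) (auto split: split_indicator)
    also have "\<dots> = ennreal (F J P A (c - w k)) * ennreal (measure (P k) (A k)) + ennreal (F J P A c) * ennreal (1 - measure (P k) (A k))"
      by (subst nn_integral_add) (auto simp: nn_integral_cmult Pk.emeasure_eq_measure Pk.prob_compl)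
    also have "\<dots> = ennreal (F J P A (c - w k) * measure (P k) (A k) + F J P A c * (1 - measure (P k) (A k)))"
      by (simp add: ennreal_mult ennreal_plus F_def)
    finally show ?thesis
      unfolding F_def[of "insert k J"] PkJ.emeasure_eq_measure
      by (subst (asm) ennreal_inj) (auto simp: F_def)
  qed
  have "F J P A c \<le> F J Q B c"
    using assms
  proof (induction J arbitrary: c)
    case empty
    then show ?case by (simp add: F_def space_PiM PiM_empty)
  next
    case (insert k J)
    interpret Pk: prob_space "P k" using insert.prems by simp
    interpret Qk: prob_space "Q k" using insert.prems by simp
    interpret QJ: prob_space "PiM J Q" using insert.prems by (intro prob_space_PiM) simp
    let ?p = "measure (P k) (A k)" and ?q = "measure (Q k) (B k)"
    have IH: "F J P A c \<le> F J Q B c" for c using insert by auto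
    have q: "?q \<le> ?p"
      using insert.prems(5)[of k] by (simp add: Pk.emeasure_eq_measure Qk.emeasure_eq_measure)
    have [measurable]: "\<And>j. j \<in> J \<Longrightarrow> B j \<in> sets (Q j)" using insert.prems by auto
    have mono: "F J Q B (c - w k) \<le> F J Q B c"
      unfolding F_def using insert.prems(6)[of k] by (intro QJ.finite_measure_mono) auto
    have "F (insert k J) P A c \<le> F J Q B (c - w k) * ?p + F J Q B c * (1 - ?p)"
      using insert.hyps insert.prems IH by (subst F_insert) (auto intro!: add_mono mult_right_mono)
    \<comment> \<open>Written this way, the mixture is visibly decreasing in the hit probability,
      since the difference it multiplies is nonnegative by \<open>mono\<close>.\<close>
    also have "\<dots> = F J Q B c - ?p * (F J Q B c - F J Q B (c - w k))" by (simp add: algebra_simps)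
    also have "\<dots> \<le> F J Q B c - ?q * (F J Q B c - F J Q B (c - w k))"
      using q mono by (intro diff_left_mono mult_right_mono) auto
    also have "\<dots> = F (insert k J) Q B c"
      using insert.hyps insert.prems by (subst F_insert) (auto simp: algebra_simps)
    finally show ?case .
  qed
  moreover have "prob_space (PiM J P)" "prob_space (PiM J Q)" using assms by (auto intro!: prob_space_PiM)
  ultimately show ?thesis
    by (simp add: F_def prob_space_def finite_measure.emeasure_eq_measure)
qed

text \<open>Among the units of small upper rank take one with the lowest score. Its upper rank
  counts every other such unit, so their total weight is at most that one rank, which is at most
  \<open>c\<close>. Ties cause no trouble because equal scores are counted.\<close>

lemma sum_weights_small_p_value_le:
  fixes w s :: "'i \<Rightarrow> real"
  assumes J: "finite J" and w: "\<And>j. j \<in> J \<Longrightarrow> 0 \<le> w j" and c: "0 \<le> c"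
  shows "(\<Sum>i\<in>J. w i * of_bool ((\<Sum>j\<in>J. w j * of_bool (s j \<ge> s i)) \<le> c)) \<le> c"
proof -
  define A where "A = {i \<in> J. (\<Sum>j\<in>J. w j * of_bool (s j \<ge> s i)) \<le> c}"
  have *: "(\<Sum>i\<in>J. w i * of_bool ((\<Sum>j\<in>J. w j * of_bool (s j \<ge> s i)) \<le> c)) = sum w A"
    unfolding A_def using J by (simp add: sum.If_cases of_bool_def if_distrib Int_def cong: if_cong)
  show ?thesis
  proof (cases "A = {}")
    case False
    have "finite A" using J by (simp add: A_def)
    then obtain i where i: "i \<in> A" "\<And>j. j \<in> A \<Longrightarrow> s i \<le> s j"
      using ex_min_if_finite[of "s ` A"] False by (metis (no_types, lifting) finite_imageI image_is_empty imageE image_eqI not_le)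
    have "sum w A = (\<Sum>j\<in>A. w j * of_bool (s j \<ge> s i))" using i by (intro sum.cong) auto
    also have "\<dots> \<le> (\<Sum>j\<in>J. w j * of_bool (s j \<ge> s i))"
      using J w by (intro sum_mono2) (auto simp: A_def)
    also have "\<dots> \<le> c" using i(1) by (simp add: A_def)
    finally show ?thesis using * by simp
  \<comment> \<open>If no unit has small rank the left side is 0; here \<open>0 \<le> c\<close>
    enters.\<close>
  qed (use * c in simp)
qed

section \<open>Kernels of the interference model\<close>

text \<open>The sigma-algebra on multisets is generated by counts, and the number of neighbors whose
  pair lies in \<open>B\<close> is a finite sum of measurable indicators over all units.\<close>

lemma measurable_local_config:
  assumes nbhd [measurable]: "nbhd j \<in> vec_space N MX \<rightarrow>\<^sub>M count_space (Pow ({1..N} - {j}))"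
  shows "(\<lambda>(x, t). local_config nbhd j x t)
    \<in> vec_space N MX \<Otimes>\<^sub>M vec_space N bool_space \<rightarrow>\<^sub>M multiset_algebra (MX \<Otimes>\<^sub>M bool_space)"
  unfolding multiset_algebra_def
proof (rule measurable_measure_of)
  let ?D = "vec_space N MX \<Otimes>\<^sub>M vec_space N bool_space"
  have sub: "nbhd j x \<subseteq> {1..N} - {j}" if "x \<in> space (vec_space N MX)" for x
    using measurable_space[OF nbhd that] by simp
  then have fin: "finite (nbhd j x)" if "x \<in> space (vec_space N MX)" for x
    using that by (meson finite_Diff finite_atLeastAtMost finite_subset)
  show "(\<lambda>(x, t). local_config nbhd j x t) \<in> space ?D \<rightarrow> {m. set_mset m \<subseteq> space (MX \<Otimes>\<^sub>M bool_space)}"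
    using sub fin by (fastforce simp: local_config_def space_pair_measure space_PiM PiE_iff)
  have pred_nbhd [measurable]: "Measurable.pred (vec_space N MX) (\<lambda>x. l \<in> nbhd j x)" for l
    by (rule measurable_compose[OF nbhd]) simp
  fix A assume "A \<in> {{m. set_mset m \<subseteq> space (MX \<Otimes>\<^sub>M bool_space) \<and> size (filter_mset (\<lambda>z. z \<in> B) m) = k} | B k.
      B \<in> sets (MX \<Otimes>\<^sub>M bool_space)}"
  then obtain B k where A: "A = {m. set_mset m \<subseteq> space (MX \<Otimes>\<^sub>M bool_space) \<and> size (filter_mset (\<lambda>z. z \<in> B) m) = k}"
    and B [measurable]: "B \<in> sets (MX \<Otimes>\<^sub>M bool_space)" by blast
  have size: "size (filter_mset (\<lambda>z. z \<in> B) (local_config nbhd j x t))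
      = (\<Sum>l\<in>{1..N}. of_bool (l \<in> nbhd j x \<and> (x l, t l) \<in> B))" if "x \<in> space (vec_space N MX)" for x t
  proof -
    have "size (filter_mset (\<lambda>z. z \<in> B) (local_config nbhd j x t)) = card {l \<in> nbhd j x. (x l, t l) \<in> B}"
      using fin[OF that] by (simp add: local_config_def filter_mset_image_mset)
    also have "{l \<in> nbhd j x. (x l, t l) \<in> B} = {l \<in> {1..N}. l \<in> nbhd j x \<and> (x l, t l) \<in> B}"
      using sub[OF that] by auto
    also have "card \<dots> = (\<Sum>l\<in>{1..N}. of_bool (l \<in> nbhd j x \<and> (x l, t l) \<in> B))"
      by (simp add: of_bool_def sum.If_cases Int_def)
    finally show ?thesis .
  qed
  have "(\<lambda>(x, t). local_config nbhd j x t) -` A \<inter> space ?D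
      = {p \<in> space ?D. (\<Sum>l\<in>{1..N}. of_bool (l \<in> nbhd j (fst p) \<and> (fst p l, snd p l) \<in> B)) = k}"
    using size fin sub by (fastforce simp: A local_config_def space_pair_measure space_PiM PiE_iff)
  also have "\<dots> \<in> sets ?D"
    by measurable
  finally show "(\<lambda>(x, t). local_config nbhd j x t) -` A \<inter> space ?D \<in> sets ?D" .
qed auto

definition switch_on :: "nat \<Rightarrow> (nat \<Rightarrow> 'x) \<times> (nat \<Rightarrow> bool) \<Rightarrow> (nat \<Rightarrow> 'x) \<times> (nat \<Rightarrow> bool)" where
  "switch_on i d = (fst d, (snd d)(i := True))"

lemma fst_switch_on [simp]: "fst (switch_on i d) = fst d"
  by (simp add: switch_on_def)

lemma snd_switch_on [simp]: "snd (switch_on i d) = (snd d)(i := True)"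
  by (simp add: switch_on_def)

section \<open>Law of exposures and treated outcomes given the design\<close>

context networked_interference
begin

abbreviation design_space :: "((nat \<Rightarrow> 'x) \<times> (nat \<Rightarrow> bool)) measure" where
  "design_space \<equiv> vec_space N MX \<Otimes>\<^sub>M vec_space N bool_space"

definition design :: "'w \<Rightarrow> (nat \<Rightarrow> 'x) \<times> (nat \<Rightarrow> bool)" where
  "design \<omega> = (vec_of N X \<omega>, vec_of N T \<omega>)"

definition exposure_kernel :: "nat \<Rightarrow> (nat \<Rightarrow> 'x) \<times> (nat \<Rightarrow> bool) \<Rightarrow> 'e measure" where
  "exposure_kernel j d = PE (fst d j, local_config nbhd j (fst d) (snd d))"

text \<open>\<open>PY\<close> sees the treatments only through the exposure. Hence the same kernel
  taken at a switched design describes the interventional pair of exposure and treated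
  outcome.\<close>

definition unit_kernel :: "nat \<Rightarrow> (nat \<Rightarrow> 'x) \<times> (nat \<Rightarrow> bool) \<Rightarrow> ('e \<times> 'y) measure" where
  "unit_kernel j d =
     exposure_kernel j d \<bind> (\<lambda>e. distr (PY True (fst d j, e)) (ME \<Otimes>\<^sub>M MY) (Pair e))"

declare One_nat_def [simp del]
declare PE_kernel [measurable] PY_kernel [measurable] \<pi>_measurable [measurable]
  X_measurable [measurable] T_measurable [measurable] E_measurable [measurable] Y_measurable [measurable]
  nbhd_measurable [measurable]

lemma vec_of_measurable [measurable]:
  "vec_of N X \<in> M \<rightarrow>\<^sub>M vec_space N MX" "vec_of N T \<in> M \<rightarrow>\<^sub>M vec_space N bool_space"
  "vec_of N E \<in> M \<rightarrow>\<^sub>M vec_space N ME" "vec_of N (Y t) \<in> M \<rightarrow>\<^sub>M vec_space N MY"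
  unfolding vec_of_def by measurable

lemma design_measurable [measurable]: "design \<in> M \<rightarrow>\<^sub>M design_space"
  unfolding design_def by measurable

lemma exposure_kernel_measurable [measurable]:
  assumes [measurable]: "j \<in> {1..N}"
  shows "exposure_kernel j \<in> design_space \<rightarrow>\<^sub>M prob_algebra ME"
proof -
  have [measurable]: "(\<lambda>d. local_config nbhd j (fst d) (snd d)) \<in> design_space \<rightarrow>\<^sub>M multiset_algebra (MX \<Otimes>\<^sub>M bool_space)"
    using measurable_local_config[of nbhd j N MX] nbhd_measurable[OF assms] by (simp add: case_prod_beta')
  show ?thesis unfolding exposure_kernel_def by measurable
qed

lemma unit_kernel_measurable [measurable]:
  assumes [measurable]: "j \<in> {1..N}"
  shows "unit_kernel j \<in> design_space \<rightarrow>\<^sub>M prob_algebra (ME \<Otimes>\<^sub>M MY)"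
  unfolding unit_kernel_def by measurable

lemma prob_space_exposure_kernel:
  assumes "j \<in> {1..N}" "d \<in> space design_space"
  shows "prob_space (exposure_kernel j d)" "sets (exposure_kernel j d) = sets ME"
  using measurable_space[OF exposure_kernel_measurable[OF assms(1)] assms(2)] by (auto simp: space_prob_algebra)

lemma prob_space_unit_kernel:
  assumes "j \<in> {1..N}" "d \<in> space design_space"
  shows "prob_space (unit_kernel j d)" "sets (unit_kernel j d) = sets (ME \<Otimes>\<^sub>M MY)"
  using measurable_space[OF unit_kernel_measurable[OF assms(1)] assms(2)] by (auto simp: space_prob_algebra)

lemma prob_space_PY:
  assumes "x \<in> space MX" "e \<in> space ME"
  shows "prob_space (PY t (x, e))" "sets (PY t (x, e)) = sets MY"
  using measurable_space[OF PY_kernel[of t], of "(x, e)"] assms by (auto simp: space_prob_algebra space_pair_measure)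

lemma nn_integral_unit_kernel:
  assumes j [measurable]: "j \<in> {1..N}" and d: "d \<in> space design_space"
    and f [measurable]: "f \<in> borel_measurable (ME \<Otimes>\<^sub>M MY)"
  shows "(\<integral>\<^sup>+z. f z \<partial>unit_kernel j d) = (\<integral>\<^sup>+e. \<integral>\<^sup>+y. f (e, y) \<partial>PY True (fst d j, e) \<partial>exposure_kernel j d)"
proof -
  have x: "fst d j \<in> space MX"
    using d j by (auto simp: space_pair_measure space_PiM PiE_iff)
  note prob_space_exposure_kernel[OF j d, measurable_cong]
  have [measurable]: "(\<lambda>e. distr (PY True (fst d j, e)) (ME \<Otimes>\<^sub>M MY) (Pair e)) \<in> ME \<rightarrow>\<^sub>M prob_algebra (ME \<Otimes>\<^sub>M MY)"
    using x by measurable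
  have "(\<integral>\<^sup>+z. f z \<partial>unit_kernel j d)
      = (\<integral>\<^sup>+e. \<integral>\<^sup>+z. f z \<partial>distr (PY True (fst d j, e)) (ME \<Otimes>\<^sub>M MY) (Pair e) \<partial>exposure_kernel j d)"
    unfolding unit_kernel_def
    by (rule nn_integral_bind[where B = "ME \<Otimes>\<^sub>M MY"]) (auto intro!: measurable_prob_algebraD)
  also have "\<dots> = (\<integral>\<^sup>+e. \<integral>\<^sup>+y. f (e, y) \<partial>PY True (fst d j, e) \<partial>exposure_kernel j d)"
  proof (rule nn_integral_cong)
    fix e assume "e \<in> space (exposure_kernel j d)"
    then have e: "e \<in> space ME" using prob_space_exposure_kernel(2)[OF j d, THEN sets_eq_imp_space_eq] by simp
    have [measurable_cong]: "sets (PY True (fst d j, e)) = sets MY" by (rule prob_space_PY[OF x e])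
    show "(\<integral>\<^sup>+z. f z \<partial>distr (PY True (fst d j, e)) (ME \<Otimes>\<^sub>M MY) (Pair e)) = (\<integral>\<^sup>+y. f (e, y) \<partial>PY True (fst d j, e))"
      using e by (subst nn_integral_distr) auto
  qed
  finally show ?thesis .
qed

text \<open>Independence of the pairs is tested on rectangles whose first factor is all of
  \<open>space MY\<close>.\<close>

lemma Y1_cond_indep:
  "cond_indep_on M (space M)
     (vimage_algebra (space M) (\<lambda>\<omega>. (vec_of N X \<omega>, vec_of N E \<omega>, vec_of N T \<omega>))
       (vec_space N MX \<Otimes>\<^sub>M vec_space N ME \<Otimes>\<^sub>M vec_space N bool_space))
     {1..N} MY (Y True)"
  unfolding cond_indep_on_def
proof
  fix B assume B: "B \<in> {1..N} \<rightarrow> sets MY"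
  let ?F = "vimage_algebra (space M) (\<lambda>\<omega>. (vec_of N X \<omega>, vec_of N E \<omega>, vec_of N T \<omega>))
       (vec_space N MX \<Otimes>\<^sub>M vec_space N ME \<Otimes>\<^sub>M vec_space N bool_space)"
  have *: "(Y False i \<omega>, Y True i \<omega>) \<in> space MY \<times> B i \<longleftrightarrow> Y True i \<omega> \<in> B i" if "i \<in> {1..N}" "\<omega> \<in> space M" for i \<omega>
    using measurable_space[OF Y_measurable[OF that(1)] that(2)] by simp
  have 1: "prob_given M ?F (\<lambda>\<omega>. (Y False i \<omega>, Y True i \<omega>) \<in> space MY \<times> B i) = prob_given M ?F (\<lambda>\<omega>. Y True i \<omega> \<in> B i)"
    if "i \<in> {1..N}" for i
    unfolding prob_given_def using *[OF that] by (intro arg_cong[where f = "real_cond_exp M ?F"] arg_cong[where f = indicator]) auto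
  have all: "(\<forall>i\<in>{1..N}. (Y False i \<omega>, Y True i \<omega>) \<in> space MY \<times> B i) \<longleftrightarrow> (\<forall>i\<in>{1..N}. Y True i \<omega> \<in> B i)"
    if "\<omega> \<in> space M" for \<omega> using * that by blast
  have 2: "prob_given M ?F (\<lambda>\<omega>. \<forall>i\<in>{1..N}. (Y False i \<omega>, Y True i \<omega>) \<in> space MY \<times> B i)
      = prob_given M ?F (\<lambda>\<omega>. \<forall>i\<in>{1..N}. Y True i \<omega> \<in> B i)"
    unfolding prob_given_def
    by (intro arg_cong[where f = "real_cond_exp M ?F"] arg_cong[where f = indicator] Collect_cong conj_cong refl all)
  have "(\<lambda>i. space MY \<times> B i) \<in> {1..N} \<rightarrow> sets (MY \<Otimes>\<^sub>M MY)" using B by auto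
  from Y_cond_indep[unfolded cond_indep_on_def, rule_format, OF this]
  show "AE \<omega> in M. \<omega> \<in> space M \<longrightarrow> prob_given M ?F (\<lambda>\<omega>'. \<forall>j\<in>{1..N}. Y True j \<omega>' \<in> B j) \<omega>
      = (\<Prod>j\<in>{1..N}. prob_given M ?F (\<lambda>\<omega>'. Y True j \<omega>' \<in> B j) \<omega>)"
    unfolding 2 by (simp only: 1 cong: prod.cong)
qed

text \<open>Outcomes are integrated out given covariates, exposures and treatments, and then
  exposures given the design. The product form survives both steps because the outcome kernel of a
  unit reads that unit's covariate and exposure only.\<close>

lemma nn_integral_units:
  assumes f: "f \<in> borel_measurable (design_space \<Otimes>\<^sub>M vec_space N (ME \<Otimes>\<^sub>M MY))"
  shows "(\<integral>\<^sup>+\<omega>. f (design \<omega>, \<lambda>j\<in>{1..N}. (E j \<omega>, Y True j \<omega>)) \<partial>M)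
    = (\<integral>\<^sup>+\<omega>. (\<integral>\<^sup>+z. f (design \<omega>, z) \<partial>PiM {1..N} (\<lambda>j. unit_kernel j (design \<omega>))) \<partial>M)"
proof -
  have "(\<integral>\<^sup>+\<omega>. indicator (space design_space) (design \<omega>) * f (design \<omega>, \<lambda>j\<in>{1..N}. (E j \<omega>, Y True j \<omega>)) \<partial>M)
    = (\<integral>\<^sup>+\<omega>. indicator (space design_space) (design \<omega>) *
        (\<integral>\<^sup>+z. f (design \<omega>, z) \<partial>PiM {1..N} (\<lambda>j. unit_kernel j (design \<omega>))) \<partial>M)"
  proof (rule nn_integral_disintegration_PiM[OF _ design_measurable _ unit_kernel_measurable sets.top _ _ _ f])
    show "finite_measure M" "space M \<noteq> {}" by unfold_locales (rule not_empty)
    show "(\<lambda>\<omega>. (E j \<omega>, Y True j \<omega>)) \<in> M \<rightarrow>\<^sub>M ME \<Otimes>\<^sub>M MY" if [measurable]: "j \<in> {1..N}" for j by measurable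
    fix C and B :: "nat \<Rightarrow> ('e \<times> 'y) set"
    assume C [measurable]: "C \<in> sets design_space" and B: "B \<in> {1..N} \<rightarrow> sets (ME \<Otimes>\<^sub>M MY)"
    have B' [measurable]: "B j \<in> sets (ME \<Otimes>\<^sub>M MY)" if "j \<in> {1..N}" for j using B that by auto
    let ?D3 = "\<lambda>\<omega>. (vec_of N X \<omega>, vec_of N E \<omega>, vec_of N T \<omega>)"
    let ?M3 = "vec_space N MX \<Otimes>\<^sub>M vec_space N ME \<Otimes>\<^sub>M vec_space N bool_space"
    let ?f3 = "\<lambda>p. indicator C (fst (fst p), snd (snd (fst p)))
        * (\<Prod>j\<in>{1..N}. indicator (B j) (fst (snd (fst p)) j, snd p j)) :: ennreal"
    \<comment> \<open>The conditional probability of \<open>B j\<close> once the outcome is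
      integrated out, as a function of the covariate and exposure of one unit.\<close>
    define h where "h j p = (\<integral>\<^sup>+y. indicator (B j) (snd p, y) \<partial>PY True p)" for j p
    have h [measurable]: "h j \<in> borel_measurable (MX \<Otimes>\<^sub>M ME)" if [measurable]: "j \<in> {1..N}" for j
      unfolding h_def
      by (rule nn_integral_measurable_subprob_algebra2[where N = MY])
         (use measurable_prob_algebraD[OF PY_kernel] in auto)
    have vecs: "vec_of N X \<omega> \<in> space (vec_space N MX)" "vec_of N E \<omega> \<in> space (vec_space N ME)"
        "design \<omega> \<in> space design_space" if "\<omega> \<in> space M" for \<omega>
      using that by (auto intro!: measurable_space[of _ M])
    have XE: "X j \<omega> \<in> space MX" "E j \<omega> \<in> space ME" if "\<omega> \<in> space M" "j \<in> {1..N}" for \<omega> j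
      using that by (auto intro!: measurable_space[of _ M])
    have "emeasure M {\<omega> \<in> space M. design \<omega> \<in> C \<and> (\<forall>j\<in>{1..N}. (E j \<omega>, Y True j \<omega>) \<in> B j)}
      = (\<integral>\<^sup>+\<omega>. indicator {\<omega> \<in> space M. design \<omega> \<in> C \<and> (\<forall>j\<in>{1..N}. (E j \<omega>, Y True j \<omega>) \<in> B j)} \<omega> \<partial>M)"
      by (rule nn_integral_indicator[symmetric]) measurable
    also have "\<dots> = (\<integral>\<^sup>+\<omega>. ?f3
        (?D3 \<omega>, \<lambda>j\<in>{1..N}. Y True j \<omega>) \<partial>M)"
      by (intro nn_integral_cong)
         (auto simp: design_def vec_of_def prod_zero_iff intro!: prod.neutral[symmetric] split: split_indicator)
    also have "\<dots> = (\<integral>\<^sup>+\<omega>. (\<integral>\<^sup>+y. ?f3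
        (?D3 \<omega>, y) \<partial>PiM {1..N} (\<lambda>j. (\<lambda>(x, e, t). PY True (x j, e j)) (?D3 \<omega>))) \<partial>M)"
    proof (rule nn_integral_disintegration_cond_indep_space[OF prob_space_axioms _ _ _ _ Y1_cond_indep])
      show "cond_law_on M (space M) (vimage_algebra (space M) ?D3 ?M3) MY (Y True j)
          (\<lambda>\<omega>. (\<lambda>(x, e, t). PY True (x j, e j)) (?D3 \<omega>))" if "j \<in> {1..N}" for j
        using Y_cond_law[OF that, of True] that by (simp add: vec_of_def)
    qed measurable
    \<comment> \<open>What is left is again a product with one exposure per factor, so the exposures
      can be treated in the same way.\<close>
    also have "\<dots> = (\<integral>\<^sup>+\<omega>. (\<lambda>(d, e). indicator C d * (\<Prod>j\<in>{1..N}. h j (fst d j, e j))) (design \<omega>, \<lambda>j\<in>{1..N}. E j \<omega>) \<partial>M)"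
    proof (rule nn_integral_cong)
      fix \<omega> assume \<omega>: "\<omega> \<in> space M"
      have ps: "prob_space (PY True (X j \<omega>, E j \<omega>))" if "j \<in> {1..N}" for j
        using prob_space_PY XE \<omega> that by auto
      have [measurable]: "(\<lambda>y. indicator (B j) (E j \<omega>, y) :: ennreal) \<in> borel_measurable (PY True (X j \<omega>, E j \<omega>))" if [measurable]: "j \<in> {1..N}" for j
      proof -
        have [measurable_cong]: "sets (PY True (X j \<omega>, E j \<omega>)) = sets MY"
          by (rule prob_space_PY(2)[OF XE[OF \<omega> that]])
        show ?thesis using XE[OF \<omega> that] by measurable
      qed
      have PP: "PiM {1..N} (\<lambda>j. PY True (vec_of N X \<omega> j, vec_of N E \<omega> j)) = PiM {1..N} (\<lambda>j. PY True (X j \<omega>, E j \<omega>))"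
        by (intro PiM_cong) (auto simp: vec_of_def)
      have v1: "(\<Prod>j\<in>{1..N}. indicator (B j) (vec_of N E \<omega> j, y j)) = (\<Prod>j\<in>{1..N}. indicator (B j) (E j \<omega>, y j) :: ennreal)" for y
        by (intro prod.cong) (auto simp: vec_of_def)
      have v2: "(\<Prod>j\<in>{1..N}. h j (vec_of N X \<omega> j, (\<lambda>j\<in>{1..N}. E j \<omega>) j)) = (\<Prod>j\<in>{1..N}. h j (X j \<omega>, E j \<omega>))"
        by (intro prod.cong) (auto simp: vec_of_def)
      have "(\<integral>\<^sup>+y. indicator C (design \<omega>) * (\<Prod>j\<in>{1..N}. indicator (B j) (E j \<omega>, y j)) \<partial>PiM {1..N} (\<lambda>j. PY True (X j \<omega>, E j \<omega>)))
        = indicator C (design \<omega>) * (\<integral>\<^sup>+y. (\<Prod>j\<in>{1..N}. indicator (B j) (E j \<omega>, y j)) \<partial>PiM {1..N} (\<lambda>j. PY True (X j \<omega>, E j \<omega>)))"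
        by (rule nn_integral_cmult) measurable
      also have "\<dots> = indicator C (design \<omega>) * (\<Prod>j\<in>{1..N}. h j (X j \<omega>, E j \<omega>))"
        using ps by (subst nn_integral_PiM_prod_prob) (auto simp: h_def)
      finally show "(\<integral>\<^sup>+y. ?f3
        (?D3 \<omega>, y) \<partial>PiM {1..N} (\<lambda>j. (\<lambda>(x, e, t). PY True (x j, e j)) (?D3 \<omega>)))
        = (\<lambda>(d, e). indicator C d * (\<Prod>j\<in>{1..N}. h j (fst d j, e j))) (design \<omega>, \<lambda>j\<in>{1..N}. E j \<omega>)"
        by (simp only: prod.case PP fst_conv snd_conv v1 v2 design_def)
    qed
    also have "\<dots> = (\<integral>\<^sup>+\<omega>. (\<integral>\<^sup>+e. (\<lambda>(d, e). indicator C d * (\<Prod>j\<in>{1..N}. h j (fst d j, e j))) (design \<omega>, e)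
        \<partial>PiM {1..N} (\<lambda>j. exposure_kernel j (design \<omega>))) \<partial>M)"
    proof (rule nn_integral_disintegration_cond_indep_space[OF prob_space_axioms _ _ _ exposure_kernel_measurable])
      show "cond_indep_on M (space M) (vimage_algebra (space M) design design_space) {1..N} ME E"
        using E_cond_indep by (simp add: design_def[abs_def])
      show "cond_law_on M (space M) (vimage_algebra (space M) design design_space) ME (E j)
          (\<lambda>\<omega>. exposure_kernel j (design \<omega>))" if "j \<in> {1..N}" for j
        using E_cond_law[OF that] that by (simp add: exposure_kernel_def design_def[abs_def] vec_of_def)
    qed measurable
    also have "\<dots> = (\<integral>\<^sup>+\<omega>. indicator C (design \<omega>) * (\<Prod>j\<in>{1..N}. emeasure (unit_kernel j (design \<omega>)) (B j)) \<partial>M)"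
    proof (rule nn_integral_cong)
      fix \<omega> assume \<omega>: "\<omega> \<in> space M"
      note d = vecs(3)[OF \<omega>]
      have x: "fst (design \<omega>) j \<in> space MX" if "j \<in> {1..N}" for j
        using that vecs(1)[OF \<omega>] by (auto simp: design_def space_PiM PiE_iff)
      have hm [measurable]: "(\<lambda>e. h j (fst (design \<omega>) j, e)) \<in> borel_measurable (exposure_kernel j (design \<omega>))" if [measurable]: "j \<in> {1..N}" for j
      proof -
        have [measurable_cong]: "sets (exposure_kernel j (design \<omega>)) = sets ME"
          by (rule prob_space_exposure_kernel(2)[OF that d])
        show ?thesis using x[OF that] by measurable
      qed
      have "(\<integral>\<^sup>+e. indicator C (design \<omega>) * (\<Prod>j\<in>{1..N}. h j (fst (design \<omega>) j, e j)) \<partial>PiM {1..N} (\<lambda>j. exposure_kernel j (design \<omega>)))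
        = indicator C (design \<omega>) * (\<integral>\<^sup>+e. (\<Prod>j\<in>{1..N}. h j (fst (design \<omega>) j, e j)) \<partial>PiM {1..N} (\<lambda>j. exposure_kernel j (design \<omega>)))"
        by (rule nn_integral_cmult) measurable
      also have "\<dots> = indicator C (design \<omega>) * (\<Prod>j\<in>{1..N}. (\<integral>\<^sup>+e. h j (fst (design \<omega>) j, e) \<partial>exposure_kernel j (design \<omega>)))"
        using prob_space_exposure_kernel(1)[OF _ d] hm by (subst nn_integral_PiM_prod_prob) auto
      also have "(\<Prod>j\<in>{1..N}. (\<integral>\<^sup>+e. h j (fst (design \<omega>) j, e) \<partial>exposure_kernel j (design \<omega>)))
          = (\<Prod>j\<in>{1..N}. emeasure (unit_kernel j (design \<omega>)) (B j))"
      proof (rule prod.cong[OF refl])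
        fix j assume j: "j \<in> {1..N}"
        have "emeasure (unit_kernel j (design \<omega>)) (B j) = (\<integral>\<^sup>+z. indicator (B j) z \<partial>unit_kernel j (design \<omega>))"
          using B'[OF j] prob_space_unit_kernel(2)[OF j d] by simp
        also have "\<dots> = (\<integral>\<^sup>+e. h j (fst (design \<omega>) j, e) \<partial>exposure_kernel j (design \<omega>))"
          using B'[OF j] by (subst nn_integral_unit_kernel[OF j d]) (auto simp: h_def)
        finally show "(\<integral>\<^sup>+e. h j (fst (design \<omega>) j, e) \<partial>exposure_kernel j (design \<omega>)) = emeasure (unit_kernel j (design \<omega>)) (B j)" ..
      qed
      finally show "(\<integral>\<^sup>+e. (\<lambda>(d, e). indicator C d * (\<Prod>j\<in>{1..N}. h j (fst d j, e j))) (design \<omega>, e)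
        \<partial>PiM {1..N} (\<lambda>j. exposure_kernel j (design \<omega>)))
        = indicator C (design \<omega>) * (\<Prod>j\<in>{1..N}. emeasure (unit_kernel j (design \<omega>)) (B j))"
        by simp
    qed
    finally show "emeasure M {\<omega> \<in> space M. design \<omega> \<in> C \<and> (\<forall>j\<in>{1..N}. (E j \<omega>, Y True j \<omega>) \<in> B j)}
      = (\<integral>\<^sup>+\<omega>. indicator C (design \<omega>) * (\<Prod>j\<in>{1..N}. emeasure (unit_kernel j (design \<omega>)) (B j)) \<partial>M)" .
  qed auto
  moreover have "indicator (space design_space) (design \<omega>) * a = a" if "\<omega> \<in> space M" for \<omega> and a :: ennreal
    using measurable_space[OF design_measurable that] by simp
  ultimately show ?thesis by (simp only: cong: nn_integral_cong)
qed

section \<open>Changing the treatment of one unit\<close>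

lemma switch_on_measurable [measurable]:
  assumes i: "i \<in> {1..N}"
  shows "switch_on i \<in> design_space \<rightarrow>\<^sub>M design_space"
proof -
  have [measurable]: "(\<lambda>d. (snd d)(i := True)) \<in> design_space \<rightarrow>\<^sub>M vec_space N bool_space"
    by (rule measurable_fun_upd[where J = "{1..N}"]) (use i in auto)
  show ?thesis unfolding switch_on_def by measurable
qed

lemma propensity_range:
  assumes "x \<in> space MX"
  shows "0 < \<pi> x" "\<pi> x < 1" "0 < weight \<pi> x"
proof -
  show *: "0 < \<pi> x" "\<pi> x < 1" using overlap[OF assms] \<pi>_min_range by auto
  show "0 < weight \<pi> x" using * by (simp add: weight_def)
qed

lemma weight_measurable [measurable]: "weight \<pi> \<in> borel_measurable MX"
  unfolding weight_def by measurable

text \<open>Given the covariates and the treatments of all other units, the left side gives the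
  switched design the mass of \<open>T i\<close> being false, and the right side the mass of
  \<open>T i\<close> being true times the odds weight. These are equal, which is where the weights
  of the conformal p-value come from.\<close>

lemma nn_integral_switch_on:
  assumes i [measurable]: "i \<in> {1..N}" and g [measurable]: "g \<in> borel_measurable design_space"
  shows "(\<integral>\<^sup>+\<omega>. of_bool (\<not> T i \<omega>) * g (switch_on i (design \<omega>)) \<partial>M)
    = (\<integral>\<^sup>+\<omega>. of_bool (T i \<omega>) * ennreal (weight \<pi> (X i \<omega>)) * g (design \<omega>) \<partial>M)"
proof -
  let ?K = "\<lambda>j x. measure_pmf (bernoulli_pmf (\<pi> (x j)))"
  have comp: "x j \<in> space MX" if "x \<in> space (vec_space N MX)" "j \<in> {1..N}" for x j
    using that by (auto simp: space_PiM PiE_iff)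
  have disint: "(\<integral>\<^sup>+\<omega>. f (vec_of N X \<omega>, vec_of N T \<omega>) \<partial>M)
    = (\<integral>\<^sup>+\<omega>. (\<integral>\<^sup>+t. f (vec_of N X \<omega>, t) \<partial>PiM {1..N} (\<lambda>j. ?K j (vec_of N X \<omega>))) \<partial>M)"
    if f [measurable]: "f \<in> borel_measurable design_space" for f
  proof -
    have K: "?K j \<in> vec_space N MX \<rightarrow>\<^sub>M prob_algebra bool_space" if [measurable]: "j \<in> {1..N}" for j
      using propensity_range comp that by (intro measurable_bernoulli_pmf) (auto simp: less_imp_le)
    have "cond_law_on M (space M) (vimage_algebra (space M) (vec_of N X) (vec_space N MX))
        bool_space (T j) (\<lambda>\<omega>. ?K j (vec_of N X \<omega>))" if "j \<in> {1..N}" for j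
      using T_cond_law[OF that] that by (simp add: vec_of_def)
    from nn_integral_disintegration_cond_indep_space[OF prob_space_axioms _ _ T_measurable K T_cond_indep this f]
    show ?thesis by (simp add: vec_of_def[of N T])
  qed
  define f1 where "f1 d = of_bool (\<not> snd d i) * g (switch_on i d)" for d
  define f2 where "f2 d = of_bool (snd d i) * ennreal (weight \<pi> (fst d i)) * g d" for d
  have f [measurable]: "f1 \<in> borel_measurable design_space" "f2 \<in> borel_measurable design_space"
    unfolding f1_def f2_def by measurable
  have inner: "(\<integral>\<^sup>+t. f1 (x, t) \<partial>PiM {1..N} (\<lambda>j. ?K j x)) = (\<integral>\<^sup>+t. f2 (x, t) \<partial>PiM {1..N} (\<lambda>j. ?K j x))"
    if x: "x \<in> space (vec_space N MX)" for x
  proof -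
    have p: "0 < \<pi> (x i)" "\<pi> (x i) < 1" using propensity_range comp[OF x i] by auto
    have ins: "insert i ({1..N} - {i}) = {1..N}" using i by auto
    \<comment> \<open>Coordinate \<open>i\<close> is integrated innermost, so that its two values
      appear explicitly under the law of the other treatments.\<close>
    have exp: "(\<integral>\<^sup>+t. f (x, t) \<partial>PiM {1..N} (\<lambda>j. ?K j x))
        = (\<integral>\<^sup>+t. f (x, t(i := True)) * \<pi> (x i) + f (x, t(i := False)) * (1 - \<pi> (x i)) \<partial>PiM ({1..N} - {i}) (\<lambda>j. ?K j x))"
      if f [measurable]: "f \<in> borel_measurable design_space" for f
    proof -
      have "sets (PiM {1..N} (\<lambda>j. ?K j x)) = sets (vec_space N bool_space)"
        by (intro sets_PiM_cong) auto
      then have "(\<lambda>t. f (x, t)) \<in> borel_measurable (PiM {1..N} (\<lambda>j. ?K j x))"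
        using x by (simp cong: measurable_cong_sets)
      then have "(\<integral>\<^sup>+t. f (x, t) \<partial>PiM {1..N} (\<lambda>j. ?K j x))
          = (\<integral>\<^sup>+t. \<integral>\<^sup>+b. f (x, t(i := b)) \<partial>?K i x \<partial>PiM ({1..N} - {i}) (\<lambda>j. ?K j x))"
        using nn_integral_PiM_insert_prob(2)[of "{1..N} - {i}" i "\<lambda>j. ?K j x" "\<lambda>t. f (x, t)", unfolded ins]
        by (simp add: prob_space_measure_pmf)
      then show ?thesis using p by simp
    qed
    have "ennreal (1 - \<pi> (x i)) = ennreal (weight \<pi> (x i)) * ennreal (\<pi> (x i))"
      using p by (simp add: weight_def ennreal_mult[symmetric])
    then show ?thesis
      unfolding exp[OF f(1)] exp[OF f(2)] by (intro nn_integral_cong) (simp add: f1_def f2_def switch_on_def mult_ac)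
  qed
  have "(\<integral>\<^sup>+\<omega>. f1 (design \<omega>) \<partial>M) = (\<integral>\<^sup>+\<omega>. f2 (design \<omega>) \<partial>M)"
    unfolding design_def disint[OF f(1)] disint[OF f(2)]
    by (intro nn_integral_cong inner) (auto intro!: measurable_space[of _ M] vec_of_measurable)
  then show ?thesis using i by (simp add: f1_def f2_def design_def vec_of_def cong: nn_integral_cong)
qed

abbreviation unit_space :: "('e \<times> 'y) measure" where
  "unit_space \<equiv> ME \<Otimes>\<^sub>M MY"

definition units :: "'w \<Rightarrow> nat \<Rightarrow> 'e \<times> 'y" where
  "units \<omega> = (\<lambda>j\<in>{1..N}. (E j \<omega>, Y True j \<omega>))"

lemma units_measurable [measurable]: "units \<in> M \<rightarrow>\<^sub>M vec_space N unit_space"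
  unfolding units_def by measurable

text \<open>The one-unit marginal of the product kernel; it is the observed counterpart of what the
  stability condition says about a single unit.\<close>

lemma nn_integral_design_unit:
  assumes j [measurable]: "j \<in> {1..N}"
    and C [measurable]: "C \<in> sets design_space" and A [measurable]: "A \<in> sets (design_space \<Otimes>\<^sub>M unit_space)"
  shows "(\<integral>\<^sup>+\<omega>. indicator C (design \<omega>) * indicator A (design \<omega>, units \<omega> j) \<partial>M)
    = (\<integral>\<^sup>+\<omega>. indicator C (design \<omega>) * emeasure (unit_kernel j (design \<omega>)) (Pair (design \<omega>) -` A) \<partial>M)"
proof -
  let ?f = "\<lambda>p. indicator C (fst p) * indicator A (fst p, snd p j) :: ennreal"
  have "(\<integral>\<^sup>+\<omega>. ?f (design \<omega>, units \<omega>) \<partial>M)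
    = (\<integral>\<^sup>+\<omega>. (\<integral>\<^sup>+z. ?f (design \<omega>, z) \<partial>PiM {1..N} (\<lambda>j. unit_kernel j (design \<omega>))) \<partial>M)"
    unfolding units_def by (rule nn_integral_units) measurable
  also have "\<dots> = (\<integral>\<^sup>+\<omega>. indicator C (design \<omega>) * emeasure (unit_kernel j (design \<omega>)) (Pair (design \<omega>) -` A) \<partial>M)"
  proof (rule nn_integral_cong)
    fix \<omega> assume "\<omega> \<in> space M"
    then have d: "design \<omega> \<in> space design_space" by (rule measurable_space[OF design_measurable])
    let ?P = "PiM {1..N} (\<lambda>j. unit_kernel j (design \<omega>))"
    have sj: "sets (unit_kernel j (design \<omega>)) = sets unit_space" by (rule prob_space_unit_kernel[OF j d])
    have Aj [measurable]: "Pair (design \<omega>) -` A \<in> sets (unit_kernel j (design \<omega>))"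
      using sets_Pair1[OF A] sj by simp
    have "(\<integral>\<^sup>+z. ?f (design \<omega>, z) \<partial>?P) = (\<integral>\<^sup>+z. indicator C (design \<omega>) * indicator {z \<in> space ?P. z j \<in> Pair (design \<omega>) -` A} z \<partial>?P)"
      by (intro nn_integral_cong) (auto split: split_indicator)
    also have "\<dots> = indicator C (design \<omega>) * emeasure ?P {z \<in> space ?P. z j \<in> Pair (design \<omega>) -` A}"
      by (rule nn_integral_cmult_indicator) measurable
    also have "emeasure ?P {z \<in> space ?P. z j \<in> Pair (design \<omega>) -` A} = emeasure (unit_kernel j (design \<omega>)) (Pair (design \<omega>) -` A)"
      using prob_space_unit_kernel(1)[OF _ d] by (intro emeasure_PiM_component j Aj) auto
    finally show "(\<integral>\<^sup>+z. ?f (design \<omega>, z) \<partial>?P) = indicator C (design \<omega>) * emeasure (unit_kernel j (design \<omega>)) (Pair (design \<omega>) -` A)" .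
  qed
  finally show ?thesis by simp
qed

lemma nbhd_pred [measurable]:
  assumes "j \<in> {1..N}"
  shows "Measurable.pred (vec_space N MX) (\<lambda>x. l \<in> nbhd j x)"
  by (rule measurable_compose[OF nbhd_measurable[OF assms]]) simp

text \<open>The treatment of \<open>i\<close> does not occur in the local configuration of a unit
  that does not have \<open>i\<close> as a neighbor.\<close>

lemma unit_kernel_switch_on_eq:
  assumes "i \<notin> nbhd j (fst d)"
  shows "unit_kernel j (switch_on i d) = unit_kernel j d"
proof -
  have "image_mset (\<lambda>k. (fst d k, ((snd d)(i := True)) k)) (mset_set (nbhd j (fst d)))
      = image_mset (\<lambda>k. (fst d k, snd d k)) (mset_set (nbhd j (fst d)))"
  proof (rule image_mset_cong)
    fix k assume "k \<in># mset_set (nbhd j (fst d))"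
    \<comment> \<open>No finiteness of the neighborhood is assumed: for an infinite set
      \<open>mset_set\<close> is empty, so membership in it still implies membership in the
      set.\<close>
    then have "k \<in> nbhd j (fst d)" by (metis elem_mset_set equals0D infinite_set_mset_mset_set)
    then show "(fst d k, ((snd d)(i := True)) k) = (fst d k, snd d k)" using assms by auto
  qed
  then show ?thesis
    by (simp add: unit_kernel_def exposure_kernel_def switch_on_def local_config_def)
qed

text \<open>The map \<open>g\<close> separates the design at which the kernel is taken from the one
  at which the event is cut: after a switch, events are still written in terms of the original
  design.\<close>

lemma emeasure_unit_kernel_measurable:
  assumes j [measurable]: "j \<in> {1..N}" and g: "g \<in> design_space \<rightarrow>\<^sub>M design_space"
    and A: "A \<in> sets (design_space \<Otimes>\<^sub>M unit_space)"
  shows "(\<lambda>d. emeasure (unit_kernel j (g d)) (Pair d -` A)) \<in> borel_measurable design_space"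
proof (rule emeasure_measurable_subprob_algebra2)
  have "(SIGMA d:space design_space. Pair d -` A) = A"
    using sets.sets_into_space[OF A] by (auto simp: space_pair_measure)
  then show "(SIGMA d:space design_space. Pair d -` A) \<in> sets (design_space \<Otimes>\<^sub>M unit_space)" using A by simp
  show "(\<lambda>d. unit_kernel j (g d)) \<in> design_space \<rightarrow>\<^sub>M subprob_algebra unit_space"
    using g by (intro measurable_prob_algebraD measurable_compose[OF g unit_kernel_measurable[OF j]])
qed

end

section \<open>The random target and the stability condition\<close>

context interventional_interference
begin

declare I_measurable [measurable] E_int_measurable [measurable] Y1_int_measurable [measurable]

lemma vec_of_E_int_measurable [measurable]: "vec_of N E_int \<in> M \<rightarrow>\<^sub>M vec_space N ME"
  unfolding vec_of_def by measurable

text \<open>The law of design and units on the event \<open>I = i\<close> is, by independence and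
  uniformity, the full law scaled by \<open>1 / N\<close>. This is how statements about the random
  target are traded for statements about a fixed one.\<close>

lemma nn_integral_index:
  assumes i: "i \<in> {1..N}"
    and f [measurable]: "f \<in> borel_measurable (design_space \<Otimes>\<^sub>M vec_space N unit_space)"
  shows "(\<integral>\<^sup>+\<omega>. indicator {i} (I \<omega>) * f (design \<omega>, units \<omega>) \<partial>M)
    = ennreal (1 / N) * (\<integral>\<^sup>+\<omega>. f (design \<omega>, units \<omega>) \<partial>M)"
proof -
  let ?S = "design_space \<Otimes>\<^sub>M vec_space N unit_space"
  let ?P = "\<lambda>\<omega>. (design \<omega>, units \<omega>)"
  let ?big = "\<lambda>\<omega>. (vec_of N X \<omega>, vec_of N T \<omega>, vec_of N E \<omega>, vec_of N (Y False) \<omega>, vec_of N (Y True) \<omega>)"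
  let ?B = "vec_space N MX \<Otimes>\<^sub>M vec_space N bool_space \<Otimes>\<^sub>M vec_space N ME \<Otimes>\<^sub>M vec_space N MY \<Otimes>\<^sub>M vec_space N MY"
  define M' where "M' = density M (\<lambda>\<omega>. indicator {i} (I \<omega>) :: ennreal)"
  \<comment> \<open>Independence of \<open>I\<close> is stated for the vector that also contains the
    untreated outcomes; \<open>g\<close> forgets them and regroups the rest.\<close>
  define g where "g b = ((fst b, fst (snd b)), \<lambda>j\<in>{1..N}. (fst (snd (snd b)) j, snd (snd (snd (snd b))) j))"
    for b :: "(nat \<Rightarrow> 'x) \<times> (nat \<Rightarrow> bool) \<times> (nat \<Rightarrow> 'e) \<times> (nat \<Rightarrow> 'y) \<times> (nat \<Rightarrow> 'y)"
  have g [measurable]: "g \<in> ?B \<rightarrow>\<^sub>M ?S"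
    unfolding g_def by measurable
  have gP: "?P \<omega> = g (?big \<omega>)" for \<omega>
    by (auto simp: g_def design_def units_def vec_of_def intro!: restrict_ext)
  have [measurable_cong]: "sets M' = sets M" by (simp add: M'_def)
  have Ii [measurable]: "{\<omega> \<in> space M. I \<omega> = i} \<in> sets M"
    by measurable
  have [measurable]: "(\<lambda>\<omega>. indicator {i} (I \<omega>) :: ennreal) \<in> borel_measurable M"
    by (rule measurable_compose[OF I_measurable]) simp
  have "distr M' ?S ?P = scale_measure (ennreal (1 / N)) (distr M ?S ?P)"
  proof (rule measure_eqI)
    fix A assume "A \<in> sets (distr M' ?S ?P)"
    then have A [measurable]: "A \<in> sets ?S" by simp
    have "I -` {i} \<inter> space M \<in> sets (vimage_algebra (space M) I (count_space {1..N}))"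
      using i by (intro in_vimage_algebra) simp
    moreover have "?big -` (g -` A \<inter> space ?B) \<inter> space M \<in> sets (vimage_algebra (space M) ?big ?B)"
      by (intro in_vimage_algebra) measurable
    ultimately have "prob ((I -` {i} \<inter> space M) \<inter> (?big -` (g -` A \<inter> space ?B) \<inter> space M))
        = prob (I -` {i} \<inter> space M) * prob (?big -` (g -` A \<inter> space ?B) \<inter> space M)"
      by (rule indep_setD[OF I_indep])
    also have "?big -` (g -` A \<inter> space ?B) \<inter> space M = ?P -` A \<inter> space M"
      unfolding gP using measurable_space[of ?big M ?B] by auto
    also have "prob (I -` {i} \<inter> space M) = measure (distr M (count_space {1..N}) I) {i}"
      using i by (subst measure_distr) auto
    also have "\<dots> = 1 / N"
      unfolding I_uniform using i by (subst measure_uniform_count_measure) auto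
    finally have eq: "prob ((I -` {i} \<inter> space M) \<inter> (?P -` A \<inter> space M)) = 1 / N * prob (?P -` A \<inter> space M)" .
    have "emeasure (distr M' ?S ?P) A = emeasure M' (?P -` A \<inter> space M)"
      by (subst emeasure_distr) (auto simp: M'_def)
    also have "\<dots> = (\<integral>\<^sup>+\<omega>. indicator {i} (I \<omega>) * indicator (?P -` A \<inter> space M) \<omega> \<partial>M)"
      unfolding M'_def by (subst emeasure_density) auto
    also have "\<dots> = (\<integral>\<^sup>+\<omega>. indicator ((I -` {i} \<inter> space M) \<inter> (?P -` A \<inter> space M)) \<omega> \<partial>M)"
      by (intro nn_integral_cong) (auto split: split_indicator)
    also have "\<dots> = emeasure M ((I -` {i} \<inter> space M) \<inter> (?P -` A \<inter> space M))"
    proof (rule nn_integral_indicator)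
      have "I -` {i} \<inter> space M \<in> sets M" using i by (intro measurable_sets[OF I_measurable]) auto
      then show "(I -` {i} \<inter> space M) \<inter> (?P -` A \<inter> space M) \<in> sets M" by measurable
    qed
    also have "\<dots> = ennreal (1 / N) * emeasure M (?P -` A \<inter> space M)"
      unfolding emeasure_eq_measure eq by (rule ennreal_mult) simp_all
    also have "\<dots> = emeasure (scale_measure (ennreal (1 / N)) (distr M ?S ?P)) A"
      by (simp add: emeasure_distr)
    finally show "emeasure (distr M' ?S ?P) A = emeasure (scale_measure (ennreal (1 / N)) (distr M ?S ?P)) A" .
  qed simp
  then have "(\<integral>\<^sup>+p. f p \<partial>distr M' ?S ?P) = ennreal (1 / N) * (\<integral>\<^sup>+p. f p \<partial>distr M ?S ?P)"
    by (simp add: nn_integral_scale_measure)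
  then show ?thesis
    by (simp add: nn_integral_distr M'_def nn_integral_density)
qed

text \<open>The interventional laws are prescribed only for an untreated target, hence the condition
  that \<open>i\<close> is untreated on \<open>C\<close>. The outcome of unit \<open>j\<close> is
  integrated out given its interventional exposure, and then that exposure given the design and the
  target; together they form the unit kernel at the switched design.\<close>

lemma nn_integral_interventional_unit:
  assumes i [measurable]: "i \<in> {1..N}" and j [measurable]: "j \<in> {1..N}"
    and C [measurable]: "C \<in> sets design_space" and C_untreated: "\<And>d. d \<in> C \<Longrightarrow> \<not> snd d i"
    and A [measurable]: "A \<in> sets (design_space \<Otimes>\<^sub>M unit_space)"
  shows "(\<integral>\<^sup>+\<omega>. indicator {i} (I \<omega>) * indicator C (design \<omega>) * indicator A (design \<omega>, (E_int j \<omega>, Y1_int j \<omega>)) \<partial>M)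
    = (\<integral>\<^sup>+\<omega>. indicator {i} (I \<omega>) * indicator C (design \<omega>)
          * emeasure (unit_kernel j (switch_on i (design \<omega>))) (Pair (design \<omega>) -` A) \<partial>M)"
proof -
  let ?D1 = "\<lambda>\<omega>. (vec_of N X \<omega>, vec_of N T \<omega>, I \<omega>)"
  let ?M1 = "vec_space N MX \<Otimes>\<^sub>M vec_space N bool_space \<Otimes>\<^sub>M count_space {1..N}"
  let ?D2 = "\<lambda>\<omega>. (vec_of N X \<omega>, vec_of N T \<omega>, I \<omega>, vec_of N E_int \<omega>)"
  let ?M2 = "vec_space N MX \<Otimes>\<^sub>M vec_space N bool_space \<Otimes>\<^sub>M count_space {1..N} \<Otimes>\<^sub>M vec_space N ME"
  define G1 where "G1 = {p \<in> space ?M1. (fst p, fst (snd p)) \<in> C \<and> snd (snd p) = i}"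
  define G2 where "G2 = {p \<in> space ?M2. (fst p, fst (snd p)) \<in> C \<and> fst (snd (snd p)) = i}"
  have G1 [measurable]: "G1 \<in> sets ?M1" unfolding G1_def by measurable
  have G2 [measurable]: "G2 \<in> sets ?M2" unfolding G2_def by measurable
  have D1: "?D1 \<in> M \<rightarrow>\<^sub>M ?M1" and D2: "?D2 \<in> M \<rightarrow>\<^sub>M ?M2" by measurable
  have ind1: "indicator G1 (?D1 \<omega>) = (indicator {i} (I \<omega>) * indicator C (design \<omega>) :: ennreal)" if "\<omega> \<in> space M" for \<omega>
    using measurable_space[OF D1 that] by (auto simp: G1_def design_def split: split_indicator)
  have ind2: "indicator G2 (?D2 \<omega>) = (indicator {i} (I \<omega>) * indicator C (design \<omega>) :: ennreal)" if "\<omega> \<in> space M" for \<omega>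
    using measurable_space[OF D2 that] by (auto simp: G2_def design_def split: split_indicator)
  \<comment> \<open>Fixing the target as well turns the update at \<open>I \<omega>\<close> in the
    prescribed exposure law into \<open>switch_on i\<close>.\<close>
  define \<Omega> where "\<Omega> = {\<omega> \<in> space M. \<not> T (I \<omega>) \<omega> \<and> I \<omega> = i}"
  have \<Omega>1: "\<omega> \<in> \<Omega>" if "\<omega> \<in> space M" "?D1 \<omega> \<in> G1" for \<omega>
    using that C_untreated[of "(vec_of N X \<omega>, vec_of N T \<omega>)"] i by (auto simp: \<Omega>_def G1_def vec_of_def)
  have \<Omega>2: "\<omega> \<in> \<Omega>" if "\<omega> \<in> space M" "?D2 \<omega> \<in> G2" for \<omega>
    using that C_untreated[of "(vec_of N X \<omega>, vec_of N T \<omega>)"] i by (auto simp: \<Omega>_def G2_def vec_of_def)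
  define h where "h d e = (\<integral>\<^sup>+y. indicator A (d, (e, y)) \<partial>PY True (fst d j, e))" for d e
  have h [measurable]: "case_prod h \<in> borel_measurable (design_space \<Otimes>\<^sub>M ME)"
    unfolding h_def split_beta'
    by (rule nn_integral_measurable_subprob_algebra2[where N = MY])
       (use measurable_prob_algebraD[OF PY_kernel] in measurable)
  let ?f2 = "\<lambda>p. indicator A ((fst (fst p), fst (snd (fst p))), (snd (snd (snd (fst p))) j, snd p j)) :: ennreal"
  let ?K2 = "\<lambda>k p. PY True (fst p j, snd (snd (snd p)) j)"
  let ?f1 = "\<lambda>p. h (fst (fst p), fst (snd (fst p))) (snd p j)"
  let ?K1 = "\<lambda>k p. exposure_kernel j (switch_on i (fst p, fst (snd p)))"
  have "(\<integral>\<^sup>+\<omega>. indicator {i} (I \<omega>) * indicator C (design \<omega>) * indicator A (design \<omega>, (E_int j \<omega>, Y1_int j \<omega>)) \<partial>M)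
      = (\<integral>\<^sup>+\<omega>. indicator G2 (?D2 \<omega>) * ?f2 (?D2 \<omega>, \<lambda>k\<in>{j}. Y1_int k \<omega>) \<partial>M)"
  proof (rule nn_integral_cong)
    fix \<omega> assume \<omega>: "\<omega> \<in> space M"
    have "vec_of N E_int \<omega> j = E_int j \<omega>" using j by (simp add: vec_of_def)
    then show "indicator {i} (I \<omega>) * indicator C (design \<omega>) * indicator A (design \<omega>, (E_int j \<omega>, Y1_int j \<omega>))
        = indicator G2 (?D2 \<omega>) * ?f2 (?D2 \<omega>, \<lambda>k\<in>{j}. Y1_int k \<omega>)"
      by (simp add: ind2[OF \<omega>] design_def)
  qed
  also have "\<dots> = (\<integral>\<^sup>+\<omega>. indicator G2 (?D2 \<omega>) * (\<integral>\<^sup>+y. ?f2 (?D2 \<omega>, y) \<partial>PiM {j} (\<lambda>k. ?K2 k (?D2 \<omega>))) \<partial>M)"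
  proof (rule nn_integral_disintegration_cond_indep[OF prob_space_axioms _ D2 _ _ cond_indep_on_singleton _ G2 \<Omega>2])
    show "cond_law_on M \<Omega> (vimage_algebra (space M) ?D2 ?M2) MY (Y1_int k) (\<lambda>\<omega>. ?K2 k (?D2 \<omega>))" if "k \<in> {j}" for k
      using that j Y1_int_cond_law[OF j]
      by (auto simp: \<Omega>_def vec_of_def elim!: cond_law_on_cong)
    show "Y1_int k \<in> M \<rightarrow>\<^sub>M MY" if "k \<in> {j}" for k using that j by simp
  qed measurable
  also have "\<dots> = (\<integral>\<^sup>+\<omega>. indicator G1 (?D1 \<omega>) * ?f1 (?D1 \<omega>, \<lambda>k\<in>{j}. E_int k \<omega>) \<partial>M)"
  proof (rule nn_integral_cong)
    fix \<omega> assume \<omega>: "\<omega> \<in> space M"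
    have x: "X j \<omega> \<in> space MX" "E_int j \<omega> \<in> space ME" "design \<omega> \<in> space design_space"
      using \<omega> j by (auto intro!: measurable_space[of _ M] design_measurable)
    have vj: "vec_of N E_int \<omega> j = E_int j \<omega>" "vec_of N X \<omega> j = X j \<omega>" using j by (simp_all add: vec_of_def)
    have [measurable_cong]: "sets (PY True (X j \<omega>, E_int j \<omega>)) = sets MY" by (rule prob_space_PY(2)[OF x(1,2)])
    have "(\<integral>\<^sup>+y. indicator A (design \<omega>, (E_int j \<omega>, y j)) \<partial>PiM {j} (\<lambda>k. PY True (X j \<omega>, E_int j \<omega>)))
        = (\<integral>\<^sup>+y. indicator A (design \<omega>, (E_int j \<omega>, y)) \<partial>PY True (X j \<omega>, E_int j \<omega>))"
      using x prob_space_PY(1)[OF x(1,2)] by (intro nn_integral_PiM_singleton_prob[where f = "\<lambda>y. indicator A (design \<omega>, (E_int j \<omega>, y))"]) measurable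
    then show "indicator G2 (?D2 \<omega>) * (\<integral>\<^sup>+y. ?f2 (?D2 \<omega>, y) \<partial>PiM {j} (\<lambda>k. ?K2 k (?D2 \<omega>)))
        = indicator G1 (?D1 \<omega>) * ?f1 (?D1 \<omega>, \<lambda>k\<in>{j}. E_int k \<omega>)"
      using vj by (simp add: ind1[OF \<omega>] ind2[OF \<omega>] h_def design_def)
  qed
  also have "\<dots> = (\<integral>\<^sup>+\<omega>. indicator G1 (?D1 \<omega>) * (\<integral>\<^sup>+e. ?f1 (?D1 \<omega>, e) \<partial>PiM {j} (\<lambda>k. ?K1 k (?D1 \<omega>))) \<partial>M)"
  proof (rule nn_integral_disintegration_cond_indep[OF prob_space_axioms _ D1 _ _ cond_indep_on_singleton _ G1 \<Omega>1])
    show "cond_law_on M \<Omega> (vimage_algebra (space M) ?D1 ?M1) ME (E_int k) (\<lambda>\<omega>. ?K1 k (?D1 \<omega>))" if "k \<in> {j}" for k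
      using that j E_int_cond_law[OF j]
      by (auto simp: \<Omega>_def vec_of_def exposure_kernel_def switch_on_def design_algebra_def elim!: cond_law_on_cong)
    show "E_int k \<in> M \<rightarrow>\<^sub>M ME" if "k \<in> {j}" for k using that j by simp
  qed measurable
  also have "\<dots> = (\<integral>\<^sup>+\<omega>. indicator {i} (I \<omega>) * indicator C (design \<omega>)
          * emeasure (unit_kernel j (switch_on i (design \<omega>))) (Pair (design \<omega>) -` A) \<partial>M)"
  proof (rule nn_integral_cong)
    fix \<omega> assume \<omega>: "\<omega> \<in> space M"
    have d: "design \<omega> \<in> space design_space" using \<omega> by (auto intro!: measurable_space[of _ M] design_measurable)
    then have fd: "switch_on i (design \<omega>) \<in> space design_space" by (rule measurable_space[OF switch_on_measurable[OF i]])
    note k = prob_space_exposure_kernel[OF j fd]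
    have [measurable_cong]: "sets (exposure_kernel j (switch_on i (design \<omega>))) = sets ME" by (rule k)
    have "(\<integral>\<^sup>+e. h (design \<omega>) (e j) \<partial>PiM {j} (\<lambda>k. exposure_kernel j (switch_on i (design \<omega>))))
        = (\<integral>\<^sup>+e. h (design \<omega>) e \<partial>exposure_kernel j (switch_on i (design \<omega>)))"
      using k(1) d by (intro nn_integral_PiM_singleton_prob) measurable
    also have "\<dots> = (\<integral>\<^sup>+z. indicator A (design \<omega>, z) \<partial>unit_kernel j (switch_on i (design \<omega>)))"
      using d by (subst nn_integral_unit_kernel[OF j fd]) (auto simp: h_def[abs_def])
    also have "\<dots> = (\<integral>\<^sup>+z. indicator (Pair (design \<omega>) -` A) z \<partial>unit_kernel j (switch_on i (design \<omega>)))"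
      by (intro nn_integral_cong) (auto split: split_indicator)
    also have "\<dots> = emeasure (unit_kernel j (switch_on i (design \<omega>))) (Pair (design \<omega>) -` A)"
      using sets_Pair1[OF A] prob_space_unit_kernel(2)[OF j fd] by (intro nn_integral_indicator) simp
    finally show "indicator G1 (?D1 \<omega>) * (\<integral>\<^sup>+e. ?f1 (?D1 \<omega>, e) \<partial>PiM {j} (\<lambda>k. ?K1 k (?D1 \<omega>)))
        = indicator {i} (I \<omega>) * indicator C (design \<omega>)
          * emeasure (unit_kernel j (switch_on i (design \<omega>))) (Pair (design \<omega>) -` A)"
      using \<omega> by (simp add: ind1 design_def)
  qed
  finally show ?thesis .
qed

text \<open>Stability is given conditionally on the design and the random target, hence speaks about
  \<open>i\<close> only where \<open>I = i\<close>, yet the conclusion is needed almost everywhere.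
  Neither kernel mentions \<open>I\<close>, so independence allows the passage: the inequality is
  integrated over the designs that violate it, together with \<open>I = i\<close>, and the factor
  \<open>1 / N\<close> cancels on both sides.\<close>

lemma AE_stability_kernel:
  assumes i [measurable]: "i \<in> {1..N}" and j [measurable]: "j \<in> {1..N}"
    and score [measurable]: "S \<in> borel_measurable (MX \<Otimes>\<^sub>M unit_space)"
    and stability: "score_stability M N MX ME MY nbhd S X T E Y I E_int Y1_int \<Delta>"
  shows "AE \<omega> in M. \<not> T i \<omega> \<and> T j \<omega> \<and> i \<in> nbhd j (vec_of N X \<omega>) \<longrightarrow>
    emeasure (unit_kernel j (switch_on i (design \<omega>))) {z \<in> space unit_space. s < S (X j \<omega>, z)}
    \<le> emeasure (unit_kernel j (design \<omega>)) {z \<in> space unit_space. s < S (X j \<omega>, z) + \<Delta> j (vec_of N X \<omega>, vec_of N T \<omega>, i, z)}"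
proof -
  let ?D1 = "\<lambda>\<omega>. (vec_of N X \<omega>, vec_of N T \<omega>, I \<omega>)"
  let ?M1 = "vec_space N MX \<Otimes>\<^sub>M vec_space N bool_space \<Otimes>\<^sub>M count_space {1..N}"
  have D1: "?D1 \<in> M \<rightarrow>\<^sub>M ?M1" by measurable
  have \<Delta> [measurable]: "\<Delta> j \<in> borel_measurable
      (vec_space N MX \<Otimes>\<^sub>M vec_space N bool_space \<Otimes>\<^sub>M count_space {1..N} \<Otimes>\<^sub>M unit_space)"
    using stability j by (simp add: score_stability_def)
  have i' [measurable]: "i \<in> space (count_space {1..N})" using i by simp
  define A1 where "A1 = {p \<in> space (design_space \<Otimes>\<^sub>M unit_space). s < S (fst (fst p) j, snd p)}"
  define A2 where "A2 = {p \<in> space (design_space \<Otimes>\<^sub>M unit_space).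
      s < S (fst (fst p) j, snd p) + \<Delta> j (fst (fst p), snd (fst p), i, snd p)}"
  have A1 [measurable]: "A1 \<in> sets (design_space \<Otimes>\<^sub>M unit_space)" unfolding A1_def by measurable
  have A2 [measurable]: "A2 \<in> sets (design_space \<Otimes>\<^sub>M unit_space)" unfolding A2_def by measurable
  define a where "a d = emeasure (unit_kernel j (switch_on i d)) (Pair d -` A1)" for d
  define b where "b d = emeasure (unit_kernel j d) (Pair d -` A2)" for d
  have a [measurable]: "a \<in> borel_measurable design_space"
    unfolding a_def by (rule emeasure_unit_kernel_measurable[OF j switch_on_measurable[OF i] A1])
  have b [measurable]: "b \<in> borel_measurable design_space"
    unfolding b_def by (rule emeasure_unit_kernel_measurable[OF j _ A2]) simp
  \<comment> \<open>The designs on which the claim fails. The goal is that they carry no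
    mass.\<close>
  define C where "C = {d \<in> space design_space. \<not> snd d i \<and> snd d j \<and> i \<in> nbhd j (fst d) \<and> b d < a d}"
  have C [measurable]: "C \<in> sets design_space" unfolding C_def by measurable
  \<comment> \<open>The violating designs together with the value \<open>i\<close> of the target, as
    a set for the map generating \<open>design_algebra\<close>; only such events can be integrated
    against the versions in the hypothesis.\<close>
  define C1 where "C1 = {p \<in> space ?M1. (fst p, fst (snd p)) \<in> C \<and> snd (snd p) = i}"
  have C1 [measurable]: "C1 \<in> sets ?M1" unfolding C1_def by measurable
  have C1_iff: "?D1 \<omega> \<in> C1 \<longleftrightarrow> design \<omega> \<in> C \<and> I \<omega> = i" if "\<omega> \<in> space M" for \<omega>
    using measurable_space[OF D1 that] by (auto simp: C1_def design_def)
  have space_D: "design \<omega> \<in> space design_space" if "\<omega> \<in> space M" for \<omega>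
    using measurable_space[OF design_measurable that] .
  have units_j: "units \<omega> j = (E j \<omega>, Y True j \<omega>)" for \<omega> using j by (simp add: units_def)
  have vec_j: "vec_of N X \<omega> j = X j \<omega>" "vec_of N T \<omega> j = T j \<omega>" "vec_of N T \<omega> i = T i \<omega>" for \<omega>
    using i j by (simp_all add: vec_of_def)
  let ?P1 = "\<lambda>\<omega>. S (X j \<omega>, E_int j \<omega>, Y1_int j \<omega>) > s"
  let ?P2 = "\<lambda>\<omega>. S (X j \<omega>, E j \<omega>, Y True j \<omega>)
      + \<Delta> j (vec_of N X \<omega>, vec_of N T \<omega>, I \<omega>, E j \<omega>, Y True j \<omega>) > s"
  have P1 [measurable]: "{\<omega> \<in> space M. ?P1 \<omega>} \<in> sets M" by measurable
  have P2 [measurable]: "{\<omega> \<in> space M. ?P2 \<omega>} \<in> sets M" by measurable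
  let ?F = "design_algebra M N MX X T I"
  have stab: "AE \<omega> in M. \<not> T (I \<omega>) \<omega> \<and> j \<in> affected N nbhd (vec_of N X \<omega>) (vec_of N T \<omega>) (I \<omega>) \<longrightarrow>
      prob_given M ?F ?P1 \<omega> \<le> prob_given M ?F ?P2 \<omega>"
    using stability j by (simp add: score_stability_def)
  have "ennreal (1 / N) * (\<integral>\<^sup>+\<omega>. indicator C (design \<omega>) * a (design \<omega>) \<partial>M)
      = (\<integral>\<^sup>+\<omega>. indicator {i} (I \<omega>) * (indicator C (design \<omega>) * a (design \<omega>)) \<partial>M)"
    using nn_integral_index[OF i, of "\<lambda>p. indicator C (fst p) * a (fst p)"] by simp
  also have "\<dots> = (\<integral>\<^sup>+\<omega>. indicator {i} (I \<omega>) * indicator C (design \<omega>) * indicator A1 (design \<omega>, (E_int j \<omega>, Y1_int j \<omega>)) \<partial>M)"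
    by (subst nn_integral_interventional_unit[OF i j C _ A1]) (auto simp: C_def a_def mult.assoc)
  also have "\<dots> = (\<integral>\<^sup>+\<omega>. indicator {\<omega> \<in> space M. ?D1 \<omega> \<in> C1 \<and> ?P1 \<omega>} \<omega> \<partial>M)"
  proof (rule nn_integral_cong)
    fix \<omega> assume \<omega>: "\<omega> \<in> space M"
    have "(design \<omega>, (E_int j \<omega>, Y1_int j \<omega>)) \<in> space (design_space \<Otimes>\<^sub>M unit_space)"
      by (rule measurable_space[OF _ \<omega>]) measurable
    then have "(design \<omega>, (E_int j \<omega>, Y1_int j \<omega>)) \<in> A1 \<longleftrightarrow> ?P1 \<omega>"
      unfolding A1_def by (simp add: design_def vec_j)
    then show "indicator {i} (I \<omega>) * indicator C (design \<omega>) * indicator A1 (design \<omega>, (E_int j \<omega>, Y1_int j \<omega>))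
        = (indicator {\<omega> \<in> space M. ?D1 \<omega> \<in> C1 \<and> ?P1 \<omega>} \<omega> :: ennreal)"
      using \<omega> C1_iff[OF \<omega>] by (auto split: split_indicator)
  qed
  also have "\<dots> = emeasure M {\<omega> \<in> space M. ?D1 \<omega> \<in> C1 \<and> ?P1 \<omega>}"
    by (rule nn_integral_indicator) measurable
  also have "\<dots> = (\<integral>\<^sup>+\<omega>. indicator C1 (?D1 \<omega>) * ennreal (prob_given M ?F ?P1 \<omega>) \<partial>M)"
    unfolding design_algebra_def by (rule emeasure_prob_given[OF prob_space_axioms D1 P1 C1])
  also have "\<dots> \<le> (\<integral>\<^sup>+\<omega>. indicator C1 (?D1 \<omega>) * ennreal (prob_given M ?F ?P2 \<omega>) \<partial>M)"
  proof (rule nn_integral_mono_AE)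
    show "AE \<omega> in M. indicator C1 (?D1 \<omega>) * ennreal (prob_given M ?F ?P1 \<omega>)
        \<le> indicator C1 (?D1 \<omega>) * ennreal (prob_given M ?F ?P2 \<omega>)"
      using stab AE_space
    proof eventually_elim
      case (elim \<omega>)
      show ?case
      proof (cases "?D1 \<omega> \<in> C1")
        case True
        then have "design \<omega> \<in> C" "I \<omega> = i" using C1_iff elim by auto
        then have "\<not> T (I \<omega>) \<omega>" "j \<in> affected N nbhd (vec_of N X \<omega>) (vec_of N T \<omega>) (I \<omega>)"
          using j by (auto simp: C_def affected_def treated_def design_def vec_j)
        then show ?thesis using elim by (auto intro!: mult_left_mono ennreal_leI)
      qed simp
    qed
  qed
  also have "\<dots> = emeasure M {\<omega> \<in> space M. ?D1 \<omega> \<in> C1 \<and> ?P2 \<omega>}"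
    unfolding design_algebra_def by (rule emeasure_prob_given[OF prob_space_axioms D1 P2 C1, symmetric])
  also have "\<dots> = (\<integral>\<^sup>+\<omega>. indicator {\<omega> \<in> space M. ?D1 \<omega> \<in> C1 \<and> ?P2 \<omega>} \<omega> \<partial>M)"
    by (rule nn_integral_indicator[symmetric]) measurable
  also have "\<dots> = (\<integral>\<^sup>+\<omega>. indicator {i} (I \<omega>) * (indicator C (design \<omega>) * indicator A2 (design \<omega>, units \<omega> j)) \<partial>M)"
  proof (rule nn_integral_cong)
    fix \<omega> assume \<omega>: "\<omega> \<in> space M"
    have "(design \<omega>, units \<omega> j) \<in> space (design_space \<Otimes>\<^sub>M unit_space)"
      by (rule measurable_space[OF _ \<omega>]) measurable
    then have "(design \<omega>, units \<omega> j) \<in> A2 \<longleftrightarrow> ?P2 \<omega>" if "I \<omega> = i"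
      unfolding A2_def using that by (simp add: design_def vec_j units_j)
    then show "indicator {\<omega> \<in> space M. ?D1 \<omega> \<in> C1 \<and> ?P2 \<omega>} \<omega>
      = (indicator {i} (I \<omega>) * (indicator C (design \<omega>) * indicator A2 (design \<omega>, units \<omega> j)) :: ennreal)"
      using \<omega> C1_iff[OF \<omega>] by (auto split: split_indicator)
  qed
  also have "\<dots> = ennreal (1 / N) * (\<integral>\<^sup>+\<omega>. indicator C (design \<omega>) * indicator A2 (design \<omega>, units \<omega> j) \<partial>M)"
    using nn_integral_index[OF i, of "\<lambda>p. indicator C (fst p) * indicator A2 (fst p, snd p j)"] by simp
  also have "(\<integral>\<^sup>+\<omega>. indicator C (design \<omega>) * indicator A2 (design \<omega>, units \<omega> j) \<partial>M)
      = (\<integral>\<^sup>+\<omega>. indicator C (design \<omega>) * b (design \<omega>) \<partial>M)"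
    unfolding b_def by (rule nn_integral_design_unit[OF j C A2])
  finally have "ennreal (1 / N) * (\<integral>\<^sup>+\<omega>. indicator C (design \<omega>) * a (design \<omega>) \<partial>M)
      \<le> ennreal (1 / N) * (\<integral>\<^sup>+\<omega>. indicator C (design \<omega>) * b (design \<omega>) \<partial>M)" .
  moreover have "ennreal (1 / N) \<noteq> 0" "ennreal (1 / N) \<noteq> \<top>" using units_nonempty by auto
  ultimately have le: "(\<integral>\<^sup>+\<omega>. indicator C (design \<omega>) * a (design \<omega>) \<partial>M) \<le> (\<integral>\<^sup>+\<omega>. indicator C (design \<omega>) * b (design \<omega>) \<partial>M)"
    by (simp add: ennreal_mult_le_mult_iff)
  \<comment> \<open>Finiteness of the smaller integral is needed to turn a violation of positive
    mass into a strict inequality of integrals.\<close>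
  have "b d \<le> 1" if "d \<in> space design_space" for d
    unfolding b_def using prob_space.emeasure_le_1[OF prob_space_unit_kernel(1)[OF j that]] by simp
  then have "(\<integral>\<^sup>+\<omega>. indicator C (design \<omega>) * b (design \<omega>) \<partial>M) \<le> (\<integral>\<^sup>+\<omega>. 1 \<partial>M)"
    using space_D by (intro nn_integral_mono) (auto split: split_indicator)
  then have fin: "(\<integral>\<^sup>+\<omega>. indicator C (design \<omega>) * b (design \<omega>) \<partial>M) \<noteq> \<infinity>"
    by (auto simp: emeasure_space_1 top_unique)
  \<comment> \<open>On \<open>C\<close> the function \<open>a\<close> exceeds \<open>b\<close>
    pointwise, while its integral over \<open>C\<close> is no larger.\<close>
  have "AE \<omega> in M. indicator C (design \<omega>) * a (design \<omega>) \<le> indicator C (design \<omega>) * b (design \<omega>)"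
  proof (rule ccontr)
    assume n: "\<not> (AE \<omega> in M. indicator C (design \<omega>) * a (design \<omega>) \<le> indicator C (design \<omega>) * b (design \<omega>))"
    have "(\<integral>\<^sup>+\<omega>. indicator C (design \<omega>) * b (design \<omega>) \<partial>M) < (\<integral>\<^sup>+\<omega>. indicator C (design \<omega>) * a (design \<omega>) \<partial>M)"
      by (rule nn_integral_less[OF _ _ fin _ n]) (auto simp: C_def split: split_indicator)
    then show False using le by simp
  qed
  then show ?thesis
    using AE_space
  proof eventually_elim
    case (elim \<omega>)
    have d: "design \<omega> \<in> space design_space" using space_D elim by simp
    have "Pair (design \<omega>) -` A1 = {z \<in> space unit_space. s < S (X j \<omega>, z)}"
      "Pair (design \<omega>) -` A2 = {z \<in> space unit_space. s < S (X j \<omega>, z) + \<Delta> j (vec_of N X \<omega>, vec_of N T \<omega>, i, z)}"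
      using d unfolding A1_def A2_def space_pair_measure[of design_space unit_space]
      by (auto simp: design_def vec_j)
    moreover have "a (design \<omega>) \<le> b (design \<omega>)" if "\<not> T i \<omega> \<and> T j \<omega> \<and> i \<in> nbhd j (vec_of N X \<omega>)"
    proof (rule ccontr)
      assume n: "\<not> a (design \<omega>) \<le> b (design \<omega>)"
      then have "design \<omega> \<in> C" using that d by (auto simp: C_def design_def vec_j)
      then show False using elim n by simp
    qed
    ultimately show ?case by (simp add: a_def b_def)
  qed
qed

end

section \<open>Comparison of the weighted ranks\<close>

context networked_interference
begin

definition total_weight :: "(nat \<Rightarrow> 'x) \<times> (nat \<Rightarrow> bool) \<Rightarrow> real" where
  "total_weight d = (\<Sum>j\<in>{1..N}. of_bool (snd d j) * weight \<pi> (fst d j))"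

text \<open>The margin is added only for units that have \<open>i\<close> as a neighbor, since for
  all others the switch leaves the kernel unchanged.\<close>

definition inflated_score ::
  "('x \<times> 'e \<times> 'y \<Rightarrow> real) \<Rightarrow> (nat \<Rightarrow> (nat \<Rightarrow> 'x) \<times> (nat \<Rightarrow> bool) \<times> nat \<times> 'e \<times> 'y \<Rightarrow> real)
     \<Rightarrow> nat \<Rightarrow> nat \<Rightarrow> (nat \<Rightarrow> 'x) \<times> (nat \<Rightarrow> bool) \<Rightarrow> 'e \<times> 'y \<Rightarrow> real" where
  "inflated_score S \<Delta> i j d z =
     S (fst d j, z) + (if i \<in> nbhd j (fst d) then \<Delta> j (fst d, snd d, i, z) else 0)"

text \<open>The event that the weighted p-value of target \<open>i\<close>, computed from inflated
  calibration scores, is at most \<alpha>, with the denominator cleared. It is meant for designs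
  with \<open>i\<close> untreated, where the sum does not contain \<open>i\<close> and its weight is
  added separately.\<close>

definition small_obs ::
  "('x \<times> 'e \<times> 'y \<Rightarrow> real) \<Rightarrow> (nat \<Rightarrow> (nat \<Rightarrow> 'x) \<times> (nat \<Rightarrow> bool) \<times> nat \<times> 'e \<times> 'y \<Rightarrow> real)
     \<Rightarrow> real \<Rightarrow> nat \<Rightarrow> (nat \<Rightarrow> 'x) \<times> (nat \<Rightarrow> bool) \<Rightarrow> (nat \<Rightarrow> 'e \<times> 'y) \<Rightarrow> bool" where
  "small_obs S \<Delta> \<alpha> i d z \<longleftrightarrow>
     weight \<pi> (fst d i) + (\<Sum>j\<in>{1..N}. weight \<pi> (fst d j)
         * of_bool (snd d j \<and> S (fst d i, z i) \<le> inflated_score S \<Delta> i j d (z j)))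
       \<le> \<alpha> * (weight \<pi> (fst d i) + total_weight d)"

text \<open>Meant for designs in which \<open>i\<close> is treated: the sum then contains the weight of \<open>i\<close> itself.\<close>

definition small_int ::
  "('x \<times> 'e \<times> 'y \<Rightarrow> real) \<Rightarrow> real \<Rightarrow> nat \<Rightarrow> (nat \<Rightarrow> 'x) \<times> (nat \<Rightarrow> bool)
     \<Rightarrow> (nat \<Rightarrow> 'e \<times> 'y) \<Rightarrow> bool" where
  "small_int S \<alpha> i d z \<longleftrightarrow>
     (\<Sum>j\<in>{1..N}. weight \<pi> (fst d j) * of_bool (snd d j \<and> S (fst d i, z i) \<le> S (fst d j, z j)))
       \<le> \<alpha> * total_weight d"

text \<open>Explains why \<open>small_obs\<close> at a design and \<open>small_int\<close> at the
  switched design have the same right-hand side.\<close>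

lemma total_weight_switch_on:
  assumes "i \<in> {1..N}" "\<not> snd d i"
  shows "total_weight (switch_on i d) = weight \<pi> (fst d i) + total_weight d"
proof -
  have "total_weight (switch_on i d) = (\<Sum>j\<in>{1..N}. of_bool (snd d j) * weight \<pi> (fst d j) + (if j = i then weight \<pi> (fst d i) else 0))"
    unfolding total_weight_def using assms by (intro sum.cong) auto
  then show ?thesis using assms by (simp add: sum.distrib total_weight_def)
qed

lemma total_weight_measurable [measurable]: "total_weight \<in> borel_measurable design_space"
  unfolding total_weight_def by measurable

lemma inflated_score_measurable:
  assumes [measurable]: "S \<in> borel_measurable (MX \<Otimes>\<^sub>M unit_space)"
    "\<Delta> j \<in> borel_measurable (vec_space N MX \<Otimes>\<^sub>M vec_space N bool_space \<Otimes>\<^sub>M count_space {1..N} \<Otimes>\<^sub>M unit_space)"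
    and i: "i \<in> {1..N}" and [measurable]: "j \<in> {1..N}"
  shows "(\<lambda>p. inflated_score S \<Delta> i j (fst p) (snd p)) \<in> borel_measurable (design_space \<Otimes>\<^sub>M unit_space)"
proof -
  have [measurable]: "i \<in> space (count_space {1..N})" using i by simp
  show ?thesis unfolding inflated_score_def by measurable
qed

lemma small_obs_measurable:
  assumes S [measurable]: "S \<in> borel_measurable (MX \<Otimes>\<^sub>M unit_space)"
    and \<Delta>: "\<And>j. j \<in> {1..N} \<Longrightarrow> \<Delta> j \<in> borel_measurable
      (vec_space N MX \<Otimes>\<^sub>M vec_space N bool_space \<Otimes>\<^sub>M count_space {1..N} \<Otimes>\<^sub>M unit_space)"
    and i [measurable]: "i \<in> {1..N}"
  shows "Measurable.pred (design_space \<Otimes>\<^sub>M vec_space N unit_space) (\<lambda>p. small_obs S \<Delta> \<alpha> i (fst p) (snd p))"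
proof -
  have [measurable]: "(\<lambda>p. inflated_score S \<Delta> i j (fst p) (snd p j)) \<in> borel_measurable (design_space \<Otimes>\<^sub>M vec_space N unit_space)"
    if [measurable]: "j \<in> {1..N}" for j
    using measurable_compose[OF _ inflated_score_measurable[of S \<Delta> j i, OF S \<Delta>[OF that] i that],
      of "\<lambda>p. (fst p, snd p j)" "design_space \<Otimes>\<^sub>M vec_space N unit_space"] by simp
  show ?thesis unfolding small_obs_def by measurable
qed

lemma small_int_measurable:
  assumes [measurable]: "S \<in> borel_measurable (MX \<Otimes>\<^sub>M unit_space)" "i \<in> {1..N}"
  shows "Measurable.pred (design_space \<Otimes>\<^sub>M vec_space N unit_space) (\<lambda>p. small_int S \<alpha> i (fst p) (snd p))"
  unfolding small_int_def by measurable

text \<open>Fix the exposure and outcome of the target, whose kernel does not change under the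
  switch. Both events then bound a weighted count over the remaining independent units, with equal
  weights and equal allowance. Stability orders the hit probabilities of units having
  \<open>i\<close> as a neighbor; for the others kernels and scores coincide.\<close>

lemma emeasure_small_obs_le:
  assumes i: "i \<in> {1..N}" and d: "d \<in> space design_space" and untreated: "\<not> snd d i"
    and S [measurable]: "S \<in> borel_measurable (MX \<Otimes>\<^sub>M unit_space)"
    and \<Delta>: "\<And>j. j \<in> {1..N} \<Longrightarrow> \<Delta> j \<in> borel_measurable
      (vec_space N MX \<Otimes>\<^sub>M vec_space N bool_space \<Otimes>\<^sub>M count_space {1..N} \<Otimes>\<^sub>M unit_space)"
    and stable: "\<And>j s. j \<in> {1..N} \<Longrightarrow> snd d j \<Longrightarrow> i \<in> nbhd j (fst d) \<Longrightarrow> s \<in> \<rat> \<Longrightarrow>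
      emeasure (unit_kernel j (switch_on i d)) {z \<in> space unit_space. s < S (fst d j, z)}
      \<le> emeasure (unit_kernel j d) {z \<in> space unit_space. s < S (fst d j, z) + \<Delta> j (fst d, snd d, i, z)}"
  shows "emeasure (PiM {1..N} (\<lambda>j. unit_kernel j d)) {z \<in> space (vec_space N unit_space). small_obs S \<Delta> \<alpha> i d z}
    \<le> emeasure (PiM {1..N} (\<lambda>j. unit_kernel j (switch_on i d))) {z \<in> space (vec_space N unit_space). small_int S \<alpha> i (switch_on i d) z}"
proof -
  let ?J = "{1..N} - {i}"
  let ?w = "\<lambda>j. weight \<pi> (fst d j)"
  \<comment> \<open>The allowance left to the other units after the weight of the target has been
    paid.\<close>
  let ?c = "\<alpha> * (?w i + total_weight d) - ?w i"
  have ins: "insert i ?J = {1..N}" using i by auto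
  have fd: "switch_on i d \<in> space design_space" by (rule measurable_space[OF switch_on_measurable[OF i] d])
  have x: "fst d j \<in> space MX" if "j \<in> {1..N}" for j
    using d that by (auto simp: space_pair_measure space_PiM PiE_iff)
  note k = prob_space_unit_kernel[OF _ d] and fk = prob_space_unit_kernel[OF _ fd]
  have "i \<notin> nbhd i (fst d)"
    using measurable_space[OF nbhd_measurable[OF i], of "fst d"] d by (auto simp: space_pair_measure)
  then have Ki: "unit_kernel i (switch_on i d) = unit_kernel i d" by (rule unit_kernel_switch_on_eq)
  have sp: "space (PiM J' (\<lambda>j. unit_kernel j d')) = space (PiM J' (\<lambda>_. unit_space))"
    "sets (PiM J' (\<lambda>j. unit_kernel j d')) = sets (PiM J' (\<lambda>_. unit_space))"
    if "d' \<in> {d, switch_on i d}" "J' \<subseteq> {1..N}" for d' J'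
  proof -
    have "sets (unit_kernel j d') = sets unit_space" if "j \<in> J'" for j
      using k(2) fk(2) that \<open>d' \<in> _\<close> \<open>J' \<subseteq> _\<close> by auto
    then show *: "sets (PiM J' (\<lambda>j. unit_kernel j d')) = sets (PiM J' (\<lambda>_. unit_space))"
      by (intro sets_PiM_cong) auto
    show "space (PiM J' (\<lambda>j. unit_kernel j d')) = space (PiM J' (\<lambda>_. unit_space))"
      using sets_eq_imp_space_eq[OF *] .
  qed
  \<comment> \<open>Given the target data \<open>y\<close>, the values of unit \<open>j\<close> that
    count. The condition \<open>snd d j\<close> makes the set empty for untreated units, so that
    sums may run over all units.\<close>
  define A where "A y j = {z \<in> space unit_space. snd d j \<and> S (fst d i, y) \<le> inflated_score S \<Delta> i j d z}" for y j
  define B where "B y j = {z \<in> space unit_space. snd d j \<and> S (fst d i, y) \<le> S (fst d j, z)}" for y j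
  have U: "inflated_score S \<Delta> i j d \<in> borel_measurable unit_space" if "j \<in> {1..N}" for j
    using measurable_compose[OF measurable_Pair1'[OF d] inflated_score_measurable[of S \<Delta> j i, OF S \<Delta>[OF that] i that]]
    by simp
  have SU: "(\<lambda>z. S (fst d j, z)) \<in> borel_measurable unit_space" if "j \<in> {1..N}" for j
    using x[OF that] by measurable
  have A: "A y j \<in> sets unit_space" and B: "B y j \<in> sets unit_space" if "j \<in> {1..N}" for y j
    unfolding A_def B_def using U[OF that] SU[OF that] by measurable
  have AB: "emeasure (unit_kernel j (switch_on i d)) (B y j) \<le> emeasure (unit_kernel j d) (A y j)" if j: "j \<in> ?J" for y j
  proof (cases "snd d j")
    case True
    have j': "j \<in> {1..N}" using j by simp
    show ?thesis
    proof (cases "i \<in> nbhd j (fst d)")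
      case aff: True
      have spk: "space (unit_kernel j d) = space unit_space" "space (unit_kernel j (switch_on i d)) = space unit_space"
        using k(2)[OF j'] fk(2)[OF j'] by (auto dest: sets_eq_imp_space_eq)
      have "emeasure (unit_kernel j (switch_on i d)) {z \<in> space (unit_kernel j (switch_on i d)). S (fst d i, y) \<le> S (fst d j, z)}
        \<le> emeasure (unit_kernel j d) {z \<in> space (unit_kernel j d). S (fst d i, y) \<le> inflated_score S \<Delta> i j d z}"
      proof (rule emeasure_tail_mono)
        show "prob_space (unit_kernel j d)" "prob_space (unit_kernel j (switch_on i d))"
          using k(1) fk(1) j' by auto
        show "(\<lambda>z. S (fst d j, z)) \<in> borel_measurable (unit_kernel j (switch_on i d))"
          using SU[OF j'] fk(2)[OF j'] by (simp cong: measurable_cong_sets)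
        show "inflated_score S \<Delta> i j d \<in> borel_measurable (unit_kernel j d)"
          using U[OF j'] k(2)[OF j'] by (simp cong: measurable_cong_sets)
        show "emeasure (unit_kernel j (switch_on i d)) {z \<in> space (unit_kernel j (switch_on i d)). s < S (fst d j, z)}
            \<le> emeasure (unit_kernel j d) {z \<in> space (unit_kernel j d). s < inflated_score S \<Delta> i j d z}" if "s \<in> \<rat>" for s
          using stable[OF j' True aff that] aff by (simp add: spk inflated_score_def)
      qed
      then show ?thesis using True by (simp add: A_def B_def spk)
    next
      case False
      then show ?thesis
        unfolding unit_kernel_switch_on_eq[OF False] A_def B_def inflated_score_def by simp
    qed
  qed (simp add: B_def)
  \<comment> \<open>The target is integrated outermost, so that its score is a constant threshold
    for the others. Stating this for both designs puts the two probabilities under the same outer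
    measure.\<close>
  have split: "emeasure (PiM {1..N} (\<lambda>j. unit_kernel j d')) {z \<in> space (vec_space N unit_space). R z}
      = (\<integral>\<^sup>+y. emeasure (PiM ?J (\<lambda>j. unit_kernel j d')) {z \<in> space (PiM ?J (\<lambda>j. unit_kernel j d')).
            (\<Sum>j\<in>?J. ?w j * indicator (Q y j) (z j)) \<le> ?c} \<partial>unit_kernel i d)"
    if d': "d' \<in> {d, switch_on i d}"
      and R: "{z \<in> space (vec_space N unit_space). R z} \<in> sets (vec_space N unit_space)"
      and RQ: "\<And>y z. y \<in> space unit_space \<Longrightarrow> z \<in> space (PiM ?J (\<lambda>_. unit_space)) \<Longrightarrow>
        R (z(i := y)) \<longleftrightarrow> (\<Sum>j\<in>?J. ?w j * indicator (Q y j) (z j)) \<le> ?c"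
      and Q: "\<And>y j. j \<in> {1..N} \<Longrightarrow> Q y j \<in> sets unit_space"
    for d' R and Q :: "'e \<times> 'y \<Rightarrow> nat \<Rightarrow> ('e \<times> 'y) set"
  proof -
    let ?P = "PiM {1..N} (\<lambda>j. unit_kernel j d')" and ?P' = "PiM ?J (\<lambda>j. unit_kernel j d')"
    let ?R = "{z \<in> space (vec_space N unit_space). R z}"
    have R': "?R \<in> sets ?P" using R sp[OF d', of "{1..N}"] by simp
    have kd': "prob_space (unit_kernel j d')" "sets (unit_kernel j d') = sets unit_space" if "j \<in> {1..N}" for j
      using k[OF that] fk[OF that] d' by auto
    have Ki': "unit_kernel i d' = unit_kernel i d" using d' Ki by auto
    have "emeasure ?P ?R = (\<integral>\<^sup>+z. indicator ?R z \<partial>?P)" using R' by simp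
    also have "\<dots> = (\<integral>\<^sup>+y. \<integral>\<^sup>+z. indicator ?R (z(i := y)) \<partial>?P' \<partial>unit_kernel i d')"
      using nn_integral_PiM_insert_prob(1)[of ?J i "\<lambda>j. unit_kernel j d'" "indicator ?R", unfolded ins]
        kd'(1) borel_measurable_indicator[OF R'] by simp
    also have "\<dots> = (\<integral>\<^sup>+y. emeasure ?P' {z \<in> space ?P'. (\<Sum>j\<in>?J. ?w j * indicator (Q y j) (z j)) \<le> ?c} \<partial>unit_kernel i d')"
    proof (rule nn_integral_cong)
      fix y assume "y \<in> space (unit_kernel i d')"
      then have y: "y \<in> space unit_space" using sets_eq_imp_space_eq[OF kd'(2)[OF i]] by simp
      have sP': "space ?P' = space (PiM ?J (\<lambda>_. unit_space))" "sets ?P' = sets (PiM ?J (\<lambda>_. unit_space))"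
        using sp[OF d', of ?J] by auto
      have "(\<integral>\<^sup>+z. indicator ?R (z(i := y)) \<partial>?P')
          = (\<integral>\<^sup>+z. indicator {z \<in> space ?P'. (\<Sum>j\<in>?J. ?w j * indicator (Q y j) (z j)) \<le> ?c} z \<partial>?P')"
      proof (rule nn_integral_cong)
        fix z assume "z \<in> space ?P'"
        then have z: "z \<in> space (PiM ?J (\<lambda>_. unit_space))" using sP' by simp
        show "indicator ?R (z(i := y)) = (indicator {z \<in> space ?P'. (\<Sum>j\<in>?J. ?w j * indicator (Q y j) (z j)) \<le> ?c} z :: ennreal)"
          using RQ[OF y z] space_vec_upd[OF i z y] z sP'(1) by (simp add: indicator_def)
      qed
      also have "\<dots> = emeasure ?P' {z \<in> space ?P'. (\<Sum>j\<in>?J. ?w j * indicator (Q y j) (z j)) \<le> ?c}"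
      proof (rule nn_integral_indicator)
        have [measurable]: "Q y j \<in> sets unit_space" if "j \<in> ?J" for j using Q that by simp
        have "{z \<in> space (PiM ?J (\<lambda>_. unit_space)). (\<Sum>j\<in>?J. ?w j * indicator (Q y j) (z j)) \<le> ?c} \<in> sets (PiM ?J (\<lambda>_. unit_space))"
          by measurable
        then show "{z \<in> space ?P'. (\<Sum>j\<in>?J. ?w j * indicator (Q y j) (z j)) \<le> ?c} \<in> sets ?P'" using sP' by simp
      qed
      finally show "(\<integral>\<^sup>+z. indicator ?R (z(i := y)) \<partial>?P')
          = emeasure ?P' {z \<in> space ?P'. (\<Sum>j\<in>?J. ?w j * indicator (Q y j) (z j)) \<le> ?c}" .
    qed
    finally show ?thesis unfolding Ki' .
  qed
  have sum_split: "(\<Sum>j\<in>{1..N}. f j) = f i + (\<Sum>j\<in>?J. f j)" for f :: "nat \<Rightarrow> real"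
    using i by (simp add: sum.remove)
  have zj: "z j \<in> space unit_space" if "z \<in> space (PiM ?J (\<lambda>_. unit_space))" "j \<in> ?J" for z j
    using that by (auto simp: space_PiM PiE_iff)
  have "emeasure (PiM {1..N} (\<lambda>j. unit_kernel j d)) {z \<in> space (vec_space N unit_space). small_obs S \<Delta> \<alpha> i d z}
      = (\<integral>\<^sup>+y. emeasure (PiM ?J (\<lambda>j. unit_kernel j d)) {z \<in> space (PiM ?J (\<lambda>j. unit_kernel j d)).
            (\<Sum>j\<in>?J. ?w j * indicator (A y j) (z j)) \<le> ?c} \<partial>unit_kernel i d)"
  proof (rule split)
    show "{z \<in> space (vec_space N unit_space). small_obs S \<Delta> \<alpha> i d z} \<in> sets (vec_space N unit_space)"
      using measurable_compose[OF measurable_Pair1'[OF d] small_obs_measurable[OF S \<Delta> i]] by (simp add: pred_def)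
    fix y z assume y: "y \<in> space unit_space" and z: "z \<in> space (PiM ?J (\<lambda>_. unit_space))"
    have "(\<Sum>j\<in>{1..N}. ?w j * of_bool (snd d j \<and> S (fst d i, (z(i := y)) i) \<le> inflated_score S \<Delta> i j d ((z(i := y)) j)))
        = (\<Sum>j\<in>?J. ?w j * indicator (A y j) (z j))"
      unfolding sum_split using untreated zj[OF z] by (auto simp: A_def intro!: sum.cong split: split_indicator)
    then show "small_obs S \<Delta> \<alpha> i d (z(i := y)) \<longleftrightarrow> (\<Sum>j\<in>?J. ?w j * indicator (A y j) (z j)) \<le> ?c"
      unfolding small_obs_def by (simp only: le_diff_eq add.commute)
  qed (use A in auto)
  also have "\<dots> \<le> (\<integral>\<^sup>+y. emeasure (PiM ?J (\<lambda>j. unit_kernel j (switch_on i d))) {z \<in> space (PiM ?J (\<lambda>j. unit_kernel j (switch_on i d))).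
            (\<Sum>j\<in>?J. ?w j * indicator (B y j) (z j)) \<le> ?c} \<partial>unit_kernel i d)"
    using k fk A B AB propensity_range(3)[OF x]
    by (intro nn_integral_mono emeasure_PiM_weighted_sum_mono) (auto simp: less_imp_le)
  also have "\<dots> = emeasure (PiM {1..N} (\<lambda>j. unit_kernel j (switch_on i d))) {z \<in> space (vec_space N unit_space). small_int S \<alpha> i (switch_on i d) z}"
  proof (rule split[symmetric])
    show "{z \<in> space (vec_space N unit_space). small_int S \<alpha> i (switch_on i d) z} \<in> sets (vec_space N unit_space)"
      using measurable_compose[OF measurable_Pair1'[OF fd] small_int_measurable[OF S i]] by (simp add: pred_def)
    fix y z assume y: "y \<in> space unit_space" and z: "z \<in> space (PiM ?J (\<lambda>_. unit_space))"
    \<comment> \<open>After the switch the target is counted against its own score and always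
      contributes \<open>?w i\<close>, the term that \<open>small_obs\<close> adds by hand.\<close>
    have "(\<Sum>j\<in>{1..N}. ?w j * of_bool (snd (switch_on i d) j \<and> S (fst d i, (z(i := y)) i) \<le> S (fst d j, (z(i := y)) j)))
        = ?w i + (\<Sum>j\<in>?J. ?w j * indicator (B y j) (z j))"
      unfolding sum_split using zj[OF z] by (auto simp: B_def intro!: sum.cong split: split_indicator)
    then show "small_int S \<alpha> i (switch_on i d) (z(i := y)) \<longleftrightarrow> (\<Sum>j\<in>?J. ?w j * indicator (B y j) (z j)) \<le> ?c"
      unfolding small_int_def total_weight_switch_on[OF i untreated] by (simp only: fst_switch_on le_diff_eq add.commute)
  qed (use B in auto)
  finally show ?thesis .
qed

text \<open>The p-value is positive because its numerator contains the weight of the target. So a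
  missed outcome cannot be due to the truncation at 0, and the observed p-value plus the correction
  is at most \<alpha>.\<close>

lemma not_in_IA_WCP_plus_imp_small_obs:
  assumes \<omega>: "\<omega> \<in> space M" and i: "i \<in> {1..N}"
    and miss: "Y True i \<omega> \<notin> IA_WCP_plus \<alpha> MY N \<pi> nbhd S \<Delta>
      (vec_of N X \<omega>) (vec_of N T \<omega>) (vec_of N E \<omega>) (vec_of N (Y True) \<omega>) i"
  shows "small_obs S \<Delta> \<alpha> i (design \<omega>) (units \<omega>)"
proof -
  let ?x = "vec_of N X \<omega>" and ?t = "vec_of N T \<omega>" and ?e = "vec_of N E \<omega>" and ?y = "vec_of N (Y True) \<omega>"
  let ?w = "\<lambda>j. weight \<pi> (?x j)" and ?V = "\<lambda>j. S (?x j, ?e j, ?y j)"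
  let ?\<Delta> = "\<lambda>j. \<Delta> j (?x, ?t, i, ?e j, ?y j)"
  let ?total = "?w i + (\<Sum>j\<in>treated N ?t. ?w j)"
  have w: "0 < ?w j" if "j \<in> {1..N}" for j
    using propensity_range(3)[OF measurable_space[OF X_measurable[OF that] \<omega>]] that by (simp add: vec_of_def)
  have yi: "Y True i \<omega> = ?y i" using i by (simp add: vec_of_def)
  have "Y True i \<omega> \<in> space MY" using measurable_space[OF Y_measurable[OF i] \<omega>] .
  with miss have le: "p_obs N \<pi> S ?x ?t ?e ?y i (?y i) \<le> max (\<alpha> - rho_plus N \<pi> nbhd S \<Delta> ?x ?t ?e ?y i (?y i)) 0"
    by (auto simp: IA_WCP_plus_def yi not_less le_max_iff_disj)
  have treated_sum: "(\<Sum>j\<in>treated N ?t. f j) = (\<Sum>j\<in>{1..N}. of_bool (?t j) * f j)" for f :: "nat \<Rightarrow> real"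
    unfolding treated_def by (rule sum.mono_neutral_cong_left) auto
  have affected_sum: "(\<Sum>j\<in>affected N nbhd ?x ?t i. f j) = (\<Sum>j\<in>{1..N}. of_bool (?t j \<and> i \<in> nbhd j ?x) * f j)"
    for f :: "nat \<Rightarrow> real"
    unfolding affected_def treated_def by (rule sum.mono_neutral_cong_left) auto
  have total: "0 < ?total"
    unfolding treated_sum using w i by (intro add_pos_nonneg sum_nonneg) (auto simp: less_imp_le)
  let ?num = "?w i + (\<Sum>j\<in>treated N ?t. ?w j * of_bool (?V j \<ge> ?V i))"
  let ?num' = "\<Sum>j\<in>affected N nbhd ?x ?t i. ?w j * of_bool (?V i - ?\<Delta> j \<le> ?V j \<and> ?V j < ?V i)"
  have "0 < ?num"
    unfolding treated_sum using w i by (intro add_pos_nonneg sum_nonneg) (auto simp: less_imp_le)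
  then have "0 < p_obs N \<pi> S ?x ?t ?e ?y i (?y i)"
    unfolding p_obs_def using total by simp
  with le have "?num / ?total + ?num' / ?total \<le> \<alpha>"
    by (simp add: p_obs_def rho_plus_def max_def split: if_splits)
  then have num: "?num + ?num' \<le> \<alpha> * ?total"
    using total by (simp add: add_divide_distrib[symmetric] divide_le_eq)
  have inflated: "inflated_score S \<Delta> i j (design \<omega>) (units \<omega> j) = ?V j + (if i \<in> nbhd j ?x then ?\<Delta> j else 0)"
    if "j \<in> {1..N}" for j
    using that by (simp add: inflated_score_def design_def units_def vec_of_def)
  \<comment> \<open>If the inflated score reaches the target's score, then either the plain score
    already does, or the unit is affected and its plain score lies in the window counted by
    \<open>rho_plus\<close>.\<close>
  have "(\<Sum>j\<in>{1..N}. ?w j * of_bool (?t j \<and> ?V i \<le> inflated_score S \<Delta> i j (design \<omega>) (units \<omega> j)))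
    \<le> (\<Sum>j\<in>{1..N}. of_bool (?t j) * (?w j * of_bool (?V j \<ge> ?V i))
        + of_bool (?t j \<and> i \<in> nbhd j ?x) * (?w j * of_bool (?V i - ?\<Delta> j \<le> ?V j \<and> ?V j < ?V i)))"
  proof (rule sum_mono)
    fix j assume j: "j \<in> {1..N}"
    show "?w j * of_bool (?t j \<and> ?V i \<le> inflated_score S \<Delta> i j (design \<omega>) (units \<omega> j))
      \<le> of_bool (?t j) * (?w j * of_bool (?V j \<ge> ?V i))
        + of_bool (?t j \<and> i \<in> nbhd j ?x) * (?w j * of_bool (?V i - ?\<Delta> j \<le> ?V j \<and> ?V j < ?V i))"
      unfolding inflated[OF j] using w[OF j] by (auto simp: of_bool_def)
  qed
  also have "\<dots> = (\<Sum>j\<in>treated N ?t. ?w j * of_bool (?V j \<ge> ?V i)) + ?num'"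
    unfolding treated_sum affected_sum by (rule sum.distrib)
  finally have "?w i + (\<Sum>j\<in>{1..N}. ?w j * of_bool (?t j \<and> ?V i \<le> inflated_score S \<Delta> i j (design \<omega>) (units \<omega> j)))
      \<le> \<alpha> * ?total"
    using num by linarith
  moreover have "?total = ?w i + total_weight (design \<omega>)"
    unfolding treated_sum total_weight_def by (simp add: design_def)
  moreover have "S (?x i, units \<omega> i) = ?V i" using i by (simp add: units_def vec_of_def)
  ultimately show ?thesis
    unfolding small_obs_def by (simp add: design_def)
qed

lemma nn_integral_PiM_unit_kernel:
  assumes d: "d \<in> space design_space"
    and P: "Measurable.pred (design_space \<Otimes>\<^sub>M vec_space N unit_space) (\<lambda>p. P (fst p) (snd p))"
  shows "(\<integral>\<^sup>+z. of_bool (P d z) \<partial>PiM {1..N} (\<lambda>j. unit_kernel j d))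
    = emeasure (PiM {1..N} (\<lambda>j. unit_kernel j d)) {z \<in> space (vec_space N unit_space). P d z}"
proof -
  let ?K = "PiM {1..N} (\<lambda>j. unit_kernel j d)"
  have s: "sets ?K = sets (vec_space N unit_space)"
    using prob_space_unit_kernel(2)[OF _ d] by (intro sets_PiM_cong) auto
  have "{z \<in> space (vec_space N unit_space). P d z} \<in> sets ?K"
    using measurable_compose[OF measurable_Pair1'[OF d] P] s by (simp add: pred_def)
  then have "emeasure ?K {z \<in> space (vec_space N unit_space). P d z}
      = (\<integral>\<^sup>+z. indicator {z \<in> space (vec_space N unit_space). P d z} z \<partial>?K)" by simp
  also have "\<dots> = (\<integral>\<^sup>+z. of_bool (P d z) \<partial>?K)"
    using sets_eq_imp_space_eq[OF s] by (intro nn_integral_cong) (auto simp: indicator_def)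
  finally show ?thesis ..
qed

text \<open>The deterministic rank bound for the treated units of one design, with allowance
  \<alpha> times their total weight.\<close>

lemma sum_small_int_le:
  assumes "d \<in> space design_space" "0 \<le> \<alpha>"
  shows "(\<Sum>i\<in>{1..N}. of_bool (snd d i) * ennreal (weight \<pi> (fst d i)) * of_bool (small_int S \<alpha> i d z))
    \<le> ennreal \<alpha> * (\<Sum>i\<in>{1..N}. of_bool (snd d i) * ennreal (weight \<pi> (fst d i)))"
proof -
  let ?w = "\<lambda>j. weight \<pi> (fst d j)" and ?s = "\<lambda>j. S (fst d j, z j)"
  let ?J = "{j \<in> {1..N}. snd d j}"
  have "fst d j \<in> space MX" if "j \<in> {1..N}" for j
    using assms that by (auto simp: space_pair_measure space_PiM PiE_iff)
  then have w: "0 \<le> ?w j" if "j \<in> {1..N}" for j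
    using propensity_range(3) that by (simp add: less_imp_le)
  have J: "(\<Sum>j\<in>?J. f j) = (\<Sum>j\<in>{1..N}. of_bool (snd d j) * f j)" for f :: "nat \<Rightarrow> real"
    by (rule sum.mono_neutral_cong_left) auto
  have small: "small_int S \<alpha> i d z \<longleftrightarrow> (\<Sum>j\<in>?J. ?w j * of_bool (?s j \<ge> ?s i)) \<le> \<alpha> * total_weight d" for i
    unfolding small_int_def J by (simp add: of_bool_conj mult_ac)
  have tot: "0 \<le> total_weight d"
    unfolding total_weight_def using w by (intro sum_nonneg) auto
  have "(\<Sum>i\<in>{1..N}. of_bool (snd d i) * ennreal (?w i) * of_bool (small_int S \<alpha> i d z))
      = (\<Sum>i\<in>{1..N}. ennreal (of_bool (snd d i) * (?w i * of_bool (small_int S \<alpha> i d z))))"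
    by (intro sum.cong) (auto simp: of_bool_def)
  also have "\<dots> = ennreal (\<Sum>i\<in>?J. ?w i * of_bool (small_int S \<alpha> i d z))"
    unfolding J using w by (intro sum_ennreal) auto
  also have "\<dots> \<le> ennreal (\<alpha> * total_weight d)"
    unfolding small using w tot assms(2)
    by (intro ennreal_leI sum_weights_small_p_value_le) auto
  also have "\<dots> = ennreal \<alpha> * ennreal (\<Sum>i\<in>{1..N}. of_bool (snd d i) * ?w i)"
    using tot assms(2) by (simp add: ennreal_mult total_weight_def)
  also have "ennreal (\<Sum>i\<in>{1..N}. of_bool (snd d i) * ?w i) = (\<Sum>i\<in>{1..N}. ennreal (of_bool (snd d i) * ?w i))"
    using w by (intro sum_ennreal[symmetric]) auto
  also have "\<dots> = (\<Sum>i\<in>{1..N}. of_bool (snd d i) * ennreal (?w i))"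
    by (intro sum.cong) (auto simp: of_bool_def)
  finally show ?thesis .
qed

end

section \<open>Averaging over the target and the coverage bound\<close>

context interventional_interference
begin

text \<open>For each target the error is moved to the switched design and then, by the weighted
  change of treatment, back to the original law with the target treated. There all targets live
  under one law, so the deterministic rank bound applies pointwise to the sum.\<close>

lemma sum_emeasure_small_obs_le:
  assumes S [measurable]: "S \<in> borel_measurable (MX \<Otimes>\<^sub>M unit_space)" and \<alpha>: "0 \<le> \<alpha>"
    and stability: "score_stability M N MX ME MY nbhd S X T E Y I E_int Y1_int \<Delta>"
  shows "(\<Sum>i\<in>{1..N}. emeasure M {\<omega> \<in> space M. \<not> T i \<omega> \<and> small_obs S \<Delta> \<alpha> i (design \<omega>) (units \<omega>)})
    \<le> ennreal \<alpha> * (\<Sum>i\<in>{1..N}. emeasure M {\<omega> \<in> space M. \<not> T i \<omega>})"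
proof -
  have \<Delta>: "\<Delta> j \<in> borel_measurable
      (vec_space N MX \<Otimes>\<^sub>M vec_space N bool_space \<Otimes>\<^sub>M count_space {1..N} \<Otimes>\<^sub>M unit_space)" if "j \<in> {1..N}" for j
    using stability that by (simp add: score_stability_def)
  define K where "K d = PiM {1..N} (\<lambda>j. unit_kernel j d)" for d
  have K: "K \<in> design_space \<rightarrow>\<^sub>M subprob_algebra (vec_space N unit_space)"
    unfolding K_def by (intro measurable_prob_algebraD measurable_PiM_prob_algebra unit_kernel_measurable) auto
  \<comment> \<open>The units are integrated out here to leave a function of the design alone, as
    the change of treatment requires.\<close>
  define H where "H i d = (\<integral>\<^sup>+z. of_bool (small_int S \<alpha> i d z) \<partial>K d)" for i d
  have dT: "snd (design \<omega>) i = T i \<omega>" "fst (design \<omega>) i = X i \<omega>" if "i \<in> {1..N}" for i \<omega>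
    using that by (simp_all add: design_def vec_of_def)
  have space_D: "design \<omega> \<in> space design_space" if "\<omega> \<in> space M" for \<omega>
    using measurable_space[OF design_measurable that] .
  let ?f2 = "\<lambda>i p. of_bool (snd (fst p) i) * ennreal (weight \<pi> (fst (fst p) i)) * of_bool (small_int S \<alpha> i (fst p) (snd p)) :: ennreal"
  have f2: "?f2 i \<in> borel_measurable (design_space \<Otimes>\<^sub>M vec_space N unit_space)" if [measurable]: "i \<in> {1..N}" for i
    using small_int_measurable[OF S that, of \<alpha>] by measurable
  have each: "emeasure M {\<omega> \<in> space M. \<not> T i \<omega> \<and> small_obs S \<Delta> \<alpha> i (design \<omega>) (units \<omega>)}
      \<le> (\<integral>\<^sup>+\<omega>. ?f2 i (design \<omega>, units \<omega>) \<partial>M)" if i [measurable]: "i \<in> {1..N}" for i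
  proof -
    have so [measurable]: "Measurable.pred (design_space \<Otimes>\<^sub>M vec_space N unit_space) (\<lambda>p. small_obs S \<Delta> \<alpha> i (fst p) (snd p))"
      by (rule small_obs_measurable[OF S \<Delta> i])
    have si [measurable]: "Measurable.pred (design_space \<Otimes>\<^sub>M vec_space N unit_space) (\<lambda>p. small_int S \<alpha> i (fst p) (snd p))"
      by (rule small_int_measurable[OF S i])
    have H [measurable]: "H i \<in> borel_measurable design_space"
      unfolding H_def by (rule nn_integral_measurable_subprob_algebra2[OF _ K]) measurable
    let ?f1 = "\<lambda>p. of_bool (\<not> snd (fst p) i) * of_bool (small_obs S \<Delta> \<alpha> i (fst p) (snd p)) :: ennreal"
    have "Measurable.pred M (\<lambda>\<omega>. small_obs S \<Delta> \<alpha> i (design \<omega>) (units \<omega>))"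
      using measurable_compose[of "\<lambda>\<omega>. (design \<omega>, units \<omega>)" M, OF _ so] by simp
    then have "{\<omega> \<in> space M. \<not> T i \<omega> \<and> small_obs S \<Delta> \<alpha> i (design \<omega>) (units \<omega>)} \<in> sets M" by measurable
    then have "emeasure M {\<omega> \<in> space M. \<not> T i \<omega> \<and> small_obs S \<Delta> \<alpha> i (design \<omega>) (units \<omega>)}
        = (\<integral>\<^sup>+\<omega>. indicator {\<omega> \<in> space M. \<not> T i \<omega> \<and> small_obs S \<Delta> \<alpha> i (design \<omega>) (units \<omega>)} \<omega> \<partial>M)"
      by simp
    also have "\<dots> = (\<integral>\<^sup>+\<omega>. ?f1 (design \<omega>, units \<omega>) \<partial>M)"
      using dT[OF i] by (intro nn_integral_cong) (auto simp: indicator_def)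
    also have "\<dots> = (\<integral>\<^sup>+\<omega>. (\<integral>\<^sup>+z. ?f1 (design \<omega>, z) \<partial>PiM {1..N} (\<lambda>j. unit_kernel j (design \<omega>))) \<partial>M)"
      unfolding units_def by (rule nn_integral_units) measurable
    also have "\<dots> \<le> (\<integral>\<^sup>+\<omega>. of_bool (\<not> T i \<omega>) * H i (switch_on i (design \<omega>)) \<partial>M)"
    proof (rule nn_integral_mono_AE)
      \<comment> \<open>Finitely many units and countably many rational thresholds give one null set
        outside which all stability inequalities hold together.\<close>
      have "AE \<omega> in M. \<forall>j\<in>{1..N}. \<forall>s\<in>\<rat>. \<not> T i \<omega> \<and> T j \<omega> \<and> i \<in> nbhd j (vec_of N X \<omega>) \<longrightarrow>
          emeasure (unit_kernel j (switch_on i (design \<omega>))) {z \<in> space unit_space. s < S (X j \<omega>, z)}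
          \<le> emeasure (unit_kernel j (design \<omega>)) {z \<in> space unit_space. s < S (X j \<omega>, z) + \<Delta> j (vec_of N X \<omega>, vec_of N T \<omega>, i, z)}"
      proof (rule AE_finite_allI[OF finite_atLeastAtMost])
        fix j assume j: "j \<in> {1..N}"
        show "AE \<omega> in M. \<forall>s\<in>\<rat>. \<not> T i \<omega> \<and> T j \<omega> \<and> i \<in> nbhd j (vec_of N X \<omega>) \<longrightarrow>
          emeasure (unit_kernel j (switch_on i (design \<omega>))) {z \<in> space unit_space. s < S (X j \<omega>, z)}
          \<le> emeasure (unit_kernel j (design \<omega>)) {z \<in> space unit_space. s < S (X j \<omega>, z) + \<Delta> j (vec_of N X \<omega>, vec_of N T \<omega>, i, z)}"
          unfolding AE_ball_countable[OF countable_rat]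
          by (intro ballI AE_stability_kernel[OF i j S stability])
      qed
      then show "AE \<omega> in M. (\<integral>\<^sup>+z. ?f1 (design \<omega>, z) \<partial>PiM {1..N} (\<lambda>j. unit_kernel j (design \<omega>)))
          \<le> of_bool (\<not> T i \<omega>) * H i (switch_on i (design \<omega>))"
        using AE_space
      proof eventually_elim
        case (elim \<omega>)
        have d: "design \<omega> \<in> space design_space" using space_D elim by simp
        have fd: "switch_on i (design \<omega>) \<in> space design_space" by (rule measurable_space[OF switch_on_measurable[OF i] d])
        show ?case
        proof (cases "T i \<omega>")
          case False
          have "emeasure (PiM {1..N} (\<lambda>j. unit_kernel j (design \<omega>))) {z \<in> space (vec_space N unit_space). small_obs S \<Delta> \<alpha> i (design \<omega>) z}
              \<le> emeasure (PiM {1..N} (\<lambda>j. unit_kernel j (switch_on i (design \<omega>)))) {z \<in> space (vec_space N unit_space). small_int S \<alpha> i (switch_on i (design \<omega>)) z}"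
          proof (rule emeasure_small_obs_le[OF i d _ S \<Delta>])
            show "\<not> snd (design \<omega>) i" using False dT[OF i] by simp
            fix j and s :: real
            assume j: "j \<in> {1..N}" "snd (design \<omega>) j" "i \<in> nbhd j (fst (design \<omega>))" "s \<in> \<rat>"
            have d_eq: "fst (design \<omega>) = vec_of N X \<omega>" "snd (design \<omega>) = vec_of N T \<omega>"
              by (simp_all add: design_def)
            have Tj: "T j \<omega>" using j(2) unfolding dT(1)[OF j(1)] .
            have nj: "i \<in> nbhd j (vec_of N X \<omega>)" using j(3) unfolding d_eq .
            have "emeasure (unit_kernel j (switch_on i (design \<omega>))) {z \<in> space unit_space. s < S (X j \<omega>, z)}
              \<le> emeasure (unit_kernel j (design \<omega>)) {z \<in> space unit_space. s < S (X j \<omega>, z) + \<Delta> j (vec_of N X \<omega>, vec_of N T \<omega>, i, z)}"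
              using elim(1)[rule_format, OF j(1,4)] False Tj nj by blast
            then show "emeasure (unit_kernel j (switch_on i (design \<omega>))) {z \<in> space unit_space. s < S (fst (design \<omega>) j, z)}
              \<le> emeasure (unit_kernel j (design \<omega>)) {z \<in> space unit_space. s < S (fst (design \<omega>) j, z) + \<Delta> j (fst (design \<omega>), snd (design \<omega>), i, z)}"
              unfolding dT(2)[OF j(1)] unfolding d_eq .
          qed
          then show ?thesis
            using False dT(1)[OF i]
            by (simp add: H_def K_def nn_integral_PiM_unit_kernel[OF d so] nn_integral_PiM_unit_kernel[OF fd si])
        qed (simp add: dT(1)[OF i])
      qed
    qed
    also have "\<dots> = (\<integral>\<^sup>+\<omega>. of_bool (T i \<omega>) * ennreal (weight \<pi> (X i \<omega>)) * H i (design \<omega>) \<partial>M)"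
      by (rule nn_integral_switch_on[OF i H])
    also have "\<dots> = (\<integral>\<^sup>+\<omega>. (\<integral>\<^sup>+z. ?f2 i (design \<omega>, z) \<partial>PiM {1..N} (\<lambda>j. unit_kernel j (design \<omega>))) \<partial>M)"
    proof (rule nn_integral_cong)
      fix \<omega> assume "\<omega> \<in> space M"
      then have d: "design \<omega> \<in> space design_space" by (rule space_D)
      have "sets (PiM {1..N} (\<lambda>j. unit_kernel j (design \<omega>))) = sets (vec_space N unit_space)"
        using prob_space_unit_kernel(2)[OF _ d] by (intro sets_PiM_cong) auto
      moreover have "(\<lambda>z. of_bool (small_int S \<alpha> i (design \<omega>) z) :: ennreal) \<in> borel_measurable (vec_space N unit_space)"
        using measurable_compose[OF measurable_Pair1'[OF d] si] by simp
      ultimately have "(\<lambda>z. of_bool (small_int S \<alpha> i (design \<omega>) z) :: ennreal)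
          \<in> borel_measurable (PiM {1..N} (\<lambda>j. unit_kernel j (design \<omega>)))"
        by (simp cong: measurable_cong_sets)
      then show "of_bool (T i \<omega>) * ennreal (weight \<pi> (X i \<omega>)) * H i (design \<omega>)
          = (\<integral>\<^sup>+z. ?f2 i (design \<omega>, z) \<partial>PiM {1..N} (\<lambda>j. unit_kernel j (design \<omega>)))"
        by (simp add: nn_integral_cmult H_def K_def dT[OF i])
    qed
    also have "\<dots> = (\<integral>\<^sup>+\<omega>. ?f2 i (design \<omega>, units \<omega>) \<partial>M)"
      unfolding units_def by (rule nn_integral_units[OF f2[OF i], symmetric])
    finally show ?thesis .
  qed
  have f2M: "(\<lambda>\<omega>. ?f2 i (design \<omega>, units \<omega>)) \<in> borel_measurable M" if "i \<in> {1..N}" for i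
    by (rule measurable_compose[OF _ f2[OF that]]) measurable
  have "(\<Sum>i\<in>{1..N}. emeasure M {\<omega> \<in> space M. \<not> T i \<omega> \<and> small_obs S \<Delta> \<alpha> i (design \<omega>) (units \<omega>)})
      \<le> (\<Sum>i\<in>{1..N}. \<integral>\<^sup>+\<omega>. ?f2 i (design \<omega>, units \<omega>) \<partial>M)"
    by (rule sum_mono) (rule each)
  also have "\<dots> = (\<integral>\<^sup>+\<omega>. (\<Sum>i\<in>{1..N}. ?f2 i (design \<omega>, units \<omega>)) \<partial>M)"
    using f2M by (intro nn_integral_sum[symmetric])
  also have "\<dots> \<le> (\<integral>\<^sup>+\<omega>. ennreal \<alpha> * (\<Sum>i\<in>{1..N}. of_bool (T i \<omega>) * ennreal (weight \<pi> (X i \<omega>))) \<partial>M)"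
  proof (rule nn_integral_mono)
    fix \<omega> assume "\<omega> \<in> space M"
    have T_sum: "(\<Sum>i\<in>{1..N}. of_bool (T i \<omega>) * ennreal (weight \<pi> (X i \<omega>)))
        = (\<Sum>i\<in>{1..N}. of_bool (snd (design \<omega>) i) * ennreal (weight \<pi> (fst (design \<omega>) i)))"
      by (rule sum.cong[OF refl]) (simp only: dT)
    from sum_small_int_le[OF space_D[OF \<open>\<omega> \<in> space M\<close>] \<alpha>, of S "units \<omega>"]
    show "(\<Sum>i\<in>{1..N}. ?f2 i (design \<omega>, units \<omega>)) \<le> ennreal \<alpha> * (\<Sum>i\<in>{1..N}. of_bool (T i \<omega>) * ennreal (weight \<pi> (X i \<omega>)))"
      unfolding T_sum by simp
  qed
  also have "\<dots> = ennreal \<alpha> * (\<Sum>i\<in>{1..N}. \<integral>\<^sup>+\<omega>. of_bool (T i \<omega>) * ennreal (weight \<pi> (X i \<omega>)) \<partial>M)"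
    by (subst nn_integral_cmult, measurable) (subst nn_integral_sum, auto)
  \<comment> \<open>The change of treatment with the constant 1 identifies the expected weight of a
    treated unit with its probability of being untreated.\<close>
  also have "(\<Sum>i\<in>{1..N}. \<integral>\<^sup>+\<omega>. of_bool (T i \<omega>) * ennreal (weight \<pi> (X i \<omega>)) \<partial>M)
      = (\<Sum>i\<in>{1..N}. emeasure M {\<omega> \<in> space M. \<not> T i \<omega>})"
  proof (rule sum.cong[OF refl])
    fix i assume i [measurable]: "i \<in> {1..N}"
    have "emeasure M {\<omega> \<in> space M. \<not> T i \<omega>} = (\<integral>\<^sup>+\<omega>. indicator {\<omega> \<in> space M. \<not> T i \<omega>} \<omega> \<partial>M)"
      by (rule nn_integral_indicator[symmetric]) measurable
    also have "\<dots> = (\<integral>\<^sup>+\<omega>. of_bool (\<not> T i \<omega>) * 1 \<partial>M)"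
      by (intro nn_integral_cong) (auto simp: indicator_def)
    also have "\<dots> = (\<integral>\<^sup>+\<omega>. of_bool (T i \<omega>) * ennreal (weight \<pi> (X i \<omega>)) \<partial>M)"
      using nn_integral_switch_on[OF i, of "\<lambda>_. 1"] by simp
    finally show "(\<integral>\<^sup>+\<omega>. of_bool (T i \<omega>) * ennreal (weight \<pi> (X i \<omega>)) \<partial>M) = emeasure M {\<omega> \<in> space M. \<not> T i \<omega>}" ..
  qed
  finally show ?thesis .
qed

text \<open>The event is split according to the finitely many values of the target; on each piece it
  concerns a fixed unit, and independence gives the factor \<open>1 / N\<close>.\<close>

lemma emeasure_random_index:
  assumes R: "\<And>i. i \<in> {1..N} \<Longrightarrow> Measurable.pred (design_space \<Otimes>\<^sub>M vec_space N unit_space) (\<lambda>p. R i (fst p) (snd p))"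
  shows "{\<omega> \<in> space M. R (I \<omega>) (design \<omega>) (units \<omega>)} \<in> sets M" (is ?meas)
    and "emeasure M {\<omega> \<in> space M. R (I \<omega>) (design \<omega>) (units \<omega>)}
      = ennreal (1 / N) * (\<Sum>i\<in>{1..N}. emeasure M {\<omega> \<in> space M. R i (design \<omega>) (units \<omega>)})" (is ?eq)
proof -
  have RM [measurable]: "Measurable.pred M (\<lambda>\<omega>. R i (design \<omega>) (units \<omega>))" if "i \<in> {1..N}" for i
    using measurable_compose[of "\<lambda>\<omega>. (design \<omega>, units \<omega>)" M, OF _ R[OF that]] by simp
  have I: "I \<omega> \<in> {1..N}" if "\<omega> \<in> space M" for \<omega>
    using measurable_space[OF I_measurable that] by simp
  let ?A = "\<lambda>i. {\<omega> \<in> space M. I \<omega> = i \<and> R i (design \<omega>) (units \<omega>)}"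
  have union: "{\<omega> \<in> space M. R (I \<omega>) (design \<omega>) (units \<omega>)} = (\<Union>i\<in>{1..N}. ?A i)"
    using I by blast
  have A: "?A i \<in> sets M" if [measurable]: "i \<in> {1..N}" for i by measurable
  show ?meas unfolding union using A by (intro sets.finite_UN) auto
  have "emeasure M {\<omega> \<in> space M. R (I \<omega>) (design \<omega>) (units \<omega>)} = (\<Sum>i\<in>{1..N}. emeasure M (?A i))"
    unfolding union using A by (intro sum_emeasure[symmetric]) (auto simp: disjoint_family_on_def)
  also have "\<dots> = (\<Sum>i\<in>{1..N}. ennreal (1 / N) * emeasure M {\<omega> \<in> space M. R i (design \<omega>) (units \<omega>)})"
  proof (rule sum.cong[OF refl])
    fix i assume i [measurable]: "i \<in> {1..N}"
    note [measurable] = R[OF i]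
    have "emeasure M (?A i) = (\<integral>\<^sup>+\<omega>. indicator (?A i) \<omega> \<partial>M)" using A[OF i] by simp
    also have "\<dots> = (\<integral>\<^sup>+\<omega>. indicator {i} (I \<omega>) * of_bool (R i (design \<omega>) (units \<omega>)) \<partial>M)"
      by (intro nn_integral_cong) (auto simp: indicator_def)
    also have "\<dots> = ennreal (1 / N) * (\<integral>\<^sup>+\<omega>. of_bool (R i (design \<omega>) (units \<omega>)) \<partial>M)"
      using nn_integral_index[OF i, of "\<lambda>p. of_bool (R i (fst p) (snd p))"] by simp
    also have "(\<integral>\<^sup>+\<omega>. of_bool (R i (design \<omega>) (units \<omega>)) \<partial>M)
        = (\<integral>\<^sup>+\<omega>. indicator {\<omega> \<in> space M. R i (design \<omega>) (units \<omega>)} \<omega> \<partial>M)"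
      by (intro nn_integral_cong) (auto simp: indicator_def)
    also have "\<dots> = emeasure M {\<omega> \<in> space M. R i (design \<omega>) (units \<omega>)}"
      by (rule nn_integral_indicator) measurable
    finally show "emeasure M (?A i) = ennreal (1 / N) * emeasure M {\<omega> \<in> space M. R i (design \<omega>) (units \<omega>)}" .
  qed
  finally show ?eq by (simp only: sum_distrib_left)
qed

lemma cond_prob_miss_le:
  assumes S: "S \<in> borel_measurable (MX \<Otimes>\<^sub>M unit_space)" and \<alpha>: "0 \<le> \<alpha>"
    and stability: "score_stability M N MX ME MY nbhd S X T E Y I E_int Y1_int \<Delta>"
  shows "\<P>(\<omega> in M. Y True (I \<omega>) \<omega> \<notin>
           IA_WCP_plus \<alpha> MY N \<pi> nbhd S \<Delta> (vec_of N X \<omega>) (vec_of N T \<omega>) (vec_of N E \<omega>) (vec_of N (Y True) \<omega>) (I \<omega>)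
         \<bar> \<not> T (I \<omega>) \<omega>) \<le> \<alpha>"
proof -
  have \<Delta>: "\<Delta> j \<in> borel_measurable
      (vec_space N MX \<Otimes>\<^sub>M vec_space N bool_space \<Otimes>\<^sub>M count_space {1..N} \<Otimes>\<^sub>M unit_space)" if "j \<in> {1..N}" for j
    using stability that by (simp add: score_stability_def)
  have I: "I \<omega> \<in> {1..N}" if "\<omega> \<in> space M" for \<omega>
    using measurable_space[OF I_measurable that] by simp
  have dT: "snd (design \<omega>) i = T i \<omega>" if "i \<in> {1..N}" for i \<omega>
    using that by (simp add: design_def vec_of_def)
  \<comment> \<open>\<open>?Q\<close> ignores the units, so that the conditioning event is averaged
    over targets by the same lemma as the error event.\<close>
  let ?Q = "\<lambda>i d z. \<not> snd d i" and ?R = "\<lambda>i d z. \<not> snd d i \<and> small_obs S \<Delta> \<alpha> i d z"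
  have Q: "Measurable.pred (design_space \<Otimes>\<^sub>M vec_space N unit_space) (\<lambda>p. ?Q i (fst p) (snd p))"
    if [measurable]: "i \<in> {1..N}" for i by measurable
  have R: "Measurable.pred (design_space \<Otimes>\<^sub>M vec_space N unit_space) (\<lambda>p. ?R i (fst p) (snd p))"
    if [measurable]: "i \<in> {1..N}" for i
    using small_obs_measurable[where \<alpha> = \<alpha>, OF S \<Delta> that] by measurable
  let ?bad = "{\<omega> \<in> space M. Y True (I \<omega>) \<omega> \<notin> IA_WCP_plus \<alpha> MY N \<pi> nbhd S \<Delta>
      (vec_of N X \<omega>) (vec_of N T \<omega>) (vec_of N E \<omega>) (vec_of N (Y True) \<omega>) (I \<omega>) \<and> \<not> T (I \<omega>) \<omega>}"
  let ?small = "{\<omega> \<in> space M. ?R (I \<omega>) (design \<omega>) (units \<omega>)}"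
  let ?untreated = "{\<omega> \<in> space M. ?Q (I \<omega>) (design \<omega>) (units \<omega>)}"
  have untreated: "{\<omega> \<in> space M. \<not> T (I \<omega>) \<omega>} = ?untreated"
    using I dT by auto
  have "?bad \<subseteq> ?small"
    using I dT not_in_IA_WCP_plus_imp_small_obs by auto
  \<comment> \<open>Monotonicity asks measurability of the larger set only, so none has to be shown
    for the miscoverage event.\<close>
  then have "measure M ?bad \<le> measure M ?small"
    using emeasure_random_index(1)[of ?R, OF R] by (intro finite_measure_mono) auto
  also have "\<dots> \<le> \<alpha> * measure M ?untreated"
  proof -
    have sum_R: "(\<Sum>i\<in>{1..N}. emeasure M {\<omega> \<in> space M. ?R i (design \<omega>) (units \<omega>)})
        = (\<Sum>i\<in>{1..N}. emeasure M {\<omega> \<in> space M. \<not> T i \<omega> \<and> small_obs S \<Delta> \<alpha> i (design \<omega>) (units \<omega>)})"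
      by (rule sum.cong[OF refl]) (simp only: dT)
    have sum_Q: "(\<Sum>i\<in>{1..N}. emeasure M {\<omega> \<in> space M. ?Q i (design \<omega>) (units \<omega>)})
        = (\<Sum>i\<in>{1..N}. emeasure M {\<omega> \<in> space M. \<not> T i \<omega>})"
      by (rule sum.cong[OF refl]) (simp only: dT)
    have "emeasure M ?small = ennreal (1 / N) * (\<Sum>i\<in>{1..N}. emeasure M {\<omega> \<in> space M. ?R i (design \<omega>) (units \<omega>)})"
      by (rule emeasure_random_index(2)[of ?R, OF R])
    also have "\<dots> = ennreal (1 / N) * (\<Sum>i\<in>{1..N}. emeasure M {\<omega> \<in> space M. \<not> T i \<omega> \<and> small_obs S \<Delta> \<alpha> i (design \<omega>) (units \<omega>)})"
      by (simp only: sum_R)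
    also have "\<dots> \<le> ennreal (1 / N) * (ennreal \<alpha> * (\<Sum>i\<in>{1..N}. emeasure M {\<omega> \<in> space M. \<not> T i \<omega>}))"
      by (intro mult_left_mono sum_emeasure_small_obs_le[OF S \<alpha> stability]) simp
    also have "\<dots> = ennreal \<alpha> * (ennreal (1 / N) * (\<Sum>i\<in>{1..N}. emeasure M {\<omega> \<in> space M. ?Q i (design \<omega>) (units \<omega>)}))"
      by (simp only: sum_Q mult.left_commute)
    also have "\<dots> = ennreal \<alpha> * emeasure M ?untreated"
      by (subst emeasure_random_index(2)[of ?Q, OF Q]) auto
    finally show ?thesis
      using \<alpha> by (simp add: emeasure_eq_measure ennreal_mult[symmetric])
  qed
  finally have "measure M ?bad \<le> \<alpha> * measure M {\<omega> \<in> space M. \<not> T (I \<omega>) \<omega>}"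
    unfolding untreated .
  then show ?thesis
    unfolding cond_prob_def using \<alpha>
    \<comment> \<open>Where the conditioning event has measure zero, the quotient is 0 by
      convention, and 0 is at most \<alpha>.\<close>
    by (cases "measure M {\<omega> \<in> space M. \<not> T (I \<omega>) \<omega>} = 0") (auto simp: divide_le_eq measure_nonneg less_le)
qed

end

theorem theorem2:
  fixes M :: "'w measure" and N :: nat
    and MX :: "'x measure" and ME :: "'e measure" and MY :: "'y measure"
    and PX :: "'x measure"
    and \<pi> :: "'x \<Rightarrow> real" and \<pi>_min :: real
    and nbhd :: "nat \<Rightarrow> (nat \<Rightarrow> 'x) \<Rightarrow> nat set"
    and PE :: "'x \<times> ('x \<times> bool) multiset \<Rightarrow> 'e measure"
    and PY :: "bool \<Rightarrow> 'x \<times> 'e \<Rightarrow> 'y measure"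
    and X :: "nat \<Rightarrow> 'w \<Rightarrow> 'x" and T :: "nat \<Rightarrow> 'w \<Rightarrow> bool" and E :: "nat \<Rightarrow> 'w \<Rightarrow> 'e"
    and Y :: "bool \<Rightarrow> nat \<Rightarrow> 'w \<Rightarrow> 'y" and Y_obs :: "nat \<Rightarrow> 'w \<Rightarrow> 'y"
    and I :: "'w \<Rightarrow> nat" and E_int :: "nat \<Rightarrow> 'w \<Rightarrow> 'e" and Y1_int :: "nat \<Rightarrow> 'w \<Rightarrow> 'y"
    and S :: "'x \<times> 'e \<times> 'y \<Rightarrow> real"
    and \<Delta> :: "nat \<Rightarrow> (nat \<Rightarrow> 'x) \<times> (nat \<Rightarrow> bool) \<times> nat \<times> 'e \<times> 'y \<Rightarrow> real"
    and \<alpha> :: real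
  assumes model: "interventional_interference M N MX ME MY PX \<pi> \<pi>_min nbhd PE PY X T E Y Y_obs I E_int Y1_int"
    and score: "S \<in> borel_measurable (MX \<Otimes>\<^sub>M ME \<Otimes>\<^sub>M MY)"
    and level: "0 < \<alpha>" "\<alpha> < 1"
    and stability: "score_stability M N MX ME MY nbhd S X T E Y I E_int Y1_int \<Delta>"
  shows "\<P>(\<omega> in M. Y True (I \<omega>) \<omega> \<notin>
           IA_WCP_plus \<alpha> MY N \<pi> nbhd S \<Delta> (vec_of N X \<omega>) (vec_of N T \<omega>) (vec_of N E \<omega>) (vec_of N (Y True) \<omega>) (I \<omega>)
         \<bar> \<not> T (I \<omega>) \<omega>) \<le> \<alpha>"
proof -
  interpret interventional_interference M N MX ME MY PX \<pi> \<pi>_min nbhd PE PY X T E Y Y_obs I E_int Y1_int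
    by (rule model)
  show ?thesis
    by (rule cond_prob_miss_le[OF score less_imp_le[OF level(1)] stability])
qed

end
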